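(* The topological conjugacy relation of chaotic invertible dynamical systems on the Cantor space is Borel bireducible with $E_{S_\infty}$, the universal orbit equivalence relation induced by Borel actions of the permutation group $S_\infty$ on Polish spaces. That is, writing $C$ for the Cantor space and $E$ for the equivalence relation of topological conjugacy on the set of all homeomorphisms $T:C\to C$ such that $(C,T)$ is chaotic, one has $E\leq_B E_{S_\infty}$ and $E_{S_\infty}\leq_B E$.
   Context: The Cantor space is the (up to homeomorphism unique) nonempty compact metrizable zero-dimensional space without isolated points. A dynamical system is a pair $(X,T)$ where $X$ is a compact metrizable space and $T:X\to X$ is continuous; it is invertible if $T$ is a homeomorphism. Two systems $(X,T)$, $(Y,S)$ are (topologically) conjugate if there is a homeomorphism $h:X\to Y$ with $h\circ T=S\circ h$. $(X,T)$ is (Devaney) chaotic if for every finite cover $\mathcal U$ of $X$ by nonempty open sets there is a periodic point $x\in X$ whose orbit $\{T^n(x):n\ge 0\}$ meets every element of $\mathcal U$; equivalently, $T$ is transitive (for all nonempty open $U,V$ there is $n\ge0$ with $T^n(U)\cap V\ne\emptyset$) and has a dense set of periodic points. For equivalence relations $E$ on $X$ and $F$ on $Y$, where $X,Y$ are Polish (or standard Borel) spaces, $E\leq_B F$ (Borel reducible) means there is a Borel map $f:X\to Y$ with $x\,E\,x'\iff f(x)\,F\,f(x')$ for all $x,x'\in X$. $E$ and $F$ are Borel bireducible if $E\leq_B F$ and $F\leq_B E$. Maps of the Cantor space $C$ into itself are regarded as elements of the Polish space $C(C,C)$ of continuous self-maps with the topology of uniform convergence. $S_\infty$ is the Polish group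 of all permutations of $\mathbb N$. $E_{S_\infty}$ denotes an orbit equivalence relation of a Borel action of $S_\infty$ on a Polish space that is universal: every orbit equivalence relation induced by a Borel action of $S_\infty$ on a Polish space is Borel reducible to it (such a relation exists and is unique up to Borel bireducibility). *)

theory Defs
  imports "HOL-Analysis.Analysis" "HOL-Algebra.Group_Action"
begin

section \<open>Borel sets and Polish spaces for abstract topologies\<close>

definition borel_of :: "'a topology \<Rightarrow> 'a measure" where
  "borel_of X = sigma (topspace X) {U. openin X U}"

lemma space_borel_of [simp]: "space (borel_of X) = topspace X"
  unfolding borel_of_def by (rule space_measure_of) (auto dest: openin_subset)

lemma sets_borel_of: "sets (borel_of X) = sigma_sets (topspace X) {U. openin X U}"
  unfolding borel_of_def by (rule sets_measure_of) (auto dest: openin_subset)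

definition Polish_space :: "'a topology \<Rightarrow> bool" where
  "Polish_space X \<longleftrightarrow> completely_metrizable_space X \<and> separable_space X"

section \<open>Borel reducibility\<close>

definition borel_reducible ::
    "'a measure \<Rightarrow> 'a rel \<Rightarrow> 'b measure \<Rightarrow> 'b rel \<Rightarrow> bool" where
  "borel_reducible M E N F \<longleftrightarrow>
     (\<exists>f \<in> measurable M N. \<forall>x \<in> space M. \<forall>y \<in> space M. (x, y) \<in> E \<longleftrightarrow> (f x, f y) \<in> F)"

definition borel_bireducible ::
    "'a measure \<Rightarrow> 'a rel \<Rightarrow> 'b measure \<Rightarrow> 'b rel \<Rightarrow> bool" where
  "borel_bireducible M E N F \<longleftrightarrow> borel_reducible M E N F \<and> borel_reducible N F M E"

section \<open>Borel actions of the permutation group of the natural numbers\<close>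

definition S_infty :: "(nat \<Rightarrow> nat) monoid" where
  "S_infty = BijGroup UNIV"

text \<open>The topology of pointwise convergence, i.e. the subspace topology inherited from the
  product topology on functions from \<open>nat\<close> to (discrete) \<open>nat\<close>.\<close>

definition S_infty_topology :: "(nat \<Rightarrow> nat) topology" where
  "S_infty_topology = top_of_set (carrier S_infty)"

definition Borel_S_infty_action ::
    "'a topology \<Rightarrow> ((nat \<Rightarrow> nat) \<Rightarrow> 'a \<Rightarrow> 'a) \<Rightarrow> bool" where
  "Borel_S_infty_action X a \<longleftrightarrow>
     Polish_space X \<and> group_action S_infty (topspace X) a \<and>
     (\<lambda>(g, x). a g x) \<in> measurable (borel_of (prod_topology S_infty_topology X)) (borel_of X)"

definition orbit_eqrel :: "'a topology \<Rightarrow> ((nat \<Rightarrow> nat) \<Rightarrow> 'a \<Rightarrow> 'a) \<Rightarrow> 'a rel" where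
  "orbit_eqrel X a = {(x, y). x \<in> topspace X \<and> y \<in> orbit S_infty a x}"

text \<open>HOL cannot quantify over the underlying type of the Polish space \<open>Y\<close> inside a formula. The
  points of \<open>Y\<close> are therefore taken from the type \<open>nat set\<close>, which has the cardinality of the
  continuum; the topology on them is arbitrary. As a Polish space has at most continuum many
  points, this loses no generality: see \<open>universal_S_infty_actionD\<close> below, where the type of
  \<open>Y\<close> is arbitrary.\<close>

definition universal_S_infty_action ::
    "'a topology \<Rightarrow> ((nat \<Rightarrow> nat) \<Rightarrow> 'a \<Rightarrow> 'a) \<Rightarrow> bool" where
  "universal_S_infty_action X a \<longleftrightarrow>
     Borel_S_infty_action X a \<and>
     (\<forall>(Y :: nat set topology) b. Borel_S_infty_action Y b \<longrightarrow>
        borel_reducible (borel_of Y) (orbit_eqrel Y b) (borel_of X) (orbit_eqrel X a))"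

lemma borel_reducible_trans:
  assumes "borel_reducible M E N F" "borel_reducible N F K G"
  shows "borel_reducible M E K G"
proof -
  obtain f where f: "f \<in> measurable M N"
    and fE: "\<And>x y. x \<in> space M \<Longrightarrow> y \<in> space M \<Longrightarrow> (x, y) \<in> E \<longleftrightarrow> (f x, f y) \<in> F"
    using assms(1) unfolding borel_reducible_def by blast
  obtain g where g: "g \<in> measurable N K"
    and gE: "\<And>x y. x \<in> space N \<Longrightarrow> y \<in> space N \<Longrightarrow> (x, y) \<in> F \<longleftrightarrow> (g x, g y) \<in> G"
    using assms(2) unfolding borel_reducible_def by blast
  have "(x, y) \<in> E \<longleftrightarrow> (g (f x), g (f y)) \<in> G" if "x \<in> space M" "y \<in> space M" for x y
    using that fE gE measurable_space[OF f] by blast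
  moreover have "(\<lambda>x. g (f x)) \<in> measurable M K"
    using f g by (rule measurable_compose)
  ultimately show ?thesis
    unfolding borel_reducible_def by (intro bexI[of _ "\<lambda>x. g (f x)"]) auto
qed

lemma continuous_map_measurable_borel_of:
  assumes "continuous_map X Y f"
  shows "f \<in> measurable (borel_of X) (borel_of Y)"
  unfolding borel_of_def[of Y]
proof (rule measurable_measure_of)
  show "{U. openin Y U} \<subseteq> Pow (topspace Y)"
    by (auto dest: openin_subset)
  show "f \<in> space (borel_of X) \<rightarrow> topspace Y"
    using continuous_map_funspace[OF assms] by simp
next
  fix U assume "U \<in> {U. openin Y U}"
  then have "openin X {x \<in> topspace X. f x \<in> U}"
    using assms openin_continuous_map_preimage by blast
  moreover have "f -` U \<inter> space (borel_of X) = {x \<in> topspace X. f x \<in> U}"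
    by auto
  ultimately show "f -` U \<inter> space (borel_of X) \<in> sets (borel_of X)"
    by (simp add: sets_borel_of sigma_sets.Basic)
qed

lemma Polish_space_inj_nat_set:
  fixes Y :: "'b topology"
  assumes "Polish_space Y"
  obtains f :: "'b \<Rightarrow> nat set" where "inj_on f (topspace Y)"
proof (cases "topspace Y = {}")
  case True
  then show ?thesis using that[of undefined] by simp
next
  case False
  obtain M d where "Metric_space M d" and Y: "Y = Metric_space.mtopology M d"
    using assms unfolding Polish_space_def completely_metrizable_space_def by blast
  interpret Metric_space M d by fact
  obtain C where C: "countable C" "C \<subseteq> M" "mtopology closure_of C = M"
    using assms unfolding Polish_space_def separable_space_def Y by auto
  have "C \<noteq> {}" using C False Y by auto
  define c where "c = from_nat_into C"
  have rc: "range c = C"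
    unfolding c_def using C \<open>C \<noteq> {}\<close> by (simp add: range_from_nat_into)
  define f where "f x = {prod_encode (i, k) | i k. d x (c i) < 1 / (real k + 1)}" for x
  have f_iff: "prod_encode (i, k) \<in> f x \<longleftrightarrow> d x (c i) < 1 / (real k + 1)" for i k x
    unfolding f_def by auto
  have "inj_on f M"
  proof (rule inj_onI, rule ccontr)
    fix x y assume x: "x \<in> M" and y: "y \<in> M" and eq: "f x = f y" and ne: "x \<noteq> y"
    have "d x y > 0" using x y ne by simp
    then obtain k where k: "1 / (real k + 1) < d x y / 2"
      using nat_approx_posE[of "d x y / 2"] by (metis half_gt_zero of_nat_Suc add.commute)
    have "x \<in> mtopology closure_of C" using C x by simp
    then obtain z where z: "z \<in> C" "d x z < 1 / (real k + 1)"
      unfolding metric_closure_of by (auto simp: in_mball dest!: spec[of _ "1 / (real k + 1)"])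
    then obtain i where i: "z = c i" using rc by auto
    have "d x (c i) < 1 / (real k + 1)" using z i by simp
    moreover from this have "d y (c i) < 1 / (real k + 1)"
      using f_iff eq by blast
    moreover have "c i \<in> M" using rc C by auto
    ultimately show False
      using triangle[OF x _ y, of "c i"] commute[of y "c i"] k by linarith
  qed
  then show ?thesis using that[of f] Y by simp
qed

lemma universal_S_infty_actionD:
  fixes Y :: "'b topology"
  assumes univ: "universal_S_infty_action X a" and act: "Borel_S_infty_action Y b"
  shows "borel_reducible (borel_of Y) (orbit_eqrel Y b) (borel_of X) (orbit_eqrel X a)"
proof -
  have Pol: "Polish_space Y" and ga: "group_action S_infty (topspace Y) b"
    and meas: "(\<lambda>(g, x). b g x) \<in> measurable (borel_of (prod_topology S_infty_topology Y)) (borel_of Y)"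
    using act unfolding Borel_S_infty_action_def by auto
  interpret A: group_action S_infty "topspace Y" b by fact
  obtain f :: "'b \<Rightarrow> nat set" where inj: "inj_on f (topspace Y)"
    using Polish_space_inj_nat_set[OF Pol] .
  define S where "S = f ` topspace Y"
  define h where "h = inv_into (topspace Y) f"
  define Z where "Z = pullback_topology S h Y"
  have hf: "h (f x) = x" if "x \<in> topspace Y" for x
    unfolding h_def using that inj by simp
  have fh: "f (h z) = z" "h z \<in> topspace Y" if "z \<in> S" for z
    using that unfolding h_def S_def by (auto simp: f_inv_into_f inv_into_into)
  have tZ: "topspace Z = S"
    unfolding Z_def topspace_pullback_topology using fh by auto
  have ch: "continuous_map Z Y h"
    using continuous_map_pullback[of Y Y id S h] unfolding Z_def by simp
  have "continuous_map Y Y (h \<circ> f)"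
    using continuous_map_eq[of Y Y id "h \<circ> f"] hf by simp
  then have cf: "continuous_map Y Z f"
    unfolding Z_def by (rule continuous_map_pullback') (auto simp: S_def)
  have "homeomorphic_maps Y Z f h"
    unfolding homeomorphic_maps_def using ch cf hf fh tZ by auto
  then have hom: "Y homeomorphic_space Z"
    unfolding homeomorphic_space_def by blast
  have PolZ: "Polish_space Z"
    using Pol hom homeomorphic_completely_metrizable_space homeomorphic_separable_space
    unfolding Polish_space_def by blast
  define b' where "b' g = (\<lambda>z \<in> S. f (b g (h z)))" for g
  have bc: "b g x \<in> topspace Y" if "g \<in> carrier S_infty" "x \<in> topspace Y" for g x
    using A.element_image that by blast
  have grp: "group S_infty"
    using A.group_hom group_hom.axioms(1) by blast
  have bij: "b' g \<in> Bij S" if g: "g \<in> carrier S_infty" for g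
  proof -
    have "bij_betw h S (topspace Y)"
      by (rule bij_betw_byWitness[of _ f]) (use hf fh in \<open>auto simp: S_def\<close>)
    moreover have "bij_betw (b g) (topspace Y) (topspace Y)"
      using A.bij_prop0[OF g] by (simp add: Bij_def)
    moreover have "bij_betw f (topspace Y) S"
      unfolding S_def using inj by (rule inj_on_imp_bij_betw)
    ultimately have "bij_betw (f \<circ> (b g \<circ> h)) S S"
      by (meson bij_betw_trans)
    then have "bij_betw (b' g) S S"
      by (rule bij_betw_cong[THEN iffD1, rotated]) (simp add: b'_def)
    then show ?thesis
      by (simp add: Bij_def b'_def)
  qed
  have hommul: "b' (g1 \<otimes>\<^bsub>S_infty\<^esub> g2) = b' g1 \<otimes>\<^bsub>BijGroup S\<^esub> b' g2"
    if g: "g1 \<in> carrier S_infty" "g2 \<in> carrier S_infty" for g1 g2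
  proof -
    have "b' (g1 \<otimes>\<^bsub>S_infty\<^esub> g2) = compose S (b' g1) (b' g2)"
      unfolding compose_def b'_def
      using g A.composition_rule bc hf fh(2) S_def by (auto simp: restrict_def fun_eq_iff)
    then show ?thesis
      using bij g by (simp add: BijGroup_def)
  qed
  have "group_hom S_infty (BijGroup S) b'"
  proof (intro group_hom.intro group_hom_axioms.intro homI)
    show "b' g \<in> carrier (BijGroup S)" if "g \<in> carrier S_infty" for g
      using bij[OF that] by (simp add: BijGroup_def)
  qed (use grp group_BijGroup hommul in auto)
  then have gaZ: "group_action S_infty (topspace Z) b'"
    unfolding group_action_def tZ .
  have cm: "continuous_map (prod_topology S_infty_topology Z) (prod_topology S_infty_topology Y)
              (\<lambda>p. (fst p, h (snd p)))"
    using continuous_map_compose[OF continuous_map_snd ch, of S_infty_topology]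
    by (auto simp: continuous_map_pairedI continuous_map_fst comp_def)
  have "(\<lambda>p. f (case (fst p, h (snd p)) of (g, x) \<Rightarrow> b g x)) \<in>
          measurable (borel_of (prod_topology S_infty_topology Z)) (borel_of Z)"
    using measurable_compose[OF continuous_map_measurable_borel_of[OF cm]
        measurable_compose[OF meas continuous_map_measurable_borel_of[OF cf]]] .
  then have "(\<lambda>(g, z). b' g z) \<in>
          measurable (borel_of (prod_topology S_infty_topology Z)) (borel_of Z)"
    by (rule measurable_cong[THEN iffD1, rotated]) (auto simp: b'_def tZ)
  then have "Borel_S_infty_action Z b'"
    unfolding Borel_S_infty_action_def using PolZ gaZ by blast
  then have red: "borel_reducible (borel_of Z) (orbit_eqrel Z b') (borel_of X) (orbit_eqrel X a)"
    using univ unfolding universal_S_infty_action_def by blast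
  have "(x, y) \<in> orbit_eqrel Y b \<longleftrightarrow> (f x, f y) \<in> orbit_eqrel Z b'"
    if xy: "x \<in> topspace Y" "y \<in> topspace Y" for x y
  proof -
    have "b' g (f x) = f (b g x)" for g
      unfolding b'_def using xy hf S_def by simp
    then have "f y = b' g (f x) \<longleftrightarrow> y = b g x" if "g \<in> carrier S_infty" for g
      using inj_on_eq_iff[OF inj] bc that xy by simp
    then show ?thesis
      unfolding orbit_eqrel_def orbit_def using xy tZ S_def by auto
  qed
  then have "borel_reducible (borel_of Y) (orbit_eqrel Y b) (borel_of Z) (orbit_eqrel Z b')"
    unfolding borel_reducible_def
    using continuous_map_measurable_borel_of[OF cf] by auto
  then show ?thesis
    using red by (rule borel_reducible_trans)
qed

section \<open>Chaotic systems on the Cantor space\<close>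

definition zero_dimensional_space :: "'a topology \<Rightarrow> bool" where
  "zero_dimensional_space X \<longleftrightarrow>
     (\<forall>U x. openin X U \<and> x \<in> U \<longrightarrow> (\<exists>V. openin X V \<and> closedin X V \<and> x \<in> V \<and> V \<subseteq> U))"

definition Cantor_space :: "'a topology \<Rightarrow> bool" where
  "Cantor_space X \<longleftrightarrow>
     topspace X \<noteq> {} \<and> compact_space X \<and> metrizable_space X \<and> zero_dimensional_space X \<and>
     (\<forall>x \<in> topspace X. \<not> openin X {x})"

definition periodic_point :: "('a \<Rightarrow> 'a) \<Rightarrow> 'a \<Rightarrow> bool" where
  "periodic_point T x \<longleftrightarrow> (\<exists>n > 0. (T ^^ n) x = x)"

definition chaotic :: "'a topology \<Rightarrow> ('a \<Rightarrow> 'a) \<Rightarrow> bool" where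
  "chaotic X T \<longleftrightarrow>
     (\<forall>\<U>. finite \<U> \<and> (\<forall>U \<in> \<U>. openin X U \<and> U \<noteq> {}) \<and> \<Union>\<U> = topspace X \<longrightarrow>
        (\<exists>x \<in> topspace X. periodic_point T x \<and> (\<forall>U \<in> \<U>. \<exists>n. (T ^^ n) x \<in> U)))"

definition conjugate_systems ::
    "'a topology \<Rightarrow> ('a \<Rightarrow> 'a) \<Rightarrow> 'b topology \<Rightarrow> ('b \<Rightarrow> 'b) \<Rightarrow> bool" where
  "conjugate_systems X T Y S \<longleftrightarrow>
     (\<exists>h. homeomorphic_map X Y h \<and> (\<forall>x \<in> topspace X. h (T x) = S (h x)))"

text \<open>For a compact space \<open>X\<close> metrized by \<open>d\<close>, \<open>cfunspace X d\<close> consists of all continuous self-maps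
  of \<open>X\<close> (extensional, i.e. undefined off the carrier) with the supremum metric.\<close>

definition chaotic_homeos :: "'a topology \<Rightarrow> 'a metric \<Rightarrow> ('a \<Rightarrow> 'a) set" where
  "chaotic_homeos X d =
     {T \<in> mspace (cfunspace X d). homeomorphic_map X X T \<and> chaotic X T}"

definition chaotic_homeos_borel :: "'a topology \<Rightarrow> 'a metric \<Rightarrow> ('a \<Rightarrow> 'a) measure" where
  "chaotic_homeos_borel X d =
     borel_of (subtopology (mtopology_of (cfunspace X d)) (chaotic_homeos X d))"

definition chaotic_conjugacy :: "'a topology \<Rightarrow> 'a metric \<Rightarrow> ('a \<Rightarrow> 'a) rel" where
  "chaotic_conjugacy X d =
     {(T, S). T \<in> chaotic_homeos X d \<and> S \<in> chaotic_homeos X d \<and> conjugate_systems X T X S}"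

end

theory Submission
  imports Defs "HOL-Library.Sublist"
begin

text \<open>Upper bound: a homeomorphism of the Cantor space is coded by the countable Boolean algebra of
  clopen sets together with the induced automorphism, and Stone duality turns conjugacy into
  isomorphism of such structures, which is an orbit relation of \<open>S\<^sub>\<infinity>\<close>.

  Lower bound: following Becker and Kechris, an orbit of a Borel action of \<open>S\<^sub>\<infinity>\<close> is coded, by
  category quantifiers, by a countable set \<open>M\<close> of finite words over the natural numbers, taken up
  to permutations of the alphabet. From \<open>M\<close> we build a shift whose letters are the words in \<open>M\<close>
  and a letter \<open>\<infinity>\<close>, the limit of all others. A word may only be followed by \<open>\<infinity>\<close> or by a word
  reachable from it in a partial order on words, and every excursion of length \<open>n\<close> into \<open>M\<close> must be
  followed by \<open>n\<close> letters \<open>\<infinity>\<close>. Long gaps are always allowed, so the system is chaotic and has no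
  isolated points. But no point is backward asymptotic to the constant sequence of a word, forward
  asymptotic to that of another word, and visits \<open>\<infinity>\<close> in between, because the excursion before the
  gap is infinite. So the asymptotic connections between fixed points determine the order on \<open>M\<close>,
  hence \<open>M\<close> up to a permutation of the alphabet. Finally the shift is transported to the given Cantor
  space in a Borel way by greedily splitting clopen sets.\<close>

section \<open>Coding compact perfect zero-dimensional spaces by binary sequences\<close>

text \<open>Chaos is the obstacle: in a transitive system any finite pattern can eventually be
  followed by any other, so finite patterns alone cannot record the order on the words. What chaos
  leaves free is the asymptotic behaviour of single orbits. A gap as long as the preceding excursion
  separates the two: every finite window can be closed off by a finite gap, whereas an orbit that
  has always been active can never pause and become active again.

  The fixed points are the constant sequences and the all-inactive one. The latter is the only one
  connected to every fixed point, because all one-letter words belong to \<open>M\<close> and a word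
  reaches only its own letters. The one-letter words are the minimal elements of the order and so
  serve as intrinsic names of the alphabet, on which a permutation can act.

  The shift space depends on \<open>M\<close> only through the question which finite conjunctions of
  coordinate tests are satisfiable. These are countably many bits, and the Borel dependence on a
  parameter is reduced to their measurability.\<close>

lemma homeomorphic_maps_inv_into:
  assumes "homeomorphic_map X Y f"
  shows "homeomorphic_maps X Y f (inv_into (topspace X) f)"
proof -
  obtain g where "homeomorphic_maps X Y f g"
    using assms homeomorphic_map_maps by blast
  then have f: "continuous_map X Y f" and g: "continuous_map Y X g"
    and gf: "\<And>x. x \<in> topspace X \<Longrightarrow> g (f x) = x" and fg: "\<And>y. y \<in> topspace Y \<Longrightarrow> f (g y) = y"
    by (auto simp: homeomorphic_maps_def)
  have inj: "inj_on f (topspace X)"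
    using gf by (rule inj_on_inverseI)
  have gX: "g y \<in> topspace X" if "y \<in> topspace Y" for y
    using continuous_map_funspace[OF g] that by (rule funcset_mem)
  have eq: "g y = inv_into (topspace X) f y" if "y \<in> topspace Y" for y
    using inv_into_f_f[OF inj gX[OF that]] fg[OF that] by simp
  have "continuous_map Y X (inv_into (topspace X) f)"
    using g eq by (rule continuous_map_eq)
  then show ?thesis
    unfolding homeomorphic_maps_def using f inj eq fg by (simp add: inv_into_f_f)
qed

lemma open_coordinate: "open {x :: 'i \<Rightarrow> bool. x i = v}"
proof -
  have "open ((\<lambda>x :: 'i \<Rightarrow> bool. x i) -` {v})"
    by (rule open_vimage) (auto intro: open_discrete)
  then show ?thesis
    by (simp add: vimage_def)
qed

lemma closed_coordinate: "closed {x :: 'i \<Rightarrow> bool. x i = v}"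
proof -
  have "- {x :: 'i \<Rightarrow> bool. x i = v} = {x. x i = (\<not> v)}"
    by auto
  then show ?thesis
    using open_coordinate[of i "\<not> v"] by (simp add: closed_def)
qed

lemma Hausdorff_space_cube: "Hausdorff_space (euclidean :: ('i \<Rightarrow> bool) topology)"
  unfolding Hausdorff_space_def
proof (intro allI impI)
  fix x y :: "'i \<Rightarrow> bool"
  assume "x \<in> topspace euclidean \<and> y \<in> topspace euclidean \<and> x \<noteq> y"
  then obtain i where "x i \<noteq> y i" by auto
  then have "disjnt {z. z i = x i} {z. z i = y i}" "x \<in> {z. z i = x i}" "y \<in> {z. z i = y i}"
    by (auto simp: disjnt_def)
  then show "\<exists>U V. openin euclidean U \<and> openin euclidean V \<and> x \<in> U \<and> y \<in> V \<and> disjnt U V"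
    using open_coordinate by (metis open_openin)
qed

lemma compact_space_cube: "compact_space (euclidean :: ('i \<Rightarrow> bool) topology)"
proof -
  have "compact_space (euclidean :: bool topology)"
    by (simp add: compact_space_def finite_imp_compact)
  then show ?thesis
    unfolding euclidean_product_topology[symmetric] compact_space_product_topology by simp
qed

section \<open>Binary coding by greedy splitting with clopen tests\<close>

definition Sat :: "(nat \<Rightarrow> 'p set) \<Rightarrow> (nat \<times> bool) list \<Rightarrow> 'p set" where
  "Sat b L = {x. \<forall>(k, v) \<in> set L. (x \<in> b k) = v}"

text \<open>Satisfiability in \<open>A\<close> of a finite conjunction of tests. The cells of the
  coding are chosen from this predicate alone, so a space that varies with a parameter enters only
  through countably many bits.\<close>

definition meets :: "'p set \<Rightarrow> (nat \<Rightarrow> 'p set) \<Rightarrow> (nat \<times> bool) list \<Rightarrow> bool" where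
  "meets A b L \<longleftrightarrow> A \<inter> Sat b L \<noteq> {}"

lemma Sat_Nil [simp]: "Sat b [] = UNIV"
  by (simp add: Sat_def)

lemma Sat_Cons: "x \<in> Sat b ((k, v) # L) \<longleftrightarrow> (x \<in> b k) = v \<and> x \<in> Sat b L"
  by (auto simp: Sat_def)

definition split_index :: "((nat \<times> bool) list \<Rightarrow> bool) \<Rightarrow> (nat \<times> bool) list \<Rightarrow> nat" where
  "split_index P L = (LEAST n. P ((n, True) # L) \<and> P ((n, False) # L))"

text \<open>The latest decision stands at the head, here and in \<open>rev_prefix\<close>, so that
  refining a cell is a \<open>Cons\<close>.\<close>

primrec node :: "((nat \<times> bool) list \<Rightarrow> bool) \<Rightarrow> bool list \<Rightarrow> (nat \<times> bool) list" where
  "node P [] = []"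
| "node P (v # s) = (split_index P (node P s), v) # node P s"

primrec rev_prefix :: "(nat \<Rightarrow> 'c) \<Rightarrow> nat \<Rightarrow> 'c list" where
  "rev_prefix y 0 = []"
| "rev_prefix y (Suc n) = y n # rev_prefix y n"

lemma length_rev_prefix [simp]: "length (rev_prefix y n) = n"
  by (induction n) auto

lemma rev_prefix_eq_iff: "rev_prefix y n = rev_prefix z n \<longleftrightarrow> (\<forall>k<n. y k = z k)"
  by (induction n) (auto simp: less_Suc_eq)

text \<open>The tests need only be relatively clopen and separate points; that the resulting cells
  form a basis follows from compactness. They may be subsets of a larger ambient type, so one family
  of tests can serve many spaces.\<close>

locale cantor_coding =
  fixes X :: "'p topology" and b :: "nat \<Rightarrow> 'p set"
  assumes compact: "compact_space X" and nonempty: "topspace X \<noteq> {}"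
    and open_test: "\<And>k. openin X (topspace X \<inter> b k)"
    and closed_test: "\<And>k. closedin X (topspace X \<inter> b k)"
    and separating: "\<And>x y. \<lbrakk>x \<in> topspace X; y \<in> topspace X; x \<noteq> y\<rbrakk> \<Longrightarrow> \<exists>k. (x \<in> b k) \<noteq> (y \<in> b k)"
    and perfect: "\<And>x. x \<in> topspace X \<Longrightarrow> \<not> openin X {x}"
begin

abbreviation P where "P \<equiv> meets (topspace X) b"
abbreviation si where "si s \<equiv> split_index P (node P s)"

lemma clopen_Sat: "openin X (topspace X \<inter> Sat b L) \<and> closedin X (topspace X \<inter> Sat b L)"
proof (induction L)
  case Nil
  then show ?case by simp
next
  case (Cons p L)
  obtain k v where p: "p = (k, v)" by (cases p)
  define B where "B = topspace X \<inter> (if v then b k else - b k)"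
  have "topspace X \<inter> - b k = topspace X - topspace X \<inter> b k"
    by auto
  then have "openin X B \<and> closedin X B"
    using open_test[of k] closed_test[of k] unfolding B_def by (auto simp: openin_diff closedin_diff)
  moreover have "topspace X \<inter> Sat b (p # L) = B \<inter> (topspace X \<inter> Sat b L)"
    unfolding p B_def by (auto simp: Sat_Cons)
  ultimately show ?case
    using Cons by (simp add: openin_Int closedin_Int)
qed

text \<open>A nonempty cell is open, hence not a singleton, and a test separating two of its points
  splits it.\<close>

lemma split_exists:
  assumes "P L"
  shows "\<exists>n. P ((n, True) # L) \<and> P ((n, False) # L)"
proof -
  obtain x where x: "x \<in> topspace X" "x \<in> Sat b L"
    using assms by (auto simp: meets_def)
  have "topspace X \<inter> Sat b L \<noteq> {x}"
    using clopen_Sat[of L] perfect[OF x(1)] by auto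
  then obtain y where y: "y \<in> topspace X" "y \<in> Sat b L" "x \<noteq> y"
    using x by blast
  then obtain k where "(x \<in> b k) \<noteq> (y \<in> b k)"
    using separating x by blast
  then have "P ((k, True) # L) \<and> P ((k, False) # L)"
    using x y by (auto simp: meets_def Sat_Cons)
  then show ?thesis by blast
qed

lemma split_index_splits:
  "P L \<Longrightarrow> P ((split_index P L, True) # L) \<and> P ((split_index P L, False) # L)"
  unfolding split_index_def by (rule LeastI_ex) (rule split_exists)

lemma split_index_le: "P ((k, True) # L) \<Longrightarrow> P ((k, False) # L) \<Longrightarrow> split_index P L \<le> k"
  unfolding split_index_def by (rule Least_le) simp

lemma meets_node: "P (node P s)"
proof (induction s)
  case Nil
  then show ?case using nonempty by (simp add: meets_def)
next
  case (Cons v s)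
  then show ?case using split_index_splits[OF Cons] by (cases v) auto
qed

text \<open>Split indices strictly increase along a branch. A test that splits a cell splits every
  larger cell, so the index of a child is at least that of its parent; it is different, because the
  parent's test is constant on the child. Hence the tests up to \<open>k\<close> are decided after
  \<open>Suc k\<close> splits.\<close>

lemma length_le_si: "length s \<le> si s"
proof (induction s)
  case Nil
  then show ?case by simp
next
  case (Cons v s)
  define k where "k = si (v # s)"
  have sp: "P ((k, True) # node P (v # s))" "P ((k, False) # node P (v # s))"
    using split_index_splits[OF meets_node[of "v # s"]] unfolding k_def by auto
  then have "P ((k, True) # node P s)" "P ((k, False) # node P s)"
    by (auto simp: meets_def Sat_Cons)
  then have "si s \<le> k"
    by (rule split_index_le)
  moreover have "k \<noteq> si s"
    using sp by (auto simp: meets_def Sat_Cons)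
  ultimately show ?case
    using Cons by (simp add: k_def)
qed

primrec code_prefix :: "'p \<Rightarrow> nat \<Rightarrow> bool list" where
  "code_prefix x 0 = []"
| "code_prefix x (Suc n) = (x \<in> b (si (code_prefix x n))) # code_prefix x n"

definition code :: "'p \<Rightarrow> nat \<Rightarrow> bool" where
  "code x n = (x \<in> b (si (code_prefix x n)))"

lemma rev_prefix_code: "rev_prefix (code x) n = code_prefix x n"
  by (induction n) (auto simp: code_def)

lemma in_node_iff: "x \<in> Sat b (node P s) \<longleftrightarrow> s = rev_prefix (code x) (length s)"
proof (induction s)
  case (Cons v s)
  have "x \<in> Sat b (node P (v # s)) \<longleftrightarrow> (x \<in> b (si s)) = v \<and> s = code_prefix x (length s)"
    by (simp add: Sat_Cons Cons rev_prefix_code)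
  moreover have "code x (length s) = (x \<in> b (si s))" if "s = code_prefix x (length s)"
    unfolding code_def using that by simp
  ultimately show ?case
    by (auto simp: rev_prefix_code simp del: node.simps)
qed simp

lemma inj_on_code: "inj_on code (topspace X)"
proof (rule inj_onI, rule ccontr)
  fix x y assume x: "x \<in> topspace X" and y: "y \<in> topspace X" and eq: "code x = code y" and "x \<noteq> y"
  then obtain k where k: "(x \<in> b k) \<noteq> (y \<in> b k)"
    using separating by blast
  \<comment> \<open>At depth \<open>Suc k\<close> the split index exceeds \<open>k\<close>, so test
    \<open>k\<close> is constant on this cell.\<close>
  define s where "s = rev_prefix (code x) (Suc k)"
  have "x \<in> Sat b (node P s)" "y \<in> Sat b (node P s)"
    unfolding in_node_iff s_def eq by simp_all
  then have "P ((k, True) # node P s)" "P ((k, False) # node P s)"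
    using x y k by (auto simp: meets_def Sat_Cons)
  then have "si s \<le> k"
    by (rule split_index_le)
  then show False
    using length_le_si[of s] by (simp add: s_def)
qed

text \<open>The cells along a branch are nonempty, clopen and decreasing, so compactness gives a
  point on every branch.\<close>

lemma code_surj: "code ` topspace X = UNIV"
proof -
  have "\<exists>x \<in> topspace X. code x = y" for y
  proof -
    let ?C = "\<lambda>n. topspace X \<inter> Sat b (node P (rev_prefix y n))"
    have "(\<Inter>n. ?C n) \<noteq> {}"
    proof (rule compact_space_imp_nest[OF compact])
      show "?C n \<noteq> {}" for n
        using meets_node by (auto simp: meets_def)
      show "decseq ?C"
        by (rule decseq_SucI) (auto simp: Sat_Cons)
    qed (use clopen_Sat in blast)
    then obtain x where x: "x \<in> topspace X" "\<And>n. x \<in> Sat b (node P (rev_prefix y n))"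
      by auto
    then have "rev_prefix y (Suc n) = rev_prefix (code x) (Suc n)" for n
      using in_node_iff by (metis length_rev_prefix)
    then have "code x n = y n" for n
      by (metis list.inject rev_prefix.simps(2))
    then show ?thesis using x by auto
  qed
  then show ?thesis by (metis (mono_tags, lifting) UNIV_eq_I image_iff)
qed

lemma homeomorphic_map_code: "homeomorphic_map X (euclidean :: (nat \<Rightarrow> bool) topology) code"
proof (rule continuous_imp_homeomorphic_map)
  have "continuous_map X euclidean (\<lambda>x. code x n)" for n
    unfolding continuous_map_def
  proof (intro conjI allI impI)
    fix U :: "bool set"
    have "{x \<in> topspace X. code x n \<in> U} =
        (\<Union>s \<in> {s. length s = Suc n \<and> hd s \<in> U}. topspace X \<inter> Sat b (node P s))"
    proof -
      have "code x n \<in> U \<longleftrightarrow> (\<exists>s. length s = Suc n \<and> hd s \<in> U \<and> x \<in> Sat b (node P s))" for x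
        unfolding in_node_iff by (metis length_rev_prefix list.sel(1) rev_prefix.simps(2))
      then show ?thesis by auto
    qed
    then show "openin X {x \<in> topspace X. code x n \<in> U}"
      using clopen_Sat by (auto simp del: UN_simps Int_UN_distrib)
  qed auto
  then show "continuous_map X euclidean code"
    by (subst euclidean_product_topology[symmetric]) (simp add: continuous_map_componentwise_UNIV)
  show "Hausdorff_space (euclidean :: (nat \<Rightarrow> bool) topology)"
    by (rule Hausdorff_space_cube)
qed (use compact code_surj inj_on_code in auto)

lemma code_prefix_meets:
  "length s = n \<Longrightarrow> \<exists>x \<in> topspace X. rev_prefix (code x) n = s"
  using meets_node[of s] unfolding meets_def[of _ _ "node P s"] by (force simp: in_node_iff)

definition cyl :: "bool list \<Rightarrow> 'p set" where
  "cyl s = topspace X \<inter> Sat b (node P s)"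

lemma in_cyl_iff: "x \<in> cyl s \<longleftrightarrow> x \<in> topspace X \<and> rev_prefix (code x) (length s) = s"
  unfolding cyl_def using in_node_iff by auto

lemma openin_cyl: "openin X (cyl s)" and closedin_cyl: "closedin X (cyl s)"
  unfolding cyl_def using clopen_Sat by auto

lemma cyl_subset: "cyl s \<subseteq> topspace X"
  by (auto simp: cyl_def)

lemma cyl_nest:
  assumes "\<And>n. closedin X (B n)" "\<And>n. B n \<noteq> {}" "decseq B"
  shows "\<exists>x \<in> topspace X. \<forall>n. x \<in> B n"
  using compact_space_imp_nest[OF compact assms] closedin_subset[OF assms(1)] by blast

text \<open>A point outside \<open>U\<close> but in all cylinders around \<open>x\<close>, which
  compactness would provide, has the same code as \<open>x\<close>.\<close>

lemma cyl_basis: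
  assumes U: "openin X U" and x: "x \<in> U"
  shows "\<exists>n. cyl (rev_prefix (code x) n) \<subseteq> U"
proof (rule ccontr)
  assume neg: "\<nexists>n. cyl (rev_prefix (code x) n) \<subseteq> U"
  define B where "B n = cyl (rev_prefix (code x) n) - U" for n
  have "\<exists>y \<in> topspace X. \<forall>n. y \<in> B n"
  proof (rule cyl_nest)
    show "B n \<noteq> {}" for n using neg unfolding B_def by auto
    show "decseq B"
      by (rule decseq_SucI) (auto simp: B_def in_cyl_iff)
    show "closedin X (B n)" for n
      unfolding B_def using closedin_cyl U by (rule closedin_diff)
  qed
  then obtain y where y: "y \<in> topspace X" "y \<notin> U" "\<And>n. rev_prefix (code y) n = rev_prefix (code x) n"
    by (auto simp: B_def in_cyl_iff)
  have "code y = code x"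
    using y(3) unfolding rev_prefix_eq_iff by (auto intro!: ext)
  then have "y = x"
    using y x openin_subset[OF U] inj_on_code by (auto dest: inj_onD)
  then show False using x y by simp
qed

text \<open>A Lebesgue number in terms of codes. The union of the cylinders of depth
  \<open>n\<close> that fit into no member of the cover is closed, being a finite union, and
  decreases with \<open>n\<close>; a common point would contradict \<open>cyl_basis\<close>.\<close>

lemma cyl_uniform_basis:
  assumes open_U: "\<And>U. U \<in> \<U> \<Longrightarrow> openin X U" and cov: "topspace X \<subseteq> \<Union>\<U>"
  obtains n where "\<And>s. length s = n \<Longrightarrow> \<exists>U \<in> \<U>. cyl s \<subseteq> U"
proof (rule ccontr)
  assume "\<not> thesis"
  then have neg: "\<exists>s. length s = n \<and> \<not> (\<exists>U \<in> \<U>. cyl s \<subseteq> U)" for n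
    using that by blast
  define bad where "bad n = {s. length s = n \<and> \<not> (\<exists>U \<in> \<U>. cyl s \<subseteq> U)}" for n
  define B where "B n = (\<Union>s \<in> bad n. cyl s)" for n
  have B_iff: "x \<in> B n \<longleftrightarrow> x \<in> topspace X \<and> \<not> (\<exists>U \<in> \<U>. cyl (rev_prefix (code x) n) \<subseteq> U)" for x n
    unfolding B_def bad_def by (auto simp: in_cyl_iff)
  have "\<exists>x \<in> topspace X. \<forall>n. x \<in> B n"
  proof (rule cyl_nest)
    fix n
    obtain s where s: "s \<in> bad n" using neg[of n] by (auto simp: bad_def)
    then obtain x where "x \<in> topspace X" "rev_prefix (code x) n = s"
      using code_prefix_meets[of s n] by (auto simp: bad_def)
    moreover from this s have "x \<in> cyl s"
      unfolding in_cyl_iff bad_def by simp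
    ultimately show "B n \<noteq> {}"
      using s unfolding B_def by blast
    have "finite (bad n)"
      using finite_lists_length_eq[of "UNIV :: bool set" n]
      by (rule rev_finite_subset) (auto simp: bad_def)
    then show "closedin X (B n)"
      unfolding B_def using closedin_cyl by (intro closedin_Union) auto
  next
    have "cyl (rev_prefix (code x) (Suc n)) \<subseteq> cyl (rev_prefix (code x) n)" for x n
      by (auto simp: in_cyl_iff)
    then show "decseq B"
      by (intro decseq_SucI subsetI) (metis B_iff subset_trans)
  qed
  then obtain x where x: "x \<in> topspace X" "\<And>n. \<not> (\<exists>U \<in> \<U>. cyl (rev_prefix (code x) n) \<subseteq> U)"
    using B_iff by blast
  then obtain U where "U \<in> \<U>" "x \<in> U" using cov by auto
  then show False
    using cyl_basis[of U x] open_U x by blast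
qed

lemma clopen_eq_Union_cyl:
  assumes "openin X U" "closedin X U"
  shows "\<exists>S. finite S \<and> U = (\<Union>s \<in> S. cyl s)"
proof -
  have "topspace X \<subseteq> \<Union>{U, topspace X - U}" by auto
  then obtain n where n: "\<And>s. length s = n \<Longrightarrow> \<exists>V \<in> {U, topspace X - U}. cyl s \<subseteq> V"
    using cyl_uniform_basis[of "{U, topspace X - U}"] assms openin_closedin_eq by (metis insertE singletonD openin_diff openin_topspace)
  define S where "S = {s. length s = n \<and> cyl s \<subseteq> U}"
  have "finite S"
    using finite_lists_length_eq[of "UNIV :: bool set" n]
    by (rule rev_finite_subset) (auto simp: S_def)
  moreover have "x \<in> (\<Union>s \<in> S. cyl s)" if "x \<in> U" for x
  proof -
    have "x \<in> topspace X" using that assms openin_subset by blast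
    then have x: "x \<in> cyl (rev_prefix (code x) n)" by (simp add: in_cyl_iff)
    then have "cyl (rev_prefix (code x) n) \<subseteq> U"
      using n[of "rev_prefix (code x) n"] that by auto
    moreover have "length (rev_prefix (code x) n) = n" by simp
    ultimately show ?thesis using x unfolding S_def by blast
  qed
  ultimately show ?thesis unfolding S_def by blast
qed

lemma countable_clopen: "countable {U. openin X U \<and> closedin X U}"
proof -
  have "{U. openin X U \<and> closedin X U} \<subseteq> (\<lambda>S. \<Union>s \<in> S. cyl s) ` {S. finite S}"
    using clopen_eq_Union_cyl by blast
  moreover have "countable {S :: bool list set. finite S}"
    by (simp add: countable_Collect_finite)
  ultimately show ?thesis
    by (meson countable_image countable_subset)
qed

lemma infinite_clopen: "infinite {U. openin X U \<and> closedin X U}"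
proof
  assume fin: "finite {U. openin X U \<and> closedin X U}"
  have "inj (\<lambda>n. cyl (replicate n True))"
  proof (rule injI)
    fix m n assume eq: "cyl (replicate m True) = cyl (replicate n True)"
    have "m \<le> n" if "cyl (replicate n True) \<subseteq> cyl (replicate m True)" for m n
    proof (rule ccontr)
      assume "\<not> m \<le> n"
      \<comment> \<open>The code of this point starts with \<open>n\<close> times
        \<open>True\<close>, followed by \<open>False\<close>; the head of the list is its entry
        \<open>n\<close>.\<close>
      obtain x where x: "x \<in> topspace X" "rev_prefix (code x) (Suc n) = False # replicate n True"
        using code_prefix_meets[of "False # replicate n True" "Suc n"] by auto
      then have "x \<in> cyl (replicate n True)" by (auto simp: in_cyl_iff)
      then have "rev_prefix (code x) m = replicate m True"
        using that by (auto simp: in_cyl_iff)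
      then have "rev_prefix (code x) m ! (m - Suc n) = True"
        using \<open>\<not> m \<le> n\<close> by simp
      moreover have "rev_prefix y m ! (m - Suc n) = y n" if "n < m" for y :: "nat \<Rightarrow> bool" and m n
        using that by (induction m) (auto simp: nth_Cons' less_Suc_eq Suc_diff_le)
      ultimately show False using x \<open>\<not> m \<le> n\<close> by auto
    qed
    then show "m = n" using eq by (simp add: le_antisym)
  qed
  moreover have "range (\<lambda>n. cyl (replicate n True)) \<subseteq> {U. openin X U \<and> closedin X U}"
    using openin_cyl closedin_cyl by auto
  ultimately show False
    using fin finite_subset range_inj_infinite by blast
qed

end

text \<open>Zero-dimensionality and compactness yield for every \<open>n\<close> a finite clopen
  cover by sets inside balls of radius \<open>1 / Suc n\<close>. All these sets together are the
  tests: points at distance more than \<open>2 / Suc n\<close> share no set of the cover with number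
  \<open>n\<close>.\<close>

lemma Cantor_space_coding:
  assumes "Cantor_space C"
  obtains b where "cantor_coding C b"
proof -
  have ne: "topspace C \<noteq> {}" and comp: "compact_space C" and "metrizable_space C"
    and zero: "zero_dimensional_space C" and perf: "\<And>x. x \<in> topspace C \<Longrightarrow> \<not> openin C {x}"
    using assms by (auto simp: Cantor_space_def)
  have small: "\<exists>V. openin C V \<and> closedin C V \<and> x \<in> V \<and> V \<subseteq> U" if "openin C U" "x \<in> U" for U x
    using zero that unfolding zero_dimensional_space_def by simp
  obtain M d where "Metric_space M d" and C: "C = Metric_space.mtopology M d"
    using \<open>metrizable_space C\<close> unfolding metrizable_space_def by blast
  interpret Metric_space M d by fact
  have "\<exists>\<V>. finite \<V> \<and> topspace C \<subseteq> \<Union>\<V> \<and>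
      (\<forall>V \<in> \<V>. openin C V \<and> closedin C V \<and> (\<exists>x. V \<subseteq> mball x (1 / real (Suc n))))" for n
  proof -
    define \<W> where "\<W> = {V. openin C V \<and> closedin C V \<and> (\<exists>x. V \<subseteq> mball x (1 / real (Suc n)))}"
    have "x \<in> \<Union>\<W>" if "x \<in> topspace C" for x
    proof -
      have "openin C (mball x (1 / real (Suc n)))" "x \<in> mball x (1 / real (Suc n))"
        using that by (auto simp: C)
      then obtain V where "openin C V" "closedin C V" "x \<in> V" "V \<subseteq> mball x (1 / real (Suc n))"
        using small[of "mball x (1 / real (Suc n))" x] by blast
      then show ?thesis
        unfolding \<W>_def by (intro UnionI[of V]) auto
    qed
    then have "topspace C \<subseteq> \<Union>\<W>" by blast
    moreover have "\<forall>U \<in> \<W>. openin C U" by (simp add: \<W>_def)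
    ultimately obtain \<V> where "finite \<V>" "\<V> \<subseteq> \<W>" "topspace C \<subseteq> \<Union>\<V>"
      using comp[unfolded compact_space_alt, rule_format, of \<W>] by blast
    then show ?thesis unfolding \<W>_def by (intro exI[of _ \<V>]) blast
  qed
  then obtain \<V> where V: "\<And>n. finite (\<V> n)" "\<And>n. topspace C \<subseteq> \<Union>(\<V> n)"
    "\<And>n V. V \<in> \<V> n \<Longrightarrow> openin C V \<and> closedin C V \<and> (\<exists>x. V \<subseteq> mball x (1 / real (Suc n)))"
    by metis
  define \<B> where "\<B> = (\<Union>n. \<V> n)"
  have "countable \<B>"
    using V(1) by (auto simp: \<B>_def countable_finite)
  have "\<V> 0 \<noteq> {}"
    using V(2)[of 0] ne by fastforce
  then have "\<B> \<noteq> {}"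
    by (auto simp: \<B>_def)
  then have r: "range (from_nat_into \<B>) = \<B>"
    using \<open>countable \<B>\<close> by (simp add: range_from_nat_into)
  have clopen: "openin C (from_nat_into \<B> k) \<and> closedin C (from_nat_into \<B> k)" for k
    using V(3) from_nat_into[OF \<open>\<B> \<noteq> {}\<close>, of k] unfolding \<B>_def by blast
  have "cantor_coding C (from_nat_into \<B>)"
  proof
    show "openin C (topspace C \<inter> from_nat_into \<B> k)" "closedin C (topspace C \<inter> from_nat_into \<B> k)" for k
      using clopen by (auto simp: closedin_Int)
    fix x y assume xy: "x \<in> topspace C" "y \<in> topspace C" "x \<noteq> y"
    then have "d x y > 0" by (simp add: C)
    then obtain n where n: "1 / real (Suc n) < d x y / 2"
      using nat_approx_posE[of "d x y / 2"] by (meson half_gt_zero)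
    obtain V where V': "V \<in> \<V> n" "x \<in> V" using V(2)[of n] xy by blast
    then obtain z where z: "V \<subseteq> mball z (1 / real (Suc n))"
      using V(3)[of V n] by blast
    have "y \<notin> V"
    proof
      assume "y \<in> V"
      then have "d z x < 1 / real (Suc n)" "d z y < 1 / real (Suc n)" "z \<in> M" "x \<in> M" "y \<in> M"
        using V' z by auto
      then show False
        using n triangle[of x z y] commute[of x z] by linarith
    qed
    moreover obtain k where "V = from_nat_into \<B> k"
      using V' r unfolding \<B>_def by blast
    ultimately show "\<exists>k. (x \<in> from_nat_into \<B> k) \<noteq> (y \<in> from_nat_into \<B> k)"
      using V' by blast
  qed (fact comp ne perf)+
  then show ?thesis by (rule that)
qed

section \<open>A shift space attached to a set of words\<close>

type_synonym letters = "int \<Rightarrow> nat list option"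

text \<open>The prefixes carry the tree structure. The one-letter words are added so that the order
  also shows which letters occur in \<open>t\<close>. Each \<open>step t\<close> is finite, which is
  what makes the shift space closed.\<close>

definition step :: "nat list \<Rightarrow> nat list set" where
  "step t = {u. u \<noteq> [] \<and> prefix u t} \<union> (\<lambda>v. [v]) ` set t"

lemma step_refl: "t \<noteq> [] \<Longrightarrow> t \<in> step t"
  by (simp add: step_def)

lemma set_mono_step: "u \<in> step t \<Longrightarrow> set u \<subseteq> set t"
  by (auto simp: step_def dest: set_mono_prefix)

lemma step_trans: "u \<in> step t \<Longrightarrow> w \<in> step u \<Longrightarrow> w \<in> step t"
proof -
  assume u: "u \<in> step t" and w: "w \<in> step u"
  have "set w \<subseteq> set t" using set_mono_step u w by blast
  consider "prefix u t" | v where "u = [v]" "v \<in> set t" using u by (auto simp: step_def)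
  then show ?thesis
  proof cases
    case 1
    then show ?thesis using w set_mono_step[OF u] by (auto simp: step_def dest: prefix_order.trans)
  next
    case 2
    then have "w = [v]" using w by (auto simp: step_def prefix_Cons)
    then show ?thesis using 2 by (auto simp: step_def)
  qed
qed

lemma finite_step: "finite (step t)"
proof -
  have "{u. u \<noteq> [] \<and> prefix u t} \<subseteq> set (prefixes t)" by auto
  then show ?thesis unfolding step_def by (simp add: finite_subset)
qed

text \<open>\<open>None\<close> is the inactive letter. The second clause is the gap rule in
  contrapositive form: if \<open>n + 1\<close> active letters end at \<open>j\<close> and
  \<open>j + 1\<close> is inactive, then \<open>j + 1 + n\<close> is inactive. Used for all smaller
  \<open>n\<close> too, it makes an excursion of length \<open>r\<close> be followed by
  \<open>r\<close> inactive letters.\<close>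

definition ruled :: "letters \<Rightarrow> bool" where
  "ruled a \<longleftrightarrow>
     (\<forall>j t u. a j = Some t \<and> a (j + 1) = Some u \<longrightarrow> u \<in> step t) \<and>
     (\<forall>j n. (\<forall>k\<le>n. a (j - int k) \<noteq> None) \<and> a (j + 1 + int n) \<noteq> None \<longrightarrow> a (j + 1) \<noteq> None)"

lemma ruled_step: "ruled a \<Longrightarrow> a j = Some t \<Longrightarrow> a (j + 1) = Some u \<Longrightarrow> u \<in> step t"
  by (auto simp: ruled_def)

lemma ruled_run:
  "ruled a \<Longrightarrow> (\<And>k. k \<le> n \<Longrightarrow> a (j - int k) \<noteq> None) \<Longrightarrow> a (j + 1 + int n) \<noteq> None \<Longrightarrow> a (j + 1) \<noteq> None"
  unfolding ruled_def by blast

text \<open>A letter becomes its indicator row over all words, and \<open>None\<close> the zero row.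
  In the product topology the rows of pairwise distinct words tend to the zero row; so the inactive
  letter is the limit of the others, and compactness is inherited from the cube.\<close>

definition point :: "letters \<Rightarrow> int \<times> nat list \<Rightarrow> bool" where
  "point a = (\<lambda>(j, t). a j = Some t)"

lemma point_apply [simp]: "point a (j, t) \<longleftrightarrow> a j = Some t"
  by (simp add: point_def)

lemma point_eq_iff: "point a = point a' \<longleftrightarrow> a = a'"
proof
  assume eq: "point a = point a'"
  have "a j = a' j" for j
    using fun_cong[OF eq, of "(j, the (a j))"] fun_cong[OF eq, of "(j, the (a' j))"]
    by (cases "a j"; cases "a' j") auto
  then show "a = a'" by auto
qed simp

definition sys_seqs :: "nat list set \<Rightarrow> letters set" where
  "sys_seqs M = {a. ruled a \<and> (\<forall>j t. a j = Some t \<longrightarrow> t \<in> M)}"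

definition sys :: "nat list set \<Rightarrow> (int \<times> nat list \<Rightarrow> bool) set" where
  "sys M = point ` sys_seqs M"

definition shift :: "(int \<times> nat list \<Rightarrow> bool) \<Rightarrow> int \<times> nat list \<Rightarrow> bool" where
  "shift x = (\<lambda>(j, t). x (j + 1, t))"

definition unshift :: "(int \<times> nat list \<Rightarrow> bool) \<Rightarrow> int \<times> nat list \<Rightarrow> bool" where
  "unshift x = (\<lambda>(j, t). x (j - 1, t))"

lemma shift_point: "shift (point a) = point (\<lambda>j. a (j + 1))"
  by (auto simp: shift_def)

lemma unshift_point: "unshift (point a) = point (\<lambda>j. a (j - 1))"
  by (auto simp: unshift_def)

lemma unshift_shift [simp]: "unshift (shift x) = x" and shift_unshift [simp]: "shift (unshift x) = x"
  by (auto simp: shift_def unshift_def)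

lemma ruled_translate: "ruled a \<Longrightarrow> ruled (\<lambda>j. a (j + s))"
proof -
  assume a: "ruled a"
  have "a (j + 1 + s) \<noteq> None" if "\<forall>k\<le>n. a (j - int k + s) \<noteq> None" "a (j + 1 + int n + s) \<noteq> None" for j n
    using ruled_run[OF a, of n "j + s"] that by (simp add: algebra_simps)
  moreover have "u \<in> step t" if "a (j + s) = Some t" "a (j + 1 + s) = Some u" for j t u
    using ruled_step[OF a, of "j + s"] that by (simp add: algebra_simps)
  ultimately show ?thesis unfolding ruled_def by blast
qed

lemma sys_seqs_translate: "a \<in> sys_seqs M \<Longrightarrow> (\<lambda>j. a (j + s)) \<in> sys_seqs M"
  using ruled_translate by (auto simp: sys_seqs_def)

lemma shift_in_sys: "x \<in> sys M \<Longrightarrow> shift x \<in> sys M"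
  using sys_seqs_translate[of _ M 1] by (auto simp: sys_def shift_point)

lemma unshift_in_sys: "x \<in> sys M \<Longrightarrow> unshift x \<in> sys M"
  using sys_seqs_translate[of _ M "-1"] by (auto simp: sys_def unshift_point)

lemma shift_funpow_point: "(shift ^^ n) (point a) = point (\<lambda>j. a (j + int n))"
  by (induction n) (auto simp: shift_point algebra_simps)

text \<open>The form needed for closedness. In the gap rule the active letter \<open>t\<close> at
  \<open>j\<close> is named, so that the letter at \<open>j + 1\<close> is sought in the finite set
  \<open>step t\<close>: a finite union of closed conditions, whereas an unbounded existential would
  only be open.\<close>

lemma sys_eq:
  "sys M = {x. (\<forall>j t. x (j, t) \<longrightarrow> t \<in> M) \<and> (\<forall>j t u. x (j, t) \<and> x (j, u) \<longrightarrow> t = u) \<and>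
     (\<forall>j t u. x (j, t) \<and> x (j + 1, u) \<longrightarrow> u \<in> step t) \<and>
     (\<forall>j n t. x (j, t) \<and> (\<forall>k \<in> {..n}. \<exists>u. x (j - int k, u)) \<and> (\<exists>u. x (j + 1 + int n, u)) \<longrightarrow>
        (\<exists>u \<in> step t. x (j + 1, u)))}" (is "_ = {x. ?A x \<and> ?B x \<and> ?C x \<and> ?D x}")
proof (intro equalityI subsetI)
  fix x assume "x \<in> sys M"
  then obtain a where x: "x = point a" and a: "ruled a" "\<And>j t. a j = Some t \<Longrightarrow> t \<in> M"
    by (auto simp: sys_def sys_seqs_def)
  have "\<exists>u \<in> step t. a (j + 1) = Some u"
    if "a j = Some t" "\<forall>k \<in> {..n}. \<exists>u. a (j - int k) = Some u" "a (j + 1 + int n) = Some u" for j n t u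
  proof -
    have "a (j + 1) \<noteq> None"
      using ruled_run[OF a(1), of n j] that by auto
    then obtain u where "a (j + 1) = Some u" by auto
    then show ?thesis using ruled_step[OF a(1)] that(1) by blast
  qed
  then have "?D x" unfolding x point_apply by blast
  moreover have "?A x \<and> ?B x" using a(2) by (auto simp: x)
  moreover have "?C x" unfolding x point_apply using ruled_step[OF a(1)] by blast
  ultimately show "x \<in> {x. ?A x \<and> ?B x \<and> ?C x \<and> ?D x}" by blast
next
  fix x assume "x \<in> {x. ?A x \<and> ?B x \<and> ?C x \<and> ?D x}"
  then have A: "\<And>j t. x (j, t) \<Longrightarrow> t \<in> M" and B: "\<And>j t u. x (j, t) \<Longrightarrow> x (j, u) \<Longrightarrow> t = u"
    and C: "\<And>j t u. x (j, t) \<Longrightarrow> x (j + 1, u) \<Longrightarrow> u \<in> step t" and D: "?D x" by blast+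
  define a where "a j = (if \<exists>t. x (j, t) then Some (THE t. x (j, t)) else None)" for j
  have a_iff: "a j = Some t \<longleftrightarrow> x (j, t)" for j t
  proof
    assume "a j = Some t"
    then have "\<exists>t. x (j, t)" "t = (THE t. x (j, t))" by (auto simp: a_def split: if_splits)
    then show "x (j, t)" using B theI[of "\<lambda>t. x (j, t)"] by metis
  next
    assume "x (j, t)"
    moreover from this have "(THE t. x (j, t)) = t" using B by blast
    ultimately show "a j = Some t" by (auto simp: a_def)
  qed
  have "a (j + 1) \<noteq> None" if "\<forall>k\<le>n. a (j - int k) \<noteq> None" "a (j + 1 + int n) \<noteq> None" for j n
  proof -
    have "\<exists>u. x (j - int k, u)" if "k \<le> n" for k
      using \<open>\<forall>k\<le>n. a (j - int k) \<noteq> None\<close> that a_iff by blast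
    moreover from this[of 0] obtain t where "x (j, t)" by auto
    moreover have "\<exists>u. x (j + 1 + int n, u)" using that(2) a_iff by blast
    ultimately obtain u where "x (j + 1, u)" using D by (metis atMost_iff)
    then show ?thesis using a_iff by (metis option.distinct(1))
  qed
  then have "ruled a"
    unfolding ruled_def a_iff using C by blast
  then have "a \<in> sys_seqs M"
    using A by (simp add: sys_seqs_def a_iff)
  moreover have "x = point a"
    by (rule ext) (auto simp: point_def a_iff)
  ultimately show "x \<in> sys M"
    by (simp add: sys_def)
qed

lemma closed_sys: "closed (sys M)"
proof -
  have finite_ex: "{x :: int \<times> nat list \<Rightarrow> bool. \<exists>u \<in> step t. x (j, u)} = (\<Union>u \<in> step t. {x. x (j, u)})" for j t
    by auto
  have op: "open {x :: int \<times> nat list \<Rightarrow> bool. x i}" and cl: "closed {x :: int \<times> nat list \<Rightarrow> bool. x i}" for i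
    using open_coordinate[of i True] closed_coordinate[of i True] by simp_all
  have "closed {x :: int \<times> nat list \<Rightarrow> bool. \<exists>u \<in> step t. x (j, u)}" for j t
    unfolding finite_ex using finite_step cl by (intro closed_UN) auto
  moreover have "open {x :: int \<times> nat list \<Rightarrow> bool. \<exists>u. x (j, u)}" for j
    by (intro open_Collect_ex op)
  moreover from this have "open {x :: int \<times> nat list \<Rightarrow> bool. \<forall>k \<in> {..n}. \<exists>u. x (j - int k, u)}" for n :: nat and j
  proof -
    have "{x :: int \<times> nat list \<Rightarrow> bool. \<forall>k \<in> {..n}. \<exists>u. x (j - int k, u)} = (\<Inter>k \<in> {..n}. {x. \<exists>u. x (j - int k, u)})"
      by auto
    then show ?thesis using \<open>\<And>j. open {x :: int \<times> nat list \<Rightarrow> bool. \<exists>u. x (j, u)}\<close> by auto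
  qed
  ultimately show ?thesis
    unfolding sys_eq
    by (intro closed_Collect_conj closed_Collect_all closed_Collect_imp open_Collect_conj closed_Collect_const op)
qed

lemma window_nbhd:
  assumes "open U" "point a \<in> U"
  shows "\<exists>N :: nat. \<forall>a'. (\<forall>i. \<bar>i\<bar> \<le> int N \<longrightarrow> a' i = a i) \<longrightarrow> point a' \<in> U"
proof -
  have "openin (product_topology (\<lambda>i. euclidean) UNIV) U"
    using assms(1) by (simp add: euclidean_product_topology)
  then obtain V where V: "finite {i. V i \<noteq> UNIV}" "point a \<in> Pi\<^sub>E UNIV V" "Pi\<^sub>E UNIV V \<subseteq> U"
    using assms(2) unfolding openin_product_topology_alt by fastforce
  have "finite ((\<lambda>i. nat \<bar>fst i\<bar>) ` {i. V i \<noteq> UNIV})" using V(1) by simp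
  then obtain N where N: "\<And>i. V i \<noteq> UNIV \<Longrightarrow> nat \<bar>fst i\<bar> \<le> N"
    unfolding finite_nat_set_iff_bounded_le by (metis (mono_tags, lifting) imageI mem_Collect_eq)
  have "point a' \<in> U" if a': "\<forall>i. \<bar>i\<bar> \<le> int N \<longrightarrow> a' i = a i" for a'
  proof -
    have "point a' i \<in> V i" for i
    proof (cases "V i = UNIV")
      case False
      then have "\<bar>fst i\<bar> \<le> int N" using N[of i] by linarith
      then have "point a' i = point a i" using a' by (cases i) auto
      then show ?thesis using V(2) by auto
    qed simp
    then show ?thesis using V(3) by auto
  qed
  then show ?thesis by blast
qed

text \<open>Sequences obtained by cutting windows out of admissible sequences and separating them by long
  inactive gaps are admissible, because an excursion inside a window of length \<open>m\<close> only asks for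
  at most \<open>m\<close> inactive letters after it.\<close>

lemma ruled_tiling:
  fixes a :: letters
  assumes tile: "\<And>j. a j \<noteq> None \<Longrightarrow> \<exists>p m b s. ruled b \<and> p \<le> j \<and> j < p + m \<and>
      (\<forall>i \<in> {p..<p + m}. a i = b (i + s)) \<and> (\<forall>i \<in> {p + m..p + 2 * m}. a i = None) \<and> a (p - 1) = None"
  shows "ruled a"
  unfolding ruled_def
proof (intro conjI allI impI; elim conjE)
  fix j t u assume t: "a j = Some t" and u: "a (j + 1) = Some u"
  obtain p m b s where b: "ruled b" and j: "p \<le> j" "j < p + m" and eq: "\<forall>i \<in> {p..<p + m}. a i = b (i + s)"
    and gap: "\<forall>i \<in> {p + m..p + 2 * m}. a i = None"
    using tile[of j] t by auto
  have "j + 1 \<noteq> p + m" using gap u j by force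
  then have "a (j + 1) = b (j + 1 + s)" "a j = b (j + s)" using j eq by auto
  then show "u \<in> step t"
    using ruled_step[OF b, of "j + s"] t u by (simp add: algebra_simps)
next
  fix j n assume run: "\<forall>k\<le>n. a (j - int k) \<noteq> None" and act: "a (j + 1 + int n) \<noteq> None"
  have "a j \<noteq> None" using run by (metis of_nat_0 diff_zero zero_le)
  then obtain p m b s where b: "ruled b" and j: "p \<le> j" "j < p + m" and eq: "\<forall>i \<in> {p..<p + m}. a i = b (i + s)"
    and gap: "\<forall>i \<in> {p + m..p + 2 * m}. a i = None" and start: "a (p - 1) = None"
    using tile[of j] by auto
  \<comment> \<open>The excursion ending at \<open>j\<close> cannot reach back beyond
    \<open>p\<close>, because position \<open>p - 1\<close> is inactive.\<close>
  have pn: "p \<le> j - int n"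
  proof (rule ccontr)
    assume "\<not> p \<le> j - int n"
    then have "nat (j - (p - 1)) \<le> n" using j by linarith
    then have "a (j - int (nat (j - (p - 1)))) \<noteq> None" using run by blast
    then show False using start j by simp
  qed
  \<comment> \<open>Since \<open>n \<le> j - p < m\<close>, the position would otherwise lie in the
    gap after the window.\<close>
  have "j + 1 + int n < p + m"
  proof (rule ccontr)
    assume "\<not> ?thesis"
    then have "j + 1 + int n \<in> {p + m..p + 2 * m}" using j pn by auto
    then show False using gap[rule_format, of "j + 1 + int n"] act by simp
  qed
  then have win: "a (j + 1 + int n) = b (j + s + 1 + int n)" "a (j + 1) = b (j + s + 1)"
    using eq[rule_format, of "j + 1 + int n"] eq[rule_format, of "j + 1"] j by (auto simp: algebra_simps)
  have "b (j + s - int k) \<noteq> None" if "k \<le> n" for k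
  proof -
    have "a (j - int k) = b (j - int k + s)" using eq that pn j by auto
    moreover have "j - int k + s = j + s - int k" by simp
    ultimately show ?thesis using run that by metis
  qed
  then show "a (j + 1) \<noteq> None"
    using ruled_run[OF b, of n "j + s"] act win by auto
qed

section \<open>Periodic concatenation of finite windows\<close>

definition tiling :: "(nat \<Rightarrow> letters) \<Rightarrow> nat \<Rightarrow> nat \<Rightarrow> letters" where
  "tiling b K N = (\<lambda>j. let m = 2 * int N + 1; S = 3 * m + 2; r = j mod S in
     if 1 \<le> r \<and> r \<le> m then b (nat (j div S mod int K)) (r - 1 - int N) else None)"

text \<open>A slot consists of one inactive cell, a window of length \<open>m = 2 * N + 1\<close>
  centred at the origin of its sequence, and \<open>2 * m + 1\<close> inactive cells, more than the
  \<open>m + 1\<close> that \<open>ruled_tiling\<close> asks for. The first cell guarantees an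
  inactive letter before the window.\<close>

definition tile_size :: "nat \<Rightarrow> int" where
  "tile_size N = 3 * (2 * int N + 1) + 2"

lemma tile_size_pos: "tile_size N > 0"
  by (simp add: tile_size_def)

lemma tiling_alt: "tiling b K N j = (if 1 \<le> j mod tile_size N \<and> j mod tile_size N \<le> 2 * int N + 1
    then b (nat (j div tile_size N mod int K)) (j mod tile_size N - 1 - int N) else None)"
  by (simp add: tiling_def tile_size_def Let_def)

lemma tiling_slot: "0 \<le> r \<Longrightarrow> r < tile_size N \<Longrightarrow> tiling b K N (q * tile_size N + r) =
   (if 1 \<le> r \<and> r \<le> 2 * int N + 1 then b (nat (q mod int K)) (r - 1 - int N) else None)"
  unfolding tiling_alt by (simp add: div_pos_pos_trivial)

lemma ruled_tiling_family:
  assumes "\<And>k. k < K \<Longrightarrow> ruled (b k)" "K > 0"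
  shows "ruled (tiling b K N)"
proof (rule ruled_tiling)
  fix j assume act: "tiling b K N j \<noteq> None"
  let ?S = "tile_size N" and ?m = "2 * int N + 1"
  define q where "q = j div ?S"
  define k where "k = nat (q mod int K)"
  have r: "1 \<le> j mod ?S" "j mod ?S \<le> ?m" using act unfolding tiling_alt by (auto split: if_splits)
  have j: "j = q * ?S + j mod ?S" by (simp add: q_def)
  have slot: "tiling b K N i = (if 1 \<le> i - q * ?S \<and> i - q * ?S \<le> ?m then b k (i - q * ?S - 1 - int N) else None)"
    if "0 \<le> i - q * ?S" "i - q * ?S < ?S" for i
    using tiling_slot[of "i - q * ?S" N b K q] that by (simp add: k_def)
  have "k < K" unfolding k_def using assms(2) by (simp add: nat_less_iff)
  moreover have "tiling b K N i = b k (i + (- q * ?S - 1 - int N))" if "i \<in> {q * ?S + 1..<q * ?S + 1 + ?m}" for i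
    using slot[of i] that by (auto simp: tile_size_def algebra_simps)
  moreover have "tiling b K N i = None" if "i \<in> {q * ?S + 1 + ?m..q * ?S + 1 + 2 * ?m}" for i
  proof -
    have "0 \<le> i - q * ?S" "i - q * ?S < ?S" "\<not> i - q * ?S \<le> ?m" using that by (auto simp: tile_size_def)
    then show ?thesis using slot[of i] by simp
  qed
  moreover have "tiling b K N (q * ?S + 1 - 1) = None"
    using slot[of "q * ?S"] tile_size_pos[of N] by simp
  moreover have "q * ?S + 1 \<le> j" "j < q * ?S + 1 + ?m" using r j by linarith+
  ultimately show "\<exists>p m b' s. ruled b' \<and> p \<le> j \<and> j < p + m \<and>
      (\<forall>i \<in> {p..<p + m}. tiling b K N i = b' (i + s)) \<and> (\<forall>i \<in> {p + m..p + 2 * m}. tiling b K N i = None) \<and>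
      tiling b K N (p - 1) = None"
    using assms(1)[of k] by (intro exI[of _ "q * ?S + 1"] exI[of _ ?m] exI[of _ "b k"] exI[of _ "- q * ?S - 1 - int N"]) blast
qed

text \<open>The offset is the start of slot \<open>k\<close>, plus one for its inactive first cell,
  plus \<open>N\<close> to reach the centre of the window.\<close>

lemma tiling_window:
  assumes "k < K" "\<bar>i\<bar> \<le> int N"
  shows "tiling b K N (i + (int k * tile_size N + 1 + int N)) = b k i"
proof -
  have "0 \<le> i + 1 + int N" "i + 1 + int N < tile_size N" "1 \<le> i + 1 + int N \<and> i + 1 + int N \<le> 2 * int N + 1"
    using assms(2) by (auto simp: tile_size_def)
  then show ?thesis
    using tiling_slot[of "i + 1 + int N" N b K "int k"] assms(1) by (simp add: algebra_simps)
qed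

lemma tiling_periodic: "K > 0 \<Longrightarrow> tiling b K N (j + int (K * nat (tile_size N))) = tiling b K N j"
proof -
  assume "K > 0"
  have e: "int (K * nat (tile_size N)) = int K * tile_size N" using tile_size_pos[of N] by simp
  have "(j + int K * tile_size N) div tile_size N = j div tile_size N + int K"
    using tile_size_pos[of N] by simp
  then show ?thesis unfolding tiling_alt e by simp
qed

lemma tiling_letter:
  assumes "tiling b K N j = Some t" "K > 0"
  shows "\<exists>k<K. \<exists>i. \<bar>i\<bar> \<le> int N \<and> b k i = Some t"
proof -
  define k where "k = nat (j div tile_size N mod int K)"
  have "k < K" using assms(2) by (simp add: k_def nat_less_iff)
  moreover have "b k (j mod tile_size N - 1 - int N) = Some t" "\<bar>j mod tile_size N - 1 - int N\<bar> \<le> int N"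
    using assms(1) unfolding tiling_alt k_def by (auto split: if_splits)
  ultimately show ?thesis by blast
qed

section \<open>The shift space as a chaotic system without isolated points\<close>

definition test :: "nat \<Rightarrow> (int \<times> nat list \<Rightarrow> bool) set" where
  "test k = {x. x (from_nat k)}"

lemma open_Sat_test: "open (Sat test L)"
proof (induction L)
  case (Cons p L)
  obtain k v where p: "p = (k, v)" by (cases p)
  have "Sat test (p # L) = {x. x (from_nat k) = v} \<inter> Sat test L"
    by (auto simp: p Sat_Cons test_def)
  then show ?case using open_coordinate Cons by (metis open_Int)
qed simp

definition sysT :: "nat list set \<Rightarrow> (int \<times> nat list \<Rightarrow> bool) topology" where
  "sysT M = top_of_set (sys M)"

lemma topspace_sysT [simp]: "topspace (sysT M) = sys M"
  by (simp add: sysT_def)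

lemma ruled_const: "t \<noteq> [] \<Longrightarrow> ruled (\<lambda>_. Some t)" and ruled_None: "ruled (\<lambda>_. None)"
  by (auto simp: ruled_def step_refl)

lemma const_in_sys_seqs: "t \<in> M \<Longrightarrow> t \<noteq> [] \<Longrightarrow> (\<lambda>_. Some t) \<in> sys_seqs M"
  and None_in_sys_seqs: "(\<lambda>_. None) \<in> sys_seqs M"
  using ruled_const ruled_None by (auto simp: sys_seqs_def)

lemma tiling_in_sys_seqs:
  assumes "\<And>k. k < K \<Longrightarrow> b k \<in> sys_seqs M" "K > 0"
  shows "(\<lambda>j. tiling b K N (j + s)) \<in> sys_seqs M"
proof (rule sys_seqs_translate)
  have "ruled (tiling b K N)"
    using assms by (intro ruled_tiling_family) (auto simp: sys_seqs_def)
  moreover have "t \<in> M" if "tiling b K N j = Some t" for j t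
    using tiling_letter[OF that assms(2)] assms(1) by (auto simp: sys_seqs_def)
  ultimately show "tiling b K N \<in> sys_seqs M"
    by (simp add: sys_seqs_def)
qed

text \<open>The window of \<open>a\<close> is continued either by a window of the constant
  \<open>t\<close> or by an inactive one. The two continuations differ at the centre of the second
  slot, so at least one of them is not \<open>a\<close>.\<close>

lemma sys_seqs_perfect:
  assumes "t \<in> M" "t \<noteq> []" "a \<in> sys_seqs M"
  shows "\<exists>a' \<in> sys_seqs M. (\<forall>i. \<bar>i\<bar> \<le> int N \<longrightarrow> a' i = a i) \<and> a' \<noteq> a"
proof -
  define b where "b c k = (if k = 0 then a else c)" for c :: letters and k :: nat
  define y where "y c = (\<lambda>j. tiling (b c) 2 N (j + (1 + int N)))" for c
  have y_mem: "y c \<in> sys_seqs M" if "c \<in> sys_seqs M" for c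
    unfolding y_def using that assms(3) by (intro tiling_in_sys_seqs) (auto simp: b_def)
  have agree: "y c i = a i" if "\<bar>i\<bar> \<le> int N" for c i
    using tiling_window[of 0 2 i N "b c"] that by (simp add: y_def b_def)
  have "y c (tile_size N) = c 0" for c
    using tiling_window[of 1 2 0 N "b c"] by (simp add: y_def b_def algebra_simps)
  then have "y (\<lambda>_. None) \<noteq> y (\<lambda>_. Some t)"
    by (metis option.distinct(1))
  then show ?thesis
    using agree y_mem const_in_sys_seqs[OF assms(1,2)] None_in_sys_seqs by metis
qed

lemma openin_sysT_window:
  assumes "openin (sysT M) U" "point a \<in> U"
  shows "\<exists>N :: nat. \<forall>a' \<in> sys_seqs M. (\<forall>i. \<bar>i\<bar> \<le> int N \<longrightarrow> a' i = a i) \<longrightarrow> point a' \<in> U"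
proof -
  obtain V where V: "open V" "U = sys M \<inter> V"
    using assms(1) unfolding sysT_def by (auto simp: openin_open)
  then obtain N :: nat where "\<forall>a'. (\<forall>i. \<bar>i\<bar> \<le> int N \<longrightarrow> a' i = a i) \<longrightarrow> point a' \<in> V"
    using window_nbhd[of V a] assms(2) by blast
  then show ?thesis using V(2) by (auto simp: sys_def)
qed

text \<open>The same tests serve for all \<open>M\<close>: they are the coordinates of the ambient
  cube. The word \<open>t\<close> supplies the second continuation that excludes isolated
  points.\<close>

lemma cantor_coding_sys:
  assumes "t \<in> M" "t \<noteq> []"
  shows "cantor_coding (sysT M) test"
proof
  show "compact_space (sysT M)"
    unfolding sysT_def using closedin_compact_space[OF compact_space_cube, of "sys M"] closed_sys
    by (intro compact_space_subtopology) simp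
  show "topspace (sysT M) \<noteq> {}"
    using None_in_sys_seqs by (auto simp: sys_def)
  have "open (test k)" "closed (test k)" for k
    using open_coordinate[of "from_nat k" True] closed_coordinate[of "from_nat k" True]
    by (simp_all add: test_def)
  then show "openin (sysT M) (topspace (sysT M) \<inter> test k)"
    "closedin (sysT M) (topspace (sysT M) \<inter> test k)" for k
    by (auto simp: sysT_def openin_open closedin_closed)
next
  fix x y :: "int \<times> nat list \<Rightarrow> bool" assume "x \<noteq> y"
  then obtain i where "x i \<noteq> y i" unfolding fun_eq_iff by blast
  then have "(x \<in> test (to_nat i)) \<noteq> (y \<in> test (to_nat i))"
    by (simp add: test_def)
  then show "\<exists>k. (x \<in> test k) \<noteq> (y \<in> test k)" by blast
next
  fix x assume "x \<in> topspace (sysT M)"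
  then obtain a where a: "a \<in> sys_seqs M" "x = point a" by (auto simp: sys_def)
  show "\<not> openin (sysT M) {x}"
  proof
    assume "openin (sysT M) {x}"
    then obtain N :: nat where N: "\<forall>a' \<in> sys_seqs M. (\<forall>i. \<bar>i\<bar> \<le> int N \<longrightarrow> a' i = a i) \<longrightarrow> point a' \<in> {x}"
      using openin_sysT_window[of M "{x}" a] a by blast
    then show False
      using sys_seqs_perfect[OF assms a(1), of N] a(2) point_eq_iff by auto
  qed
qed

text \<open>A finite conjunction of tests sees only a finite window, and repeating this window
  periodically gives a point using only the words that occur in it. Satisfiability thus becomes a
  countable disjunction over \<open>l\<close> of conditions \<open>set l \<subseteq> M\<close>
  paired with facts that do not involve \<open>M\<close>, which is the source of all measurability
  in \<open>M\<close>.\<close>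

lemma meets_sys_iff: "meets (sys M) test L \<longleftrightarrow> (\<exists>l. set l \<subseteq> M \<and> meets (sys (set l)) test L)"
proof
  assume "meets (sys M) test L"
  then obtain a where a: "a \<in> sys_seqs M" "point a \<in> Sat test L"
    by (auto simp: meets_def sys_def)
  obtain N :: nat where N: "\<forall>a'. (\<forall>i. \<bar>i\<bar> \<le> int N \<longrightarrow> a' i = a i) \<longrightarrow> point a' \<in> Sat test L"
    using window_nbhd[OF open_Sat_test a(2)] by blast
  define F where "F = {t. \<exists>i. \<bar>i\<bar> \<le> int N \<and> a i = Some t}"
  have "F \<subseteq> (\<lambda>i. the (a i)) ` {- int N..int N}"
  proof
    fix t assume "t \<in> F"
    then obtain i where "\<bar>i\<bar> \<le> int N" "a i = Some t" by (auto simp: F_def)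
    then show "t \<in> (\<lambda>i. the (a i)) ` {- int N..int N}" by (intro image_eqI[of _ _ i]) auto
  qed
  then have "finite F" by (rule finite_subset) simp
  then obtain l where l: "set l = F" using finite_list by blast
  define y where "y = (\<lambda>j. tiling (\<lambda>_. a) 1 N (j + (1 + int N)))"
  have "ruled y"
    unfolding y_def using a(1) by (intro ruled_translate ruled_tiling_family) (auto simp: sys_seqs_def)
  moreover have "t \<in> F" if "y j = Some t" for j t
    using tiling_letter[of "\<lambda>_. a" 1 N "j + (1 + int N)" t] that by (auto simp: y_def F_def)
  ultimately have "y \<in> sys_seqs (set l)"
    by (auto simp: sys_seqs_def l)
  moreover have "point y \<in> Sat test L"
    using N tiling_window[of 0 1 _ N "\<lambda>_. a"] by (simp add: y_def)
  moreover have "set l \<subseteq> M"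
    using a(1) by (auto simp: l F_def sys_seqs_def)
  ultimately show "\<exists>l. set l \<subseteq> M \<and> meets (sys (set l)) test L"
    by (auto simp: meets_def sys_def intro!: exI[of _ l])
next
  assume "\<exists>l. set l \<subseteq> M \<and> meets (sys (set l)) test L"
  then show "meets (sys M) test L"
    by (force simp: meets_def sys_def sys_seqs_def)
qed

lemma continuous_map_shift: "continuous_map (sysT M) (sysT M) shift"
  and continuous_map_unshift: "continuous_map (sysT M) (sysT M) unshift"
proof -
  have "continuous_on UNIV (\<lambda>x :: int \<times> nat list \<Rightarrow> bool. \<lambda>i. x (fst i + c, snd i))" for c
    by (intro continuous_on_coordinatewise_then_product continuous_on_product_coordinates)
  from this[of 1] this[of "-1"] have "continuous_on UNIV shift" "continuous_on UNIV unshift"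
    by (simp_all add: shift_def[abs_def] unshift_def[abs_def] case_prod_beta')
  then show "continuous_map (sysT M) (sysT M) shift" "continuous_map (sysT M) (sysT M) unshift"
    using shift_in_sys unshift_in_sys unfolding sysT_def
    by (auto intro: continuous_on_subset)
qed

lemma homeomorphic_map_shift: "homeomorphic_map (sysT M) (sysT M) shift"
proof -
  have "homeomorphic_maps (sysT M) (sysT M) shift unshift"
    unfolding homeomorphic_maps_def using continuous_map_shift continuous_map_unshift by simp
  then show ?thesis by (rule homeomorphic_maps_imp_map)
qed

text \<open>Each of the finitely many open sets contains all points with some prescribed window.
  After enlarging the windows to a common radius, the periodic sequence that cycles through them
  visits every set.\<close>

lemma chaotic_shift: "chaotic (sysT M) shift"
  unfolding chaotic_def
proof (intro allI impI; elim conjE)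
  fix \<U> assume fin: "finite \<U>" and op: "\<forall>U \<in> \<U>. openin (sysT M) U \<and> U \<noteq> {}" and cov: "\<Union>\<U> = topspace (sysT M)"
  define K where "K = card \<U>"
  have "\<U> \<noteq> {}"
    using cov None_in_sys_seqs[of M] by (auto simp: sys_def)
  then have K: "K > 0" using fin by (simp add: K_def card_gt_0_iff)
  obtain h where h: "bij_betw h {..<K} \<U>"
    unfolding K_def using ex_bij_betw_nat_finite[OF fin] by (auto simp: atLeast0LessThan)
  have "\<exists>a N. a \<in> sys_seqs M \<and> (\<forall>a' \<in> sys_seqs M. (\<forall>i. \<bar>i\<bar> \<le> int N \<longrightarrow> a' i = a i) \<longrightarrow> point a' \<in> h k)"
    if "k < K" for k
  proof -
    have "h k \<in> \<U>" using h that by (auto simp: bij_betw_def)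
    then have o: "openin (sysT M) (h k)" and "h k \<noteq> {}" using op by auto
    moreover from o have "h k \<subseteq> sys M" using openin_subset by fastforce
    ultimately obtain a where "a \<in> sys_seqs M" "point a \<in> h k" by (auto simp: sys_def)
    then show ?thesis using openin_sysT_window[OF o] by blast
  qed
  then obtain a N where aN: "\<And>k. k < K \<Longrightarrow> a k \<in> sys_seqs M"
    "\<And>k a'. k < K \<Longrightarrow> a' \<in> sys_seqs M \<Longrightarrow> (\<And>i. \<bar>i\<bar> \<le> int (N k) \<Longrightarrow> a' i = a k i) \<Longrightarrow> point a' \<in> h k"
    by metis
  define m where "m = Max (N ` {..<K})"
  have m: "N k \<le> m" if "k < K" for k
    unfolding m_def using that by (intro Max_ge) auto
  define y where "y = tiling a K m"
  have y_mem: "(\<lambda>j. y (j + s)) \<in> sys_seqs M" for s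
    unfolding y_def using aN(1) K by (intro tiling_in_sys_seqs) auto
  have visit: "\<exists>n. (shift ^^ n) (point y) \<in> U" if U: "U \<in> \<U>" for U
  proof -
    obtain k where k: "k < K" "U = h k" using h U by (auto simp: bij_betw_def)
    define n where "n = nat (int k * tile_size m + 1 + int m)"
    have n: "int n = int k * tile_size m + 1 + int m"
      unfolding n_def using tile_size_pos[of m] by simp
    have "point (\<lambda>j. y (j + int n)) \<in> h k"
    proof (rule aN(2)[OF k(1) y_mem])
      fix i assume "\<bar>i\<bar> \<le> int (N k)"
      then have "\<bar>i\<bar> \<le> int m" using m[OF k(1)] by linarith
      then show "y (i + int n) = a k i"
        unfolding y_def n by (rule tiling_window[OF k(1)])
    qed
    then show ?thesis using k(2) shift_funpow_point by metis
  qed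
  have "(shift ^^ (K * nat (tile_size m))) (point y) = point y"
    unfolding shift_funpow_point y_def using tiling_periodic[OF K] by simp
  moreover have "K * nat (tile_size m) > 0" using K tile_size_pos[of m] by simp
  ultimately have "periodic_point shift (point y)" unfolding periodic_point_def by blast
  moreover have "point y \<in> sys M" using y_mem[of 0] by (simp add: sys_def)
  ultimately show "\<exists>x \<in> topspace (sysT M). periodic_point shift x \<and> (\<forall>U \<in> \<U>. \<exists>n. (shift ^^ n) x \<in> U)"
    using visit by auto
qed

section \<open>Permutations of the alphabet\<close>

definition relabel :: "(nat \<Rightarrow> nat) \<Rightarrow> (int \<times> nat list \<Rightarrow> bool) \<Rightarrow> int \<times> nat list \<Rightarrow> bool" where
  "relabel h x = (\<lambda>(j, t). x (j, map (inv_into UNIV h) t))"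

lemma map_in_step: "u \<in> step t \<Longrightarrow> map h u \<in> step (map h t)"
  by (auto simp: step_def intro: map_mono_prefix)

lemma relabel_point:
  assumes "bij h"
  shows "relabel h (point a) = point (\<lambda>j. map_option (map h) (a j))"
proof -
  have "a j = Some (map (inv_into UNIV h) t) \<longleftrightarrow> map_option (map h) (a j) = Some t" for j t
  proof -
    have 1: "map h (map (inv_into UNIV h) t) = t"
      using assms by (simp add: bij_is_surj surj_f_inv_f map_idI)
    have 2: "map (inv_into UNIV h) (map h u) = u" for u
      using assms by (simp add: bij_is_inj inv_f_f map_idI)
    show ?thesis
    proof (cases "a j")
      case (Some u)
      then show ?thesis using 1 2[of u] by (auto simp del: map_map)
    qed simp
  qed
  then have eq: "relabel h (point a) (j, t) = point (\<lambda>j. map_option (map h) (a j)) (j, t)" for j t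
    by (simp add: relabel_def)
  show ?thesis
  proof (rule ext)
    show "relabel h (point a) i = point (\<lambda>j. map_option (map h) (a j)) i" for i
      using eq by (cases i) blast
  qed
qed

lemma relabel_in_sys:
  assumes "bij h" "x \<in> sys M"
  shows "relabel h x \<in> sys (map h ` M)"
proof -
  obtain a where x: "x = point a" and a: "ruled a" "\<And>j t. a j = Some t \<Longrightarrow> t \<in> M"
    using assms(2) by (auto simp: sys_def sys_seqs_def)
  have "ruled (\<lambda>j. map_option (map h) (a j))"
    unfolding ruled_def
  proof (intro conjI allI impI)
    show "u \<in> step t" if "map_option (map h) (a j) = Some t \<and> map_option (map h) (a (j + 1)) = Some u" for j t u
      using that ruled_step[OF a(1)] map_in_step by auto
    show "map_option (map h) (a (j + 1)) \<noteq> None"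
      if "(\<forall>k\<le>n. map_option (map h) (a (j - int k)) \<noteq> None) \<and> map_option (map h) (a (j + 1 + int n)) \<noteq> None" for j n
      using that ruled_run[OF a(1), of n j] by simp
  qed
  then have "(\<lambda>j. map_option (map h) (a j)) \<in> sys_seqs (map h ` M)"
    using a(2) by (auto simp: sys_seqs_def)
  then show ?thesis
    unfolding x relabel_point[OF assms(1)] by (simp add: sys_def)
qed

lemma conjugate_sys_map:
  assumes h: "bij h"
  shows "conjugate_systems (sysT M) shift (sysT (map h ` M)) shift"
proof -
  have cont: "continuous_on UNIV (relabel g)" for g
  proof -
    have "continuous_on UNIV (\<lambda>x :: int \<times> nat list \<Rightarrow> bool. \<lambda>i. x (fst i, map (inv_into UNIV g) (snd i)))"
      by (intro continuous_on_coordinatewise_then_product continuous_on_product_coordinates)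
    then show ?thesis by (simp add: relabel_def[abs_def] case_prod_beta')
  qed
  have hi: "bij (inv_into UNIV h)" "inv_into UNIV (inv_into UNIV h) = h" using h by (simp_all add: bij_imp_bij_inv inv_inv_eq)
  have hh: "map (inv_into UNIV h) ` map h ` M = M"
    using h by (auto simp: image_image bij_is_inj inv_f_f o_def)
  have "homeomorphic_maps (sysT M) (sysT (map h ` M)) (relabel h) (relabel (inv_into UNIV h))"
    unfolding homeomorphic_maps_def
  proof (intro conjI ballI)
    show "continuous_map (sysT M) (sysT (map h ` M)) (relabel h)"
      using relabel_in_sys[OF h] continuous_on_subset[OF cont] unfolding sysT_def by auto
    show "continuous_map (sysT (map h ` M)) (sysT M) (relabel (inv_into UNIV h))"
      using relabel_in_sys[OF hi(1), of _ "map h ` M"] continuous_on_subset[OF cont]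
      unfolding sysT_def hh by auto
    have "map (inv_into UNIV h) (map h t) = t" "map h (map (inv_into UNIV h) t) = t" for t
      using h by (simp_all add: bij_is_inj bij_is_surj inv_f_f surj_f_inv_f map_idI)
    then show "relabel (inv_into UNIV h) (relabel h x) = x" "relabel h (relabel (inv_into UNIV h) x) = x" for x
      unfolding relabel_def hi(2) by (auto simp del: map_map)
  qed
  then have "homeomorphic_map (sysT M) (sysT (map h ` M)) (relabel h)"
    by (rule homeomorphic_maps_imp_map)
  moreover have "relabel h (shift x) = shift (relabel h x)" for x
    by (auto simp: relabel_def shift_def)
  ultimately show ?thesis unfolding conjugate_systems_def by blast
qed

section \<open>Recovering the set of words from asymptotic connections\<close>

definition fixed_points :: "'p topology \<Rightarrow> ('p \<Rightarrow> 'p) \<Rightarrow> 'p set" where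
  "fixed_points X T = {x \<in> topspace X. T x = x}"

text \<open>A two-sided orbit that is heteroclinic from \<open>p\<close> to \<open>q\<close>. The
  whole orbit is part of the data, so only \<open>T\<close> and the topology are mentioned and the
  relation passes through conjugacies.\<close>

definition connects :: "'p topology \<Rightarrow> ('p \<Rightarrow> 'p) \<Rightarrow> 'p \<Rightarrow> 'p \<Rightarrow> bool" where
  "connects X T p q \<longleftrightarrow> (\<exists>z :: int \<Rightarrow> 'p. (\<forall>n. z n \<in> topspace X \<and> T (z n) = z (n + 1)) \<and>
     limitin X (\<lambda>n. z (- int n)) p sequentially \<and> limitin X (\<lambda>n. z (int n)) q sequentially)"

lemma connects_continuous_image:
  assumes h: "continuous_map X Y h" and hT: "\<And>x. x \<in> topspace X \<Longrightarrow> h (T x) = S (h x)"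
    and "connects X T p q"
  shows "connects Y S (h p) (h q)"
proof -
  obtain z :: "int \<Rightarrow> 'a" where z: "\<And>n. z n \<in> topspace X" "\<And>n. T (z n) = z (n + 1)"
    and lim: "limitin X (\<lambda>n. z (- int n)) p sequentially" "limitin X (\<lambda>n. z (int n)) q sequentially"
    using assms(3) unfolding connects_def by blast
  have "limitin Y (h \<circ> (\<lambda>n. z (- int n))) (h p) sequentially" "limitin Y (h \<circ> (\<lambda>n. z (int n))) (h q) sequentially"
    using continuous_map_limit[OF h] lim by blast+
  moreover have "h (z n) \<in> topspace Y" for n
    using continuous_map_funspace[OF h] z(1) by auto
  moreover have "S (h (z n)) = h (z (n + 1))" for n
    using hT[OF z(1)] z(2) by metis
  ultimately show ?thesis
    unfolding connects_def by (intro exI[of _ "\<lambda>n. h (z n)"]) (simp add: o_def)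
qed

lemma conjugate_systems_invariants:
  assumes "conjugate_systems X T Y S" and T: "T ` topspace X \<subseteq> topspace X" and S: "S ` topspace Y \<subseteq> topspace Y"
  obtains h where "bij_betw h (fixed_points X T) (fixed_points Y S)"
    "\<And>p q. p \<in> fixed_points X T \<Longrightarrow> q \<in> fixed_points X T \<Longrightarrow> connects X T p q \<longleftrightarrow> connects Y S (h p) (h q)"
proof -
  obtain h where h: "homeomorphic_map X Y h" and hT: "\<And>x. x \<in> topspace X \<Longrightarrow> h (T x) = S (h x)"
    using assms(1) by (auto simp: conjugate_systems_def)
  define g where "g = inv_into (topspace X) h"
  have hg: "homeomorphic_maps X Y h g"
    unfolding g_def by (rule homeomorphic_maps_inv_into[OF h])
  then have cont: "continuous_map X Y h" "continuous_map Y X g"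
    and gh: "\<And>x. x \<in> topspace X \<Longrightarrow> g (h x) = x" and hg: "\<And>y. y \<in> topspace Y \<Longrightarrow> h (g y) = y"
    by (auto simp: homeomorphic_maps_def)
  have hY: "h x \<in> topspace Y" if "x \<in> topspace X" for x
    using continuous_map_funspace[OF cont(1)] that by (rule funcset_mem)
  have gX: "g y \<in> topspace X" if "y \<in> topspace Y" for y
    using continuous_map_funspace[OF cont(2)] that by (rule funcset_mem)
  have gS: "g (S y) = T (g y)" if "y \<in> topspace Y" for y
    using hT[OF gX[OF that]] hg[OF that] gh T gX[OF that] by (metis image_subset_iff)
  have "bij_betw h (fixed_points X T) (fixed_points Y S)"
  proof (rule bij_betw_byWitness[of _ g])
    show "h ` fixed_points X T \<subseteq> fixed_points Y S"
      using hY hT by (force simp: fixed_points_def)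
    show "g ` fixed_points Y S \<subseteq> fixed_points X T"
      using gX gS by (force simp: fixed_points_def)
  qed (use gh hg in \<open>auto simp: fixed_points_def\<close>)
  moreover have "connects X T p q \<longleftrightarrow> connects Y S (h p) (h q)"
    if "p \<in> fixed_points X T" "q \<in> fixed_points X T" for p q
  proof
    assume "connects Y S (h p) (h q)"
    then have "connects X T (g (h p)) (g (h q))"
      using connects_continuous_image[OF cont(2), of S T] gS by blast
    then show "connects X T p q" using gh that by (simp add: fixed_points_def)
  next
    show "connects X T p q \<Longrightarrow> connects Y S (h p) (h q)"
      using connects_continuous_image[OF cont(1), of T S] hT by blast
  qed
  ultimately show ?thesis by (rule that)
qed

section \<open>Fixed points of the shift and their connections\<close>

definition const_point :: "nat list \<Rightarrow> int \<times> nat list \<Rightarrow> bool" where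
  "const_point t = point (\<lambda>_. Some t)"

definition rest_point :: "int \<times> nat list \<Rightarrow> bool" where
  "rest_point = point (\<lambda>_. None)"

lemma const_point_eq_iff: "const_point s = const_point t \<longleftrightarrow> s = t"
  by (auto simp: const_point_def point_eq_iff fun_eq_iff)

lemma const_point_neq_rest: "const_point s \<noteq> rest_point"
  by (auto simp: const_point_def rest_point_def point_eq_iff fun_eq_iff)

lemma fixed_points_sys:
  assumes "[] \<notin> M"
  shows "fixed_points (sysT M) shift = insert rest_point (const_point ` M)"
proof (intro equalityI subsetI)
  fix x assume "x \<in> fixed_points (sysT M) shift"
  then obtain a where x: "x = point a" and a: "a \<in> sys_seqs M" and "shift (point a) = point a"
    by (auto simp: fixed_points_def sys_def)
  then have step: "a (j + 1) = a j" for j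
    unfolding shift_point point_eq_iff by (metis)
  have "a j = a 0" for j
  proof (induction j rule: int_induct[of _ 0])
    case (step2 i)
    then show ?case using step[of "i - 1"] by simp
  qed (use step in auto)
  then have "a = (\<lambda>_. a 0)" by auto
  then show "x \<in> insert rest_point (const_point ` M)"
    using a x by (cases "a 0") (auto simp: sys_seqs_def const_point_def rest_point_def)
next
  fix x assume "x \<in> insert rest_point (const_point ` M)"
  moreover have "t \<in> M \<Longrightarrow> t \<noteq> []" for t using assms by auto
  ultimately show "x \<in> fixed_points (sysT M) shift"
    using const_in_sys_seqs[of _ M] None_in_sys_seqs[of M]
    by (auto simp: fixed_points_def sys_def const_point_def rest_point_def shift_point)
qed

lemma limitin_sysT_coordinate:
  assumes "limitin (sysT M) z (point a) sequentially" "a j = Some t"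
  shows "\<forall>\<^sub>F n in sequentially. z n (j, t)"
proof -
  have "openin (sysT M) (sys M \<inter> {x. x (j, t)})"
    using open_coordinate[of "(j, t)" True] by (auto simp: sysT_def openin_open)
  moreover have "point a \<in> sys M \<inter> {x. x (j, t)}"
    using limitin_topspace[OF assms(1)] assms(2) by simp
  ultimately have "\<forall>\<^sub>F n in sequentially. z n \<in> sys M \<inter> {x. x (j, t)}"
    using assms(1) unfolding limitin_def by blast
  then show ?thesis by (rule eventually_mono) simp
qed

lemma limitin_sysT_windowI:
  assumes "point a \<in> sys M" "\<And>n. c n \<in> sys_seqs M" "\<And>N. \<exists>n0. \<forall>n\<ge>n0. \<forall>i. \<bar>i\<bar> \<le> int N \<longrightarrow> c n i = a i"
  shows "limitin (sysT M) (\<lambda>n. point (c n)) (point a) sequentially"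
  unfolding limitin_sequentially
proof (intro conjI allI impI)
  fix U assume U: "openin (sysT M) U \<and> point a \<in> U"
  then obtain N :: nat where N: "\<forall>a' \<in> sys_seqs M. (\<forall>i. \<bar>i\<bar> \<le> int N \<longrightarrow> a' i = a i) \<longrightarrow> point a' \<in> U"
    using openin_sysT_window by blast
  then show "\<exists>n0. \<forall>n\<ge>n0. point (c n) \<in> U"
    using assms(3)[of N] assms(2) by blast
qed (use assms(1) in simp)

lemma connectsI:
  assumes a: "a \<in> sys_seqs M" and l: "(\<lambda>_. l) \<in> sys_seqs M" "\<And>j. j < 0 \<Longrightarrow> a j = l"
    and r: "(\<lambda>_. r) \<in> sys_seqs M" "\<And>j. j \<ge> 0 \<Longrightarrow> a j = r"
  shows "connects (sysT M) shift (point (\<lambda>_. l)) (point (\<lambda>_. r))"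
  unfolding connects_def
proof (intro exI[of _ "\<lambda>n. point (\<lambda>j. a (j + n))"] conjI allI)
  show "point (\<lambda>j. a (j + n)) \<in> topspace (sysT M)" for n
    using sys_seqs_translate[OF a] by (simp add: sys_def)
  show "shift (point (\<lambda>j. a (j + n))) = point (\<lambda>j. a (j + (n + 1)))" for n
    by (simp add: shift_point algebra_simps)
  show "limitin (sysT M) (\<lambda>n. point (\<lambda>j. a (j + - int n))) (point (\<lambda>_. l)) sequentially"
  proof (rule limitin_sysT_windowI)
    show "\<exists>n0. \<forall>n\<ge>n0. \<forall>i. \<bar>i\<bar> \<le> int N \<longrightarrow> a (i + - int n) = l" for N
      using l(2) by (intro exI[of _ "Suc N"]) auto
    show "(\<lambda>j. a (j + - int n)) \<in> sys_seqs M" for n by (rule sys_seqs_translate[OF a])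
  qed (use l(1) in \<open>auto simp: sys_def\<close>)
  show "limitin (sysT M) (\<lambda>n. point (\<lambda>j. a (j + int n))) (point (\<lambda>_. r)) sequentially"
  proof (rule limitin_sysT_windowI)
    show "\<exists>n0. \<forall>n\<ge>n0. \<forall>i. \<bar>i\<bar> \<le> int N \<longrightarrow> a (i + int n) = r" for N
      using r(2) by (intro exI[of _ N]) auto
    show "(\<lambda>j. a (j + int n)) \<in> sys_seqs M" for n by (rule sys_seqs_translate[OF a])
  qed (use r(1) in \<open>auto simp: sys_def\<close>)
qed

text \<open>Switching from \<open>s\<close> to \<open>t\<close> at the origin gives a connection.
  Conversely the orbit is active in the distant past, so the gap rule, used with a position in the
  right tail, rules out a first inactive letter; along the uninterrupted activity the steps compose
  by transitivity.\<close>

lemma connects_const_iff: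
  assumes M: "[] \<notin> M" and s: "s \<in> M" and t: "t \<in> M"
  shows "connects (sysT M) shift (const_point s) (const_point t) \<longleftrightarrow> t \<in> step s"
proof
  assume "t \<in> step s"
  moreover have "s \<noteq> []" "t \<noteq> []" using M s t by auto
  ultimately have "ruled (\<lambda>j. Some (if j < 0 then s else t))"
    by (auto simp: ruled_def step_refl)
  then have "(\<lambda>j. Some (if j < 0 then s else t)) \<in> sys_seqs M"
    using s t by (auto simp: sys_seqs_def)
  then show "connects (sysT M) shift (const_point s) (const_point t)"
    unfolding const_point_def
    by (rule connectsI) (simp_all add: const_in_sys_seqs[OF s \<open>s \<noteq> []\<close>] const_in_sys_seqs[OF t \<open>t \<noteq> []\<close>])
next
  assume "connects (sysT M) shift (const_point s) (const_point t)"
  then obtain z :: "int \<Rightarrow> int \<times> nat list \<Rightarrow> bool" where z: "\<And>n. z n \<in> sys M" "\<And>n. shift (z n) = z (n + 1)"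
    and lim: "limitin (sysT M) (\<lambda>n. z (- int n)) (const_point s) sequentially"
      "limitin (sysT M) (\<lambda>n. z (int n)) (const_point t) sequentially"
    unfolding connects_def topspace_sysT by blast
  obtain a where z0: "z 0 = point a" and a: "ruled a" using z(1)[of 0] by (auto simp: sys_def sys_seqs_def)
  have zn: "z n = point (\<lambda>j. a (j + n))" for n
  proof (induction n rule: int_induct[of _ 0])
    case base
    then show ?case using z0 by simp
  next
    case (step1 i)
    then show ?case using z(2)[of i] by (simp add: shift_point algebra_simps)
  next
    case (step2 i)
    have "z (i - 1) = unshift (z i)" using z(2)[of "i - 1"] by (metis diff_add_cancel unshift_shift)
    then show ?case using step2 by (simp add: unshift_point algebra_simps)
  qed
  have "\<forall>\<^sub>F n in sequentially. z (- int n) (0, s)" "\<forall>\<^sub>F n in sequentially. z (int n) (0, t)"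
    using limitin_sysT_coordinate[OF lim(1)[unfolded const_point_def], where j = 0 and t = s]
      limitin_sysT_coordinate[OF lim(2)[unfolded const_point_def], where j = 0 and t = t] by simp_all
  then obtain n0 n1 :: nat where left: "\<And>n. n \<ge> n0 \<Longrightarrow> a (- int n) = Some s" and right: "\<And>n. n \<ge> n1 \<Longrightarrow> a (int n) = Some t"
    unfolding eventually_sequentially zn by (simp add: point_def) blast
  have act: "a (- int n0 + int k) \<noteq> None" for k
  proof (induction k rule: less_induct)
    case (less k)
    show ?case
    proof (cases k)
      case (Suc k')
      \<comment> \<open>\<open>?n\<close> is so large that \<open>?j + 1 + ?n\<close> lies in the
        tail where the letter is \<open>t\<close>. An active run of the matching length is available
        because everything up to \<open>?j\<close> is active.\<close>
      let ?j = "- int n0 + int k'" and ?n = "n0 + n1 + k'"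
      have "a (?j - int i) \<noteq> None" for i
      proof (cases "i \<le> k'")
        case True
        then have e: "?j - int i = - int n0 + int (k' - i)" by simp
        show ?thesis unfolding e by (rule less.IH) (use Suc in linarith)
      next
        case False
        then have "?j - int i = - int (n0 + (i - k'))" by simp
        moreover have "a (- int (n0 + (i - k'))) = Some s" by (rule left) simp
        ultimately show ?thesis by (metis option.distinct(1))
      qed
      moreover have e: "?j + 1 + int ?n = int (n1 + 2 * k' + 1)" by simp
      have "a (?j + 1 + int ?n) = Some t" unfolding e by (rule right) simp
      then have "a (?j + 1 + int ?n) \<noteq> None" by (metis option.distinct(1))
      ultimately have "a (?j + 1) \<noteq> None" using ruled_run[OF a, of ?n ?j] by blast
      then show ?thesis by (simp add: Suc algebra_simps)
    next
      case 0
      then show ?thesis using left[of n0] by simp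
    qed
  qed
  have path: "\<exists>u \<in> step s. a (- int n0 + int k) = Some u" for k
  proof (induction k)
    case 0
    have "s \<noteq> []" using M s by auto
    then show ?case using left[of n0] by (auto simp: step_refl)
  next
    case (Suc k)
    then obtain u where u: "u \<in> step s" "a (- int n0 + int k) = Some u" by blast
    obtain w where w: "a (- int n0 + int (Suc k)) = Some w" using act[of "Suc k"] by auto
    then have "w \<in> step u" using ruled_step[OF a u(2), of w] by (simp add: algebra_simps)
    then show ?case using w u(1) step_trans by blast
  qed
  show "t \<in> step s" using path[of "n0 + n1"] right[of n1] by simp
qed

text \<open>Both rules restrict only what follows an active letter, so the inactive sequence may
  turn into any constant word of \<open>M\<close>. This property singles out the rest point among
  the fixed points.\<close>

lemma connects_rest:
  assumes M: "[] \<notin> M" and q: "q \<in> fixed_points (sysT M) shift"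
  shows "connects (sysT M) shift rest_point q"
proof -
  consider "q = rest_point" | t where "q = const_point t" "t \<in> M"
    using q fixed_points_sys[OF M] by auto
  then show ?thesis
  proof cases
    case 1
    show ?thesis unfolding 1 rest_point_def
      by (rule connectsI[of "\<lambda>_. None"]) (auto simp: None_in_sys_seqs)
  next
    case 2
    then have "t \<noteq> []" using M by auto
    have "ruled (\<lambda>j. if j < 0 then None else Some t)"
    proof -
      have "\<not> j < 0" if "\<forall>k\<le>n. (if j - int k < 0 then None else Some t) \<noteq> None" for j and n :: nat
        using that[rule_format, of 0] by (simp split: if_splits)
      then show ?thesis
        unfolding ruled_def using step_refl[OF \<open>t \<noteq> []\<close>] by (auto split: if_splits)
    qed
    then have "(\<lambda>j. if j < 0 then None else Some t) \<in> sys_seqs M"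
      using 2 by (auto simp: sys_seqs_def split: if_splits)
    then show ?thesis
      unfolding 2 const_point_def rest_point_def
      by (rule connectsI) (simp_all add: None_in_sys_seqs const_in_sys_seqs[OF 2(2) \<open>t \<noteq> []\<close>])
  qed
qed

text \<open>The words \<open>a\<^sup>n s\<close> with \<open>a # s\<close> distinct, where \<open>n \<ge> 2\<close> unless \<open>s\<close> is empty: the block of
  repeated first letters can carry a number, and a word is determined by its longest proper prefix
  together with its set of letters.\<close>

definition code_tree :: "nat list set \<Rightarrow> bool" where
  "code_tree M \<longleftrightarrow> [] \<notin> M \<and> (\<forall>v. [v] \<in> M) \<and> (\<forall>t v. t @ [v] \<in> M \<longrightarrow> t = [] \<or> t \<in> M) \<and>
     (\<forall>t v. t @ [v] \<in> M \<and> v \<in> set t \<longrightarrow> set t = {v}) \<and> (\<forall>u v. [u, v] \<in> M \<longrightarrow> u = v)"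

lemma singleton_in_step_iff: "[v] \<in> step t \<longleftrightarrow> v \<in> set t"
  by (cases t) (auto simp: step_def)

text \<open>Every word reaches its own first letter, so only one-letter words can be minimal. The
  alphabet is thereby visible in the order.\<close>

lemma step_minimal_iff:
  assumes "code_tree M" "t \<in> M"
  shows "(\<forall>u \<in> M. u \<in> step t \<longrightarrow> u = t) \<longleftrightarrow> length t = 1"
proof
  assume min: "\<forall>u \<in> M. u \<in> step t \<longrightarrow> u = t"
  have "t \<noteq> []" using assms by (auto simp: code_tree_def)
  then have "[hd t] \<in> step t" by (simp add: singleton_in_step_iff)
  moreover have "[hd t] \<in> M" using assms by (auto simp: code_tree_def)
  ultimately have "[hd t] = t" using min by blast
  then show "length t = 1" by (metis One_nat_def length_Cons list.size(3))
next
  assume "length t = 1"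
  then obtain v where "t = [v]" by (auto simp: length_Suc_conv)
  then show "\<forall>u \<in> M. u \<in> step t \<longrightarrow> u = t" by (auto simp: step_def prefix_Cons)
qed

lemma step_long_iff: "length u \<noteq> 1 \<Longrightarrow> u \<in> step t \<longleftrightarrow> u \<noteq> [] \<and> prefix u t"
  by (auto simp: step_def)

text \<open>Minimal elements correspond, which gives the permutation \<open>h\<close>; since
  \<open>[v] \<in> step t\<close> means \<open>v \<in> set t\<close>, sets of letters correspond as
  well. Among words of length at least two \<open>step\<close> is the prefix order, so by induction
  the longest proper prefix of \<open>f (t @ [v])\<close> is known, and its last letter is read off
  from the set of letters. A one-letter word below another word need not be its prefix, which is why
  words of length two must have the form \<open>[v, v]\<close>.\<close>

lemma code_tree_rigid:
  assumes M: "code_tree M" and N: "code_tree N" and f: "bij_betw f M N"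
    and iso: "\<And>s t. s \<in> M \<Longrightarrow> t \<in> M \<Longrightarrow> t \<in> step s \<longleftrightarrow> f t \<in> step (f s)"
  shows "\<exists>h. bij h \<and> N = map h ` M"
proof -
  have fN: "f t \<in> N" if "t \<in> M" for t using f that by (auto simp: bij_betw_def)
  have f_inj: "f s = f t \<longleftrightarrow> s = t" if "s \<in> M" "t \<in> M" for s t
    using f that by (auto simp: bij_betw_def dest: inj_onD)
  have f_surj: "\<exists>t \<in> M. f t = w" if "w \<in> N" for w
    using f that by (auto simp: bij_betw_def)
  have len1: "length (f t) = 1 \<longleftrightarrow> length t = 1" if t: "t \<in> M" for t
  proof -
    have "(\<forall>u \<in> N. u \<in> step (f t) \<longrightarrow> u = f t) \<longleftrightarrow> (\<forall>u \<in> M. u \<in> step t \<longrightarrow> u = t)"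
    proof
      assume *: "\<forall>u \<in> N. u \<in> step (f t) \<longrightarrow> u = f t"
      show "\<forall>u \<in> M. u \<in> step t \<longrightarrow> u = t" using * fN iso[OF t] f_inj t by blast
    next
      assume *: "\<forall>u \<in> M. u \<in> step t \<longrightarrow> u = t"
      show "\<forall>u \<in> N. u \<in> step (f t) \<longrightarrow> u = f t"
      proof (intro ballI impI)
        fix u assume u: "u \<in> N" "u \<in> step (f t)"
        obtain s where s: "s \<in> M" "f s = u" using f_surj u(1) by blast
        then show "u = f t" using * iso[OF t s(1)] u(2) by auto
      qed
    qed
    then show ?thesis using step_minimal_iff[OF M t] step_minimal_iff[OF N fN[OF t]] by simp
  qed
  have single: "[v] \<in> M" "[v] \<in> N" for v using M N by (auto simp: code_tree_def)
  define h where "h v = hd (f [v])" for v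
  have fh: "f [v] = [h v]" for v
    using len1[OF single(1)[of v]] by (auto simp: h_def length_Suc_conv)
  have "inj h"
    using fh f_inj[OF single(1) single(1)] by (metis injI list.inject)
  moreover have "surj h"
  proof -
    have "\<exists>v. h v = w" for w
    proof -
      obtain t where t: "t \<in> M" "f t = [w]" using f_surj[OF single(2)] by blast
      then have "length t = 1" using len1[OF t(1)] by simp
      then obtain v where "t = [v]" by (auto simp: length_Suc_conv)
      then show ?thesis using t fh by auto
    qed
    then show ?thesis by (metis surj_def)
  qed
  ultimately have "bij h" by (simp add: bij_def)
  have set_f: "set (f t) = h ` set t" if t: "t \<in> M" for t
  proof -
    have "h v \<in> set (f t) \<longleftrightarrow> v \<in> set t" for v
      using iso[OF t single(1), of v] by (simp add: fh singleton_in_step_iff)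
    then have "h -` set (f t) = set t" by auto
    then show ?thesis using \<open>surj h\<close> by (metis surj_image_vimage_eq)
  qed
  have "f t = map h t" if "t \<in> M" for t
    using that
  proof (induction t rule: rev_induct)
    case Nil
    then show ?case using M by (simp add: code_tree_def)
  next
    case (snoc v t)
    show ?case
    proof (cases "t = []")
      case True
      then show ?thesis using fh by simp
    next
      case False
      then have t: "t \<in> M" using snoc.prems M by (auto simp: code_tree_def)
      then have IH: "f t = map h t" using snoc.IH by simp
      have long: "length (t @ [v]) \<noteq> 1" using False by simp
      have fN': "f (t @ [v]) \<in> N" using fN snoc.prems by blast
      then have "f (t @ [v]) \<noteq> []" using N by (auto simp: code_tree_def)
      then obtain w u where w: "f (t @ [v]) = w @ [u]" by (metis rev_exhaust)
      have "length (w @ [u]) \<noteq> 1" using len1[OF snoc.prems] long w by simp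
      then have "w \<noteq> []" by auto
      then have wN: "w \<in> N" using N fN' w by (auto simp: code_tree_def)
      \<comment> \<open>If \<open>w\<close> is longer than one letter, its preimage is a proper
        prefix of \<open>t @ [v]\<close>, hence a prefix of \<open>t\<close>.\<close>
      have pull: "\<exists>s \<in> M. f s = w \<and> prefix s t \<and> length s \<noteq> 1 \<and> s \<noteq> []" if "length w \<noteq> 1"
      proof -
        obtain s where s: "s \<in> M" "f s = w" using f_surj wN by blast
        have "length s \<noteq> 1" using len1[OF s(1)] s(2) that by simp
        have "w \<in> step (w @ [u])" using \<open>w \<noteq> []\<close> by (simp add: step_def)
        then have "s \<in> step (t @ [v])" using iso[OF snoc.prems s(1)] s w by simp
        then have "s \<noteq> []" "prefix s (t @ [v])" using \<open>length s \<noteq> 1\<close> step_long_iff by blast+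
        moreover have "s \<noteq> t @ [v]" using s w by auto
        ultimately show ?thesis using s \<open>length s \<noteq> 1\<close> by (auto simp: prefix_snoc)
      qed
      have "w = map h t"
      proof (cases "length t = 1")
        \<comment> \<open>Both words turn out to have length two, hence to repeat one letter, and
          comparing their sets of letters identifies it.\<close>
        case True
        have "length w = 1"
        proof (rule ccontr)
          assume "length w \<noteq> 1"
          then obtain s where "prefix s t" "length s \<noteq> 1" "s \<noteq> []" using pull by blast
          then show False using True prefix_length_le[of s t] by (cases s) auto
        qed
        then obtain b where b: "w = [b]" by (auto simp: length_Suc_conv)
        obtain a where a: "t = [a]" using True by (auto simp: length_Suc_conv)
        have "[b, u] \<in> N" using fN' unfolding w b by simp
        moreover have "[a, v] \<in> M" using snoc.prems unfolding a by simp
        ultimately have "u = b" "v = a" using N M by (auto simp: code_tree_def)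
        have "set (w @ [u]) = h ` set (t @ [v])" using set_f[OF snoc.prems] unfolding w .
        then have "b \<in> h ` {a}" unfolding a b \<open>u = b\<close> \<open>v = a\<close> by auto
        then show ?thesis by (simp add: a b)
      next
        case False
        have "t \<in> step (t @ [v])" using \<open>t \<noteq> []\<close> by (simp add: step_def)
        then have "f t \<in> step (w @ [u])" using iso[OF snoc.prems t] w by simp
        moreover have "length (f t) \<noteq> 1" using False len1[OF t] by simp
        ultimately have "prefix (f t) (w @ [u])" using step_long_iff by blast
        moreover have "f t \<noteq> w @ [u]" using f_inj[OF t snoc.prems] w by auto
        ultimately have 1: "prefix (f t) w" by (auto simp: prefix_snoc)
        have "length (f t) \<ge> 2" using False \<open>t \<noteq> []\<close> unfolding IH by (cases t rule: rev_cases) (auto simp: Suc_le_eq)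
        then have "length w \<noteq> 1" using prefix_length_le[OF 1] by simp
        then obtain s where s: "s \<in> M" "f s = w" "prefix s t" "length s \<noteq> 1" "s \<noteq> []" using pull by blast
        then have "s \<in> step t" by (simp add: step_def)
        then have "w \<in> step (f t)" using iso[OF t s(1)] s(2) by simp
        then have "prefix w (f t)" using \<open>length w \<noteq> 1\<close> step_long_iff by blast
        then show ?thesis using 1 IH by (simp add: prefix_order.antisym)
      qed
      moreover have "u = h v"
      proof -
        \<comment> \<open>Either \<open>v\<close> is new, and then \<open>u\<close> must be the one
          added letter, or \<open>code_tree\<close> leaves \<open>v\<close> as the only letter of
          \<open>t\<close>.\<close>
        have set_wu: "insert u (h ` set t) = insert (h v) (h ` set t)"
          using set_f[OF snoc.prems] unfolding w \<open>w = map h t\<close> by simp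
        show ?thesis
        proof (cases "v \<in> set t")
          case True
          then have "set t = {v}" using M snoc.prems by (auto simp: code_tree_def)
          then show ?thesis using set_wu by auto
        next
          case False
          then have "h v \<notin> h ` set t" using \<open>inj h\<close> by (auto dest: injD)
          then show ?thesis using set_wu by auto
        qed
      qed
      ultimately show ?thesis by (simp add: w)
    qed
  qed
  then have "f ` M = map h ` M" by simp
  then have "N = map h ` M" using f by (simp add: bij_betw_def)
  then show ?thesis using \<open>bij h\<close> by blast
qed

lemma conjugate_sys_iff:
  assumes M: "code_tree M" and N: "code_tree N"
  shows "conjugate_systems (sysT M) shift (sysT N) shift \<longleftrightarrow> (\<exists>h. bij h \<and> N = map h ` M)"
proof
  assume "\<exists>h. bij h \<and> N = map h ` M"
  then show "conjugate_systems (sysT M) shift (sysT N) shift" using conjugate_sys_map by auto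
next
  let ?FM = "fixed_points (sysT M) shift" and ?FN = "fixed_points (sysT N) shift"
  assume "conjugate_systems (sysT M) shift (sysT N) shift"
  moreover have "shift ` topspace (sysT K) \<subseteq> topspace (sysT K)" for K using shift_in_sys by auto
  ultimately obtain g where g: "bij_betw g (?FM) (?FN)"
    and con: "\<And>p q. p \<in> ?FM \<Longrightarrow> q \<in> ?FM \<Longrightarrow>
        connects (sysT M) shift p q \<longleftrightarrow> connects (sysT N) shift (g p) (g q)"
    using conjugate_systems_invariants[of "sysT M" shift "sysT N" shift] by blast
  have ne: "[] \<notin> M" "[] \<notin> N" using M N by (auto simp: code_tree_def)
  note fp = fixed_points_sys[OF ne(1)] fixed_points_sys[OF ne(2)]
  \<comment> \<open>The rest point is recognized by its connections: a constant word
    \<open>s\<close> has none to \<open>[v]\<close> when \<open>v\<close> does not occur in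
    \<open>s\<close>, and such a \<open>v\<close> exists because \<open>s\<close> is finite.\<close>
  have char: "p = rest_point \<longleftrightarrow> (\<forall>q \<in> fixed_points (sysT K) shift. connects (sysT K) shift p q)"
    if K: "code_tree K" and p: "p \<in> fixed_points (sysT K) shift" for K p
  proof
    have neK: "[] \<notin> K" using K by (auto simp: code_tree_def)
    show "\<forall>q \<in> fixed_points (sysT K) shift. connects (sysT K) shift p q" if "p = rest_point"
      using that connects_rest[OF neK] by blast
    assume all: "\<forall>q \<in> fixed_points (sysT K) shift. connects (sysT K) shift p q"
    show "p = rest_point"
    proof (rule ccontr)
      assume "p \<noteq> rest_point"
      then obtain s where s: "s \<in> K" "p = const_point s" using p fixed_points_sys[OF neK] by auto
      obtain v where v: "v \<notin> set s" using ex_new_if_finite[of "set s"] by auto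
      have "[v] \<in> K" using K by (auto simp: code_tree_def)
      then have "const_point [v] \<in> fixed_points (sysT K) shift" using fixed_points_sys[OF neK] by auto
      then have "[v] \<in> step s" using all s connects_const_iff[OF neK s(1) \<open>[v] \<in> K\<close>] by simp
      then show False using v by (simp add: singleton_in_step_iff)
    qed
  qed
  have g_in: "g p \<in> ?FN" if "p \<in> ?FM" for p
    using g that by (auto simp: bij_betw_def)
  have g_rest: "g p = rest_point \<longleftrightarrow> p = rest_point" if p: "p \<in> ?FM" for p
  proof -
    have "(\<forall>q \<in> ?FN. connects (sysT N) shift (g p) q) \<longleftrightarrow>
        (\<forall>q \<in> ?FM. connects (sysT M) shift p q)"
    proof -
      have "?FN = g ` ?FM" using g by (simp add: bij_betw_def)
      then show ?thesis using con[OF p] by simp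
    qed
    then show ?thesis using char[OF M p] char[OF N g_in[OF p]] by simp
  qed
  have "\<exists>u \<in> N. g (const_point t) = const_point u" if "t \<in> M" for t
  proof -
    have "const_point t \<in> ?FM" using that fp by simp
    then have "g (const_point t) \<in> insert rest_point (const_point ` N)" "g (const_point t) \<noteq> rest_point"
      using g_in[of "const_point t"] g_rest[of "const_point t"] fp(2) const_point_neq_rest[of t] by simp_all
    then show ?thesis by auto
  qed
  then obtain f where f: "\<And>t. t \<in> M \<Longrightarrow> f t \<in> N" "\<And>t. t \<in> M \<Longrightarrow> g (const_point t) = const_point (f t)"
    by metis
  have in_fp: "const_point t \<in> ?FM" if "t \<in> M" for t using that fp by simp
  have "bij_betw f M N"
    unfolding bij_betw_def
  proof (intro conjI inj_onI equalityI subsetI)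
    fix s t assume st: "s \<in> M" "t \<in> M" "f s = f t"
    then have "g (const_point s) = g (const_point t)" using f by simp
    then have "const_point s = const_point t"
      using inj_onD[OF bij_betw_imp_inj_on[OF g]] in_fp st by blast
    then show "s = t" by (simp add: const_point_eq_iff)
  next
    fix u assume "u \<in> N"
    then have "const_point u \<in> g ` ?FM" using g fp by (simp add: bij_betw_def)
    then obtain p where p: "p \<in> ?FM" "g p = const_point u" by (metis imageE)
    then have "p \<noteq> rest_point" using g_rest[OF p(1)] const_point_neq_rest[of u] by simp
    then obtain t where "t \<in> M" "p = const_point t" using p fp by auto
    then show "u \<in> f ` M" using f(2)[of t] p(2) const_point_eq_iff by auto
  qed (use f in auto)
  moreover have "t \<in> step s \<longleftrightarrow> f t \<in> step (f s)" if "s \<in> M" "t \<in> M" for s t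
    using con[OF in_fp[OF that(1)] in_fp[OF that(2)]] connects_const_iff[OF ne(1) that]
      connects_const_iff[OF ne(2) f(1)[OF that(1)] f(1)[OF that(2)]] f(2) that by simp
  ultimately show "\<exists>h. bij h \<and> N = map h ` M"
    using code_tree_rigid[OF M N] by blast
qed

section \<open>Transport to the Cantor space\<close>

lemma conjugate_systems_sym:
  assumes "conjugate_systems X T Y S" and T: "\<And>x. x \<in> topspace X \<Longrightarrow> T x \<in> topspace X"
  shows "conjugate_systems Y S X T"
proof -
  obtain h where h: "homeomorphic_map X Y h" and hT: "\<And>x. x \<in> topspace X \<Longrightarrow> h (T x) = S (h x)"
    using assms(1) by (auto simp: conjugate_systems_def)
  define g where "g = inv_into (topspace X) h"
  have hg: "homeomorphic_maps X Y h g"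
    unfolding g_def by (rule homeomorphic_maps_inv_into[OF h])
  then have g: "homeomorphic_map Y X g"
    using homeomorphic_maps_map by blast
  have gh: "g (h x) = x" if "x \<in> topspace X" for x
    using hg that by (simp add: homeomorphic_maps_def)
  have hgy: "h (g y) = y" if "y \<in> topspace Y" for y
    using hg that by (simp add: homeomorphic_maps_def)
  have "g (S y) = T (g y)" if y: "y \<in> topspace Y" for y
  proof -
    have "g y \<in> topspace X"
      using homeomorphic_imp_surjective_map[OF g] y by blast
    then show ?thesis using hT[of "g y"] hgy[OF y] gh[OF T] by metis
  qed
  then show ?thesis using g unfolding conjugate_systems_def by blast
qed

lemma conjugate_systems_trans:
  assumes "conjugate_systems X T Y S" "conjugate_systems Y S Z R"
  shows "conjugate_systems X T Z R"
proof -
  obtain h where h: "homeomorphic_map X Y h" "\<And>x. x \<in> topspace X \<Longrightarrow> h (T x) = S (h x)"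
    using assms(1) by (auto simp: conjugate_systems_def)
  obtain g where g: "homeomorphic_map Y Z g" "\<And>y. y \<in> topspace Y \<Longrightarrow> g (S y) = R (g y)"
    using assms(2) by (auto simp: conjugate_systems_def)
  have "homeomorphic_map X Z (g \<circ> h)"
    using h(1) g(1) by (rule homeomorphic_map_compose)
  moreover have "(g \<circ> h) (T x) = R ((g \<circ> h) x)" if "x \<in> topspace X" for x
  proof -
    have "h x \<in> topspace Y" using homeomorphic_imp_surjective_map[OF h(1)] that by blast
    then show ?thesis using h(2)[OF that] g(2) by simp
  qed
  ultimately show ?thesis unfolding conjugate_systems_def by blast
qed

lemma chaotic_conjugate:
  assumes conj: "conjugate_systems X T Y S" and T: "\<And>x. x \<in> topspace X \<Longrightarrow> T x \<in> topspace X"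
    and ch: "chaotic X T"
  shows "chaotic Y S"
  unfolding chaotic_def
proof (intro allI impI; elim conjE)
  obtain h where h: "homeomorphic_map X Y h" and hT: "\<And>x. x \<in> topspace X \<Longrightarrow> h (T x) = S (h x)"
    using conj by (auto simp: conjugate_systems_def)
  have cont: "continuous_map X Y h" and sur: "h ` topspace X = topspace Y"
    using h homeomorphic_imp_continuous_map homeomorphic_imp_surjective_map by blast+
  fix \<U> assume U: "finite \<U>" "\<forall>U \<in> \<U>. openin Y U \<and> U \<noteq> {}" "\<Union>\<U> = topspace Y"
  define pre where "pre U = {x \<in> topspace X. h x \<in> U}" for U
  have "openin X (pre U) \<and> pre U \<noteq> {}" if "U \<in> \<U>" for U
  proof
    show "openin X (pre U)"
      unfolding pre_def by (rule openin_continuous_map_preimage[OF cont]) (use U(2) \<open>U \<in> \<U>\<close> in simp)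
    have "U \<noteq> {}" using U(2) \<open>U \<in> \<U>\<close> by simp
    then obtain y where y: "y \<in> U" by auto
    then have "y \<in> h ` topspace X" using U(3) that sur by blast
    then show "pre U \<noteq> {}" using y unfolding pre_def by blast
  qed
  moreover have "\<Union>(pre ` \<U>) = topspace X"
    using sur U(3) unfolding pre_def by blast
  ultimately obtain x where x: "x \<in> topspace X" "periodic_point T x" "\<forall>U \<in> pre ` \<U>. \<exists>n. (T ^^ n) x \<in> U"
    using ch[unfolded chaotic_def, rule_format, of "pre ` \<U>"] U(1) by auto
  have it: "(T ^^ n) x \<in> topspace X \<and> h ((T ^^ n) x) = (S ^^ n) (h x)" for n
    by (induction n) (use x(1) T hT in auto)
  obtain m where m: "m > 0" "(T ^^ m) x = x" using x(2) by (auto simp: periodic_point_def)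
  have "(S ^^ m) (h x) = h x" using it[of m] m(2) by simp
  then have "periodic_point S (h x)" using m(1) unfolding periodic_point_def by blast
  moreover have "\<exists>n. (S ^^ n) (h x) \<in> U" if "U \<in> \<U>" for U
  proof -
    have "pre U \<in> pre ` \<U>" using that by (rule imageI)
    then obtain n where "(T ^^ n) x \<in> pre U" using x(3)[rule_format, of "pre U"] by auto
    then show ?thesis using it[of n] unfolding pre_def by (metis (mono_tags, lifting) mem_Collect_eq)
  qed
  moreover have "h x \<in> topspace Y" using sur x(1) by blast
  ultimately show "\<exists>x \<in> topspace Y. periodic_point S x \<and> (\<forall>U \<in> \<U>. \<exists>n. (S ^^ n) x \<in> U)"
    by blast
qed

text \<open>The restriction to the carrier is there because the elements of \<open>cfunspace\<close>
  are extensional functions.\<close>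

definition pull_back_system :: "'p topology \<Rightarrow> ('p \<Rightarrow> 'q) \<Rightarrow> ('q \<Rightarrow> 'q) \<Rightarrow> 'p \<Rightarrow> 'p" where
  "pull_back_system X h S = (\<lambda>x \<in> topspace X. inv_into (topspace X) h (S (h x)))"

lemma pull_back_system:
  assumes h: "homeomorphic_map X Y h" and S: "homeomorphic_map Y Y S"
  shows "homeomorphic_map X X (pull_back_system X h S)"
    and "conjugate_systems X (pull_back_system X h S) Y S"
    and "\<And>x. x \<in> topspace X \<Longrightarrow> pull_back_system X h S x \<in> topspace X"
    and "\<And>x. x \<in> topspace X \<Longrightarrow> h (pull_back_system X h S x) = S (h x)"
proof -
  define g where "g = inv_into (topspace X) h"
  have hg: "homeomorphic_maps X Y h g"
    unfolding g_def by (rule homeomorphic_maps_inv_into[OF h])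
  then have g: "homeomorphic_map Y X g"
    using homeomorphic_maps_map by blast
  have hgy: "h (g y) = y" if "y \<in> topspace Y" for y
    using hg that by (simp add: homeomorphic_maps_def)
  have ShY: "S (h x) \<in> topspace Y" if "x \<in> topspace X" for x
    using homeomorphic_imp_surjective_map[OF h] homeomorphic_imp_surjective_map[OF S] that by blast
  have "homeomorphic_map X X (g \<circ> (S \<circ> h))"
    by (rule homeomorphic_map_compose[OF homeomorphic_map_compose[OF h S] g])
  then show hom: "homeomorphic_map X X (pull_back_system X h S)"
    by (rule homeomorphic_map_eq) (simp add: pull_back_system_def g_def)
  show "h (pull_back_system X h S x) = S (h x)" if "x \<in> topspace X" for x
    using hgy[OF ShY[OF that]] that by (simp add: pull_back_system_def g_def)
  then show "conjugate_systems X (pull_back_system X h S) Y S"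
    unfolding conjugate_systems_def using h by blast
  show "pull_back_system X h S x \<in> topspace X" if "x \<in> topspace X" for x
    using homeomorphic_imp_surjective_map[OF hom] that by blast
qed

text \<open>In the uniform topology every open set of chaotic homeomorphisms is a union of sets
  \<open>W L\<close>, which prescribe, for finitely many cylinders \<open>v\<close>, a cylinder
  \<open>u\<close> containing the image. There are countably many lists \<open>L\<close>, so
  preimages of open sets are countable unions of finite intersections of the sets in
  \<open>meas\<close>.\<close>

lemma measurable_chaotic_homeosI:
  fixes C :: "'a topology" and d :: "'a metric"
  assumes coding: "cantor_coding C b" and d: "mtopology_of d = C"
    and f: "\<And>\<omega>. \<omega> \<in> space \<Omega> \<Longrightarrow> f \<omega> \<in> chaotic_homeos C d"
    and meas: "\<And>u v. {\<omega> \<in> space \<Omega>. f \<omega> ` cantor_coding.cyl C b v \<subseteq> cantor_coding.cyl C b u} \<in> sets \<Omega>"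
  shows "f \<in> measurable \<Omega> (chaotic_homeos_borel C d)"
proof -
  interpret cantor_coding C b by fact
  define D where "D = cfunspace C d"
  define H where "H = chaotic_homeos C d"
  define W where "W L = {g \<in> H. \<forall>(v, u) \<in> set L. g ` cyl v \<subseteq> cyl u}" for L
  have HD: "H \<subseteq> mspace D" by (auto simp: H_def D_def chaotic_homeos_def)
  have local: "\<exists>L. g \<in> W L \<and> W L \<subseteq> V" if V: "openin (mtopology_of D) V" and g: "g \<in> V" "g \<in> H" for V g
  proof -
    interpret D: Metric_space "mspace D" "mdist D" by simp
    have "\<exists>e>0. D.mball g e \<subseteq> V"
      using V g(1) unfolding mtopology_of_def D.openin_mtopology by blast
    then obtain e where e: "e > 0" "mball_of D g e \<subseteq> V"
      unfolding mball_of_def by blast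
    have g_cont: "continuous_map C C g"
      using g(2) d by (auto simp: H_def chaotic_homeos_def homeomorphic_imp_continuous_map)
    have g_in: "g' x \<in> topspace C" if "g' \<in> H" "x \<in> topspace C" for g' x
    proof -
      have "homeomorphic_map C C g'" using that(1) by (simp add: H_def chaotic_homeos_def)
      then show ?thesis using homeomorphic_imp_surjective_map that(2) by blast
    qed
    have topC: "topspace C = mspace d" using d by auto
    \<comment> \<open>Two points of a ball of radius \<open>e / 4\<close> are at distance less than
      \<open>e / 2\<close>, so even the supremum of such distances is strictly below
      \<open>e\<close>.\<close>
    let ?\<U> = "(\<lambda>x. mball_of d x (e / 4)) ` topspace C"
    have opU: "openin C U" if "U \<in> ?\<U>" for U
    proof -
      obtain x where "U = mball_of d x (e / 4)" using \<open>U \<in> ?\<U>\<close> by blast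
      moreover have "openin (mtopology_of d) (mball_of d x (e / 4))"
        by (simp add: mtopology_of_def mball_of_def Metric_space.openin_mball)
      ultimately show ?thesis using d by simp
    qed
    have covU: "topspace C \<subseteq> \<Union>?\<U>"
    proof
      fix x assume x: "x \<in> topspace C"
      then have "mdist d x x = 0" using topC mdist_zero[of x d x] by blast
      then have "mdist d x x < e / 4" using e(1) by linarith
      then have "x \<in> mball_of d x (e / 4)" using topC x by simp
      then show "x \<in> \<Union>?\<U>" using x by blast
    qed
    have "\<exists>n. \<forall>s. length s = n \<longrightarrow> (\<exists>U \<in> ?\<U>. cyl s \<subseteq> U)"
    proof (rule cyl_uniform_basis[OF opU covU])
      fix k assume "\<And>s. length s = k \<Longrightarrow> \<exists>U \<in> ?\<U>. cyl s \<subseteq> U"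
      then show ?thesis by (intro exI[of _ k]) simp
    qed
    then obtain n where n: "\<And>s. length s = n \<Longrightarrow> \<exists>U \<in> ?\<U>. cyl s \<subseteq> U"
      by blast
    \<comment> \<open>By continuity of \<open>g\<close> and compactness, every cylinder of some
      depth \<open>l\<close> is mapped into a cylinder of depth \<open>n\<close>. The list
      \<open>L\<close> records these inclusions for all \<open>v\<close> of length
      \<open>l\<close>.\<close>
    let ?\<V> = "(\<lambda>u. {x \<in> topspace C. g x \<in> cyl u}) ` {u. length u = n}"
    have opV: "openin C U" if "U \<in> ?\<V>" for U
      using that openin_continuous_map_preimage[OF g_cont openin_cyl] by blast
    have covV: "topspace C \<subseteq> \<Union>?\<V>"
    proof
      fix x assume x: "x \<in> topspace C"
      then have "g x \<in> cyl (rev_prefix (code (g x)) n)" using g_in[OF g(2)] by (simp add: in_cyl_iff)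
      moreover have "length (rev_prefix (code (g x)) n) = n" by simp
      ultimately show "x \<in> \<Union>?\<V>" using x by blast
    qed
    have "\<exists>l. \<forall>s. length s = l \<longrightarrow> (\<exists>U \<in> ?\<V>. cyl s \<subseteq> U)"
    proof (rule cyl_uniform_basis[OF opV covV])
      fix k assume "\<And>s. length s = k \<Longrightarrow> \<exists>U \<in> ?\<V>. cyl s \<subseteq> U"
      then show ?thesis by (intro exI[of _ k]) simp
    qed
    then obtain l where l: "\<And>s. length s = l \<Longrightarrow> \<exists>U \<in> ?\<V>. cyl s \<subseteq> U"
      by blast
    have "\<exists>u. length v = l \<longrightarrow> length u = n \<and> g ` cyl v \<subseteq> cyl u" for v
    proof (cases "length v = l")
      case True
      then obtain u where "length u = n" "cyl v \<subseteq> {x \<in> topspace C. g x \<in> cyl u}" using l[of v] by blast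
      then show ?thesis by blast
    qed simp
    then obtain \<phi> where \<phi>: "\<And>v. length v = l \<Longrightarrow> length (\<phi> v) = n \<and> g ` cyl v \<subseteq> cyl (\<phi> v)" by metis
    have "finite {v :: bool list. length v = l}"
      using finite_lists_length_eq[of "UNIV :: bool set" l] by simp
    then obtain vs where vs: "set vs = {v :: bool list. length v = l}" using finite_list by blast
    define L where "L = map (\<lambda>v. (v, \<phi> v)) vs"
    have "g \<in> W L" using g(2) \<phi> vs by (auto simp: W_def L_def)
    moreover have "g' \<in> V" if g': "g' \<in> W L" for g'
    proof -
      have g'H: "g' \<in> H" using g' by (simp add: W_def)
      have "mdist d (g x) (g' x) \<le> e / 2" if x: "x \<in> topspace C" for x
      proof -
        define v where "v = rev_prefix (code x) l"
        have v: "x \<in> cyl v" "length v = l" using x by (simp_all add: v_def in_cyl_iff)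
        then have "g ` cyl v \<subseteq> cyl (\<phi> v)" "g' ` cyl v \<subseteq> cyl (\<phi> v)"
          using \<phi>[OF v(2)] g' vs by (auto simp: W_def L_def)
        then have "g x \<in> cyl (\<phi> v)" "g' x \<in> cyl (\<phi> v)" using v(1) by auto
        moreover obtain z where "z \<in> topspace C" "cyl (\<phi> v) \<subseteq> mball_of d z (e / 4)"
          using n[of "\<phi> v"] \<phi>[OF v(2)] by blast
        ultimately have z: "z \<in> mspace d" "mdist d z (g x) < e / 4" "mdist d z (g' x) < e / 4"
          "g x \<in> mspace d" "g' x \<in> mspace d"
          by (auto simp: subset_iff)
        then have "mdist d (g x) (g' x) \<le> mdist d (g x) z + mdist d z (g' x)"
          using mdist_triangle[of "g x" d z "g' x"] by blast
        then show ?thesis using z(2,3) mdist_commute[of d "g x" z] by linarith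
      qed
      then have "mdist D g g' \<le> e / 2"
        unfolding D_def using e(1) by (intro mdist_cfunspace_le) auto
      then have "g' \<in> mball_of D g e"
        using g(2) g'H HD e(1) by auto
      then show ?thesis using e(2) by blast
    qed
    ultimately show ?thesis by blast
  qed
  have W_meas: "{\<omega> \<in> space \<Omega>. f \<omega> \<in> W L} \<in> sets \<Omega>" for L
  proof -
    have "{\<omega> \<in> space \<Omega>. f \<omega> \<in> W L} =
        {\<omega> \<in> space \<Omega>. \<forall>p \<in> set L. \<omega> \<in> {\<omega> \<in> space \<Omega>. f \<omega> ` cyl (fst p) \<subseteq> cyl (snd p)}}"
      using f unfolding W_def H_def by (auto simp: case_prod_beta')
    also have "\<dots> \<in> sets \<Omega>"
      using meas by (intro sets.sets_Collect_finite_All) auto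
    finally show ?thesis .
  qed
  show ?thesis
    unfolding chaotic_homeos_borel_def borel_of_def
  proof (rule measurable_measure_of)
    fix U assume "U \<in> {U. openin (subtopology (mtopology_of (cfunspace C d)) (chaotic_homeos C d)) U}"
    then obtain V where V: "openin (mtopology_of D) V" "U = V \<inter> H"
      by (auto simp: openin_subtopology D_def H_def)
    have "f -` U \<inter> space \<Omega> = (\<Union>L \<in> {L. W L \<subseteq> V}. {\<omega> \<in> space \<Omega>. f \<omega> \<in> W L})"
    proof (intro equalityI subsetI)
      fix \<omega> assume \<omega>: "\<omega> \<in> f -` U \<inter> space \<Omega>"
      then obtain L where "f \<omega> \<in> W L" "W L \<subseteq> V" using local[OF V(1), of "f \<omega>"] V(2) by blast
      then show "\<omega> \<in> (\<Union>L \<in> {L. W L \<subseteq> V}. {\<omega> \<in> space \<Omega>. f \<omega> \<in> W L})" using \<omega> by blast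
    next
      fix \<omega> assume "\<omega> \<in> (\<Union>L \<in> {L. W L \<subseteq> V}. {\<omega> \<in> space \<Omega>. f \<omega> \<in> W L})"
      then show "\<omega> \<in> f -` U \<inter> space \<Omega>" using V(2) f by (auto simp: H_def)
    qed
    then show "f -` U \<inter> space \<Omega> \<in> sets \<Omega>"
      using W_meas by (simp only:) (intro sets.countable_UN', auto)
  next
    show "{U. openin (subtopology (mtopology_of (cfunspace C d)) (chaotic_homeos C d)) U}
        \<subseteq> Pow (topspace (subtopology (mtopology_of (cfunspace C d)) (chaotic_homeos C d)))"
      using openin_subset by blast
    show "f \<in> space \<Omega> \<rightarrow> topspace (subtopology (mtopology_of (cfunspace C d)) (chaotic_homeos C d))"
      using f HD by (auto simp: H_def D_def)
  qed
qed

lemma measurable_split_index: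
  assumes "\<And>L. Measurable.pred \<Omega> (\<lambda>\<omega>. P \<omega> L)"
  shows "(\<lambda>\<omega>. split_index (P \<omega>) L) \<in> measurable \<Omega> (count_space UNIV)"
  unfolding split_index_def using assms by (intro measurable_Least pred_intros_logic)

text \<open>Lists of tests form a countable set, so the next split can be treated separately for
  each value of the previous node.\<close>

lemma measurable_node:
  assumes P: "\<And>L. Measurable.pred \<Omega> (\<lambda>\<omega>. P \<omega> L)"
  shows "(\<lambda>\<omega>. node (P \<omega>) s) \<in> measurable \<Omega> (count_space UNIV)"
proof (induction s)
  case (Cons v s)
  have "(\<lambda>\<omega>. (split_index (P \<omega>) L, v) # L) \<in> measurable \<Omega> (count_space UNIV)" for L
    using measurable_compose[OF measurable_split_index[OF P], of "\<lambda>k. (k, v) # L"] by simp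
  then show ?case
    using measurable_compose_countable[of "\<lambda>L \<omega>. (split_index (P \<omega>) L, v) # L", OF _ Cons] by simp
qed simp

definition shift_test :: "nat \<Rightarrow> nat" where
  "shift_test k = (case from_nat k of (j :: int, t :: nat list) \<Rightarrow> to_nat (j + 1, t))"

lemma shift_in_test_iff: "shift x \<in> test k \<longleftrightarrow> x \<in> test (shift_test k)"
  by (auto simp: test_def shift_test_def shift_def split: prod.splits)

text \<open>The inclusion fails exactly when a literal of \<open>L\<close> is violated after the
  shift, and such a violation is one more literal on \<open>x\<close> itself. So inclusions between
  cells reduce to the bits \<open>meets\<close>.\<close>

lemma shift_image_subset_iff:
  "(\<forall>x \<in> A \<inter> Sat test K. shift x \<in> Sat test L) \<longleftrightarrow>
     (\<forall>k v. (k, v) \<in> set L \<longrightarrow> \<not> meets A test ((shift_test k, \<not> v) # K))"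
proof -
  have "(\<exists>x \<in> A \<inter> Sat test K. shift x \<notin> Sat test L) \<longleftrightarrow>
      (\<exists>k v. (k, v) \<in> set L \<and> (\<exists>x \<in> A \<inter> Sat test K. (x \<in> test (shift_test k)) \<noteq> v))"
    unfolding Sat_def[of test L] by (auto simp: shift_in_test_iff)
  also have "\<dots> \<longleftrightarrow> (\<exists>k v. (k, v) \<in> set L \<and> meets A test ((shift_test k, \<not> v) # K))"
    unfolding meets_def by (auto simp: Sat_Cons set_eq_iff)
  finally show ?thesis by blast
qed

text \<open>The two codings of the Cantor space and of the shift space by binary sequences transport the
  shift to the Cantor space.\<close>

definition cantor_shift :: "'a topology \<Rightarrow> (nat \<Rightarrow> 'a set) \<Rightarrow> nat list set \<Rightarrow> 'a \<Rightarrow> 'a" where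
  "cantor_shift C b M = pull_back_system C
     (inv_into (sys M) (cantor_coding.code (sysT M) test) \<circ> cantor_coding.code C b) shift"

text \<open>The homeomorphism \<open>h\<close> matches codes, so the cylinder of \<open>s\<close> in
  \<open>C\<close> corresponds to the cell \<open>node s\<close> in the shift space. The last claim
  therefore expresses the action on cylinders inside the shift space, in the form handled by
  \<open>shift_image_subset_iff\<close>.\<close>

lemma cantor_shift:
  fixes C :: "'a topology" and d :: "'a metric"
  assumes C: "cantor_coding C b" and d: "mtopology_of d = C" and M: "code_tree M"
  shows "cantor_shift C b M \<in> chaotic_homeos C d"
    and "conjugate_systems C (cantor_shift C b M) (sysT M) shift"
    and "\<And>x. x \<in> topspace C \<Longrightarrow> cantor_shift C b M x \<in> topspace C"
    and "cantor_shift C b M ` cantor_coding.cyl C b v \<subseteq> cantor_coding.cyl C b u \<longleftrightarrow>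
      (\<forall>x \<in> sys M \<inter> Sat test (node (meets (sys M) test) v). shift x \<in> Sat test (node (meets (sys M) test) u))"
proof -
  interpret C: cantor_coding C b by fact
  have "[0] \<in> M" using M by (auto simp: code_tree_def)
  then interpret S: cantor_coding "sysT M" test by (rule cantor_coding_sys) simp
  define h where "h = inv_into (sys M) S.code \<circ> C.code"
  define T where "T = cantor_shift C b M"
  have Th: "T = pull_back_system C h shift" unfolding T_def h_def cantor_shift_def ..
  have "homeomorphic_map euclidean (sysT M) (inv_into (sys M) S.code)"
    using homeomorphic_maps_inv_into[OF S.homeomorphic_map_code] homeomorphic_maps_map by fastforce
  then have h: "homeomorphic_map C (sysT M) h"
    unfolding h_def using C.homeomorphic_map_code homeomorphic_map_compose by blast
  note pb = pull_back_system[OF h homeomorphic_map_shift, folded Th]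
  have code_h: "S.code (h x) = C.code x" for x
    unfolding h_def o_def using S.code_surj f_inv_into_f[of "C.code x" S.code "sys M"] by simp
  have hx: "h x \<in> sys M" if "x \<in> topspace C" for x
    using homeomorphic_imp_surjective_map[OF h] that by auto
  have TC: "conjugate_systems (sysT M) shift C T"
    using conjugate_systems_sym[OF pb(2) pb(3)] .
  have "chaotic C T"
    using chaotic_conjugate[OF TC _ chaotic_shift] shift_in_sys by simp
  moreover have "T \<in> mspace (cfunspace C d)"
    using pb(1,3) d homeomorphic_imp_continuous_map[OF pb(1)] C.compact
    unfolding compactin_mspace_cfunspace[of C d, OF C.compact[unfolded compact_space_def]]
    by (auto simp: Th pull_back_system_def)
  ultimately show "cantor_shift C b M \<in> chaotic_homeos C d"
    using pb(1) by (simp add: chaotic_homeos_def T_def)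
  show "conjugate_systems C (cantor_shift C b M) (sysT M) shift" using pb(2) by (simp add: T_def)
  show "cantor_shift C b M x \<in> topspace C" if "x \<in> topspace C" for x using pb(3) that by (simp add: T_def)
  have cyl_iff: "x \<in> C.cyl s \<longleftrightarrow> h x \<in> Sat test (node S.P s)" if "x \<in> topspace C" for x s
    unfolding C.in_cyl_iff S.in_node_iff code_h using that by auto
  have sur: "h ` topspace C = sys M" using homeomorphic_imp_surjective_map[OF h] by simp
  have "T ` C.cyl v \<subseteq> C.cyl u \<longleftrightarrow>
      (\<forall>x \<in> topspace C. h x \<in> Sat test (node S.P v) \<longrightarrow> shift (h x) \<in> Sat test (node S.P u))"
    using cyl_iff pb(3,4) C.cyl_subset by (smt (verit, best) image_subset_iff subset_iff)
  also have "\<dots> \<longleftrightarrow> (\<forall>x \<in> h ` topspace C \<inter> Sat test (node S.P v). shift x \<in> Sat test (node S.P u))"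
    by blast
  finally show "cantor_shift C b M ` C.cyl v \<subseteq> C.cyl u \<longleftrightarrow>
      (\<forall>x \<in> sys M \<inter> Sat test (node (meets (sys M) test) v). shift x \<in> Sat test (node (meets (sys M) test) u))"
    unfolding sur T_def by simp
qed

text \<open>The set \<open>M \<omega>\<close> enters through satisfiability only. These bits are
  measurable by \<open>meets_sys_iff\<close>, the nodes take values in a countable set, and the
  behaviour on cylinders is a countable combination of both.\<close>

lemma measurable_cantor_shift:
  fixes C :: "'a topology" and d :: "'a metric"
  assumes C: "cantor_coding C b" and d: "mtopology_of d = C"
    and M: "\<And>\<omega>. \<omega> \<in> space \<Omega> \<Longrightarrow> code_tree (M \<omega>)" and meas: "\<And>t. Measurable.pred \<Omega> (\<lambda>\<omega>. t \<in> M \<omega>)"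
  shows "(\<lambda>\<omega>. cantor_shift C b (M \<omega>)) \<in> measurable \<Omega> (chaotic_homeos_borel C d)"
proof (rule measurable_chaotic_homeosI[OF C d])
  show "cantor_shift C b (M \<omega>) \<in> chaotic_homeos C d" if "\<omega> \<in> space \<Omega>" for \<omega>
    using cantor_shift(1)[OF C d M[OF that]] .
  have P: "Measurable.pred \<Omega> (\<lambda>\<omega>. meets (sys (M \<omega>)) test L)" for L
  proof -
    have "Measurable.pred \<Omega> (\<lambda>\<omega>. \<exists>l. (\<forall>t. t \<in> set l \<longrightarrow> t \<in> M \<omega>) \<and> meets (sys (set l)) test L)"
      using meas by (intro pred_intros_countable pred_intros_logic) simp_all
    then show ?thesis unfolding meets_sys_iff[of "M _"] subset_iff .
  qed
  fix u v
  define good where "good K L \<omega> \<longleftrightarrow> (\<forall>k w. (k, w) \<in> set L \<longrightarrow> \<not> meets (sys (M \<omega>)) test ((shift_test k, \<not> w) # K))" for K L \<omega>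
  have "Measurable.pred \<Omega> (good K L)" for K L
    unfolding good_def[abs_def] using P by (intro pred_intros_countable pred_intros_logic) simp_all
  then have "Measurable.pred \<Omega> (\<lambda>\<omega>. good K (node (meets (sys (M \<omega>)) test) u) \<omega>)" for K
    by (intro measurable_compose_countable[where f = "good K" for K, OF _ measurable_node[OF P]])
  then have "Measurable.pred \<Omega> (\<lambda>\<omega>. good (node (meets (sys (M \<omega>)) test) v) (node (meets (sys (M \<omega>)) test) u) \<omega>)"
    by (intro measurable_compose_countable[where f = "\<lambda>K \<omega>. good K (node (meets (sys (M \<omega>)) test) u) \<omega>", OF _ measurable_node[OF P]])
  then have "{\<omega> \<in> space \<Omega>. good (node (meets (sys (M \<omega>)) test) v) (node (meets (sys (M \<omega>)) test) u) \<omega>} \<in> sets \<Omega>"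
    by (simp add: pred_def)
  also have "{\<omega> \<in> space \<Omega>. good (node (meets (sys (M \<omega>)) test) v) (node (meets (sys (M \<omega>)) test) u) \<omega>} =
      {\<omega> \<in> space \<Omega>. cantor_shift C b (M \<omega>) ` cantor_coding.cyl C b v \<subseteq> cantor_coding.cyl C b u}"
    using cantor_shift(4)[OF C d M] unfolding good_def shift_image_subset_iff by (intro Collect_cong conj_cong) auto
  finally show "{\<omega> \<in> space \<Omega>. cantor_shift C b (M \<omega>) ` cantor_coding.cyl C b v \<subseteq> cantor_coding.cyl C b u} \<in> sets \<Omega>" .
qed

lemma cantor_shift_conjugate_iff:
  fixes C :: "'a topology" and d :: "'a metric"
  assumes C: "cantor_coding C b" and d: "mtopology_of d = C" and M: "code_tree M" and N: "code_tree N"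
  shows "(cantor_shift C b M, cantor_shift C b N) \<in> chaotic_conjugacy C d \<longleftrightarrow> (\<exists>h. bij h \<and> N = map h ` M)"
proof -
  have "conjugate_systems C (cantor_shift C b M) C (cantor_shift C b N) \<longleftrightarrow>
      conjugate_systems (sysT M) shift (sysT N) shift"
    using cantor_shift(2,3)[OF C d M] cantor_shift(2,3)[OF C d N]
      conjugate_systems_trans conjugate_systems_sym by metis
  then show ?thesis
    using conjugate_sys_iff[OF M N] cantor_shift(1)[OF C d M] cantor_shift(1)[OF C d N]
    by (simp add: chaotic_conjugacy_def)
qed

section \<open>Category in the permutation group\<close>

definition meager_in :: "'p topology \<Rightarrow> 'p set \<Rightarrow> bool" where
  "meager_in X A \<longleftrightarrow> (\<exists>\<F>. countable \<F> \<and> (\<forall>T \<in> \<F>. closedin X T \<and> X interior_of T = {}) \<and> A \<subseteq> \<Union>\<F>)"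

lemma meager_in_subset: "meager_in X B \<Longrightarrow> A \<subseteq> B \<Longrightarrow> meager_in X A"
  unfolding meager_in_def by (meson subset_trans)

lemma meager_in_empty [simp]: "meager_in X {}"
  unfolding meager_in_def by (intro exI[of _ "{}"]) simp

lemma meager_in_nowhere_dense: "closedin X T \<Longrightarrow> X interior_of T = {} \<Longrightarrow> meager_in X T"
  unfolding meager_in_def by (intro exI[of _ "{T}"]) simp

lemma meager_in_UN:
  assumes "countable I" "\<And>i. i \<in> I \<Longrightarrow> meager_in X (A i)"
  shows "meager_in X (\<Union>i \<in> I. A i)"
proof -
  have "\<forall>i \<in> I. \<exists>\<F>. countable \<F> \<and> (\<forall>T \<in> \<F>. closedin X T \<and> X interior_of T = {}) \<and> A i \<subseteq> \<Union>\<F>"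
    using assms(2) by (simp add: meager_in_def)
  then obtain \<F> where F: "\<And>i. i \<in> I \<Longrightarrow> countable (\<F> i)"
    "\<And>i. i \<in> I \<Longrightarrow> \<forall>T \<in> \<F> i. closedin X T \<and> X interior_of T = {}" "\<And>i. i \<in> I \<Longrightarrow> A i \<subseteq> \<Union>(\<F> i)"
    by (metis (no_types, lifting))
  show ?thesis
    unfolding meager_in_def
  proof (intro exI[of _ "\<Union>i \<in> I. \<F> i"] conjI)
    show "countable (\<Union>i \<in> I. \<F> i)" using assms(1) F(1) by simp
    show "\<forall>T \<in> \<Union>i \<in> I. \<F> i. closedin X T \<and> X interior_of T = {}" using F(2) by blast
    show "(\<Union>i \<in> I. A i) \<subseteq> \<Union>(\<Union>i \<in> I. \<F> i)" using F(3) by (intro UN_least) blast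
  qed
qed

lemma meager_in_Un: "meager_in X A \<Longrightarrow> meager_in X B \<Longrightarrow> meager_in X (A \<union> B)"
  using meager_in_UN[of "{A, B}" X id] by auto

lemma not_meager_in_open:
  assumes "completely_metrizable_space X" "openin X U" "U \<noteq> {}"
  shows "\<not> meager_in X U"
proof
  assume "meager_in X U"
  then obtain \<F> where F: "countable \<F>" "\<And>T. T \<in> \<F> \<Longrightarrow> closedin X T \<and> X interior_of T = {}" "U \<subseteq> \<Union>\<F>"
    unfolding meager_in_def by auto
  have "X interior_of \<Union>\<F> = {}"
    using Baire_category_alt[of X \<F>] assms(1) F by blast
  then show False
    using interior_of_maximal[OF F(3) assms(2)] assms(3) by simp
qed

lemma meager_in_homeomorphic_image:
  assumes f: "homeomorphic_map X X f" and "meager_in X A"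
  shows "meager_in X (f ` A)"
proof -
  obtain \<F> where F: "countable \<F>" "\<And>T. T \<in> \<F> \<Longrightarrow> closedin X T \<and> X interior_of T = {}" "A \<subseteq> \<Union>\<F>"
    using assms(2) unfolding meager_in_def by auto
  show ?thesis
    unfolding meager_in_def
  proof (intro exI[of _ "(`) f ` \<F>"] conjI ballI)
    show "closedin X T" "X interior_of T = {}" if "T \<in> (`) f ` \<F>" for T
    proof -
      obtain S where S: "S \<in> \<F>" "T = f ` S" using \<open>T \<in> (`) f ` \<F>\<close> by (metis imageE)
      then have "S \<subseteq> topspace X" using F(2) closedin_subset by blast
      then show "closedin X T" "X interior_of T = {}"
        using S F(2)[OF S(1)] homeomorphic_map_closedness[OF f] homeomorphic_map_interior_of[OF f] by auto
    qed
    show "countable ((`) f ` \<F>)" using F(1) by simp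
    show "f ` A \<subseteq> \<Union>((`) f ` \<F>)" using image_mono[OF F(3), of f] by (simp add: image_Union)
  qed
qed

section \<open>The permutation group as a completely metrizable space\<close>

lemma carrier_S_infty: "carrier S_infty = {g. bij g}"
  by (auto simp: S_infty_def BijGroup_def Bij_def extensional_def)

lemma mult_S_infty: "bij g \<Longrightarrow> bij h \<Longrightarrow> g \<otimes>\<^bsub>S_infty\<^esub> h = g \<circ> h"
  by (auto simp: S_infty_def BijGroup_def Bij_def extensional_def compose_def)

lemma topspace_S_infty [simp]: "topspace S_infty_topology = {g. bij g}"
  by (simp add: S_infty_topology_def carrier_S_infty)

lemma open_nat_coordinate: "open {g :: nat \<Rightarrow> nat. P (g i)}"
proof -
  have "open ((\<lambda>g :: nat \<Rightarrow> nat. g i) -` {k. P k})"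
    by (rule open_vimage) (auto intro: open_discrete)
  then show ?thesis by (simp add: vimage_def)
qed

text \<open>The permutations are a countable intersection of open sets of functions:
  \<open>U p\<close> expresses injectivity for one pair of arguments, \<open>W n\<close> that
  \<open>n\<close> is a value.\<close>

lemma completely_metrizable_S_infty: "completely_metrizable_space S_infty_topology"
proof -
  have "(euclidean :: nat topology) = discrete_topology UNIV"
    unfolding topology_eq by (simp add: open_discrete)
  then have "completely_metrizable_space (euclidean :: nat topology)"
    by (simp add: completely_metrizable_space_discrete_topology)
  then have cm: "completely_metrizable_space (euclidean :: (nat \<Rightarrow> nat) topology)"
    unfolding euclidean_product_topology[symmetric] completely_metrizable_space_product_topology by simp
  define U where "U p = {g :: nat \<Rightarrow> nat. g (fst p) = g (snd p) \<longrightarrow> fst p = snd p}" for p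
  define W where "W n = {g :: nat \<Rightarrow> nat. \<exists>m. g m = n}" for n
  have eq: "{g :: nat \<Rightarrow> nat. bij g} = \<Inter>(range U \<union> range W)"
  proof (intro equalityI subsetI)
    fix g assume "g \<in> {g :: nat \<Rightarrow> nat. bij g}"
    then have "inj g" "\<And>n. \<exists>m. g m = n" by (simp_all add: bij_def surj_def) metis
    then show "g \<in> \<Inter>(range U \<union> range W)"
      by (auto simp: U_def W_def dest: injD)
  next
    fix g assume g: "g \<in> \<Inter>(range U \<union> range W)"
    have "inj g"
    proof (rule injI)
      show "x = y" if "g x = g y" for x y
      proof -
        have "g \<in> U (x, y)" using g by blast
        then show ?thesis using that by (simp add: U_def)
      qed
    qed
    moreover have "\<exists>m. g m = n" for n
    proof -
      have "g \<in> W n" using g by blast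
      then show ?thesis by (simp add: W_def)
    qed
    then have "surj g" by (metis surj_def)
    ultimately show "g \<in> {g. bij g}" by (simp add: bij_def)
  qed
  have "open (U p)" for p
  proof -
    have "U p = (if fst p = snd p then UNIV else (\<Union>k. {g. g (fst p) = k} \<inter> {g. g (snd p) \<noteq> k}))"
      by (auto simp: U_def)
    then show ?thesis using open_nat_coordinate by (auto intro!: open_UN open_Int)
  qed
  moreover have "open (W n)" for n
    unfolding W_def using open_nat_coordinate by (intro open_Collect_ex)
  ultimately have "gdelta_in euclidean {g :: nat \<Rightarrow> nat. bij g}"
    unfolding eq by (intro gdelta_in_Inter) (auto intro: open_imp_gdelta_in)
  then show ?thesis
    unfolding S_infty_topology_def carrier_S_infty
    using completely_metrizable_space_gdelta_in[OF cm] by simp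
qed

lemma openin_S_inftyI: "open V \<Longrightarrow> openin S_infty_topology ({g. bij g} \<inter> V)"
  unfolding S_infty_topology_def carrier_S_infty by (rule openin_open_Int)

text \<open>Basic open sets prescribe the inverse on an initial segment: \<open>s\<close> lists the
  preimages of 0, 1 and so on. With this choice right translation by a permutation \<open>h\<close>
  carries \<open>inv_nbhd (map h s)\<close> to \<open>inv_nbhd s\<close>, so translations act on
  neighbourhoods by relabelling words.\<close>

definition inv_nbhd :: "nat list \<Rightarrow> (nat \<Rightarrow> nat) set" where
  "inv_nbhd s = {g. bij g \<and> (\<forall>i<length s. g (s ! i) = i)}"

lemma openin_inv_nbhd: "openin S_infty_topology (inv_nbhd s)"
proof -
  have eq: "inv_nbhd s = {g. bij g} \<inter> (\<Inter>i \<in> {..<length s}. {g. g (s ! i) = i})"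
    by (auto simp: inv_nbhd_def)
  have op: "open (\<Inter>i \<in> {..<length s}. {g :: nat \<Rightarrow> nat. g (s ! i) = i})"
    using open_nat_coordinate by (intro open_INT) auto
  show ?thesis unfolding eq by (rule openin_S_inftyI[OF op])
qed

lemma closedin_inv_nbhd: "closedin S_infty_topology (inv_nbhd s)"
proof -
  have eq: "{g. bij g} - inv_nbhd s = {g. bij g} \<inter> (\<Union>i \<in> {..<length s}. {g. g (s ! i) \<noteq> i})"
    by (auto simp: inv_nbhd_def)
  have op: "open (\<Union>i \<in> {..<length s}. {g :: nat \<Rightarrow> nat. g (s ! i) \<noteq> i})"
    using open_nat_coordinate by (intro open_UN) auto
  have "openin S_infty_topology ({g. bij g} - inv_nbhd s)"
    unfolding eq by (rule openin_S_inftyI[OF op])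
  then show ?thesis
    unfolding closedin_def by (auto simp: inv_nbhd_def)
qed

text \<open>The parameter \<open>m\<close> allows the word to be as long as desired, since
  prescribing further values only shrinks the neighbourhood.\<close>

lemma inv_nbhd_basis:
  assumes "openin S_infty_topology U" "g \<in> U"
  shows "\<exists>s. m \<le> length s \<and> g \<in> inv_nbhd s \<and> inv_nbhd s \<subseteq> U"
proof -
  obtain V where V: "open V" "U = {g. bij g} \<inter> V"
    using assms(1) unfolding S_infty_topology_def carrier_S_infty by (auto simp: openin_open)
  have g: "bij g" "g \<in> V" using assms(2) V by auto
  have "openin (product_topology (\<lambda>i. euclidean) UNIV) V"
    using V(1) by (simp add: euclidean_product_topology)
  then obtain W where W: "finite {i. W i \<noteq> UNIV}" "g \<in> Pi\<^sub>E UNIV W" "Pi\<^sub>E UNIV W \<subseteq> V"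
    using g(2) unfolding openin_product_topology_alt by fastforce
  have "finite (g ` {i. W i \<noteq> UNIV})" using W(1) by simp
  then obtain N where N: "\<And>i. W i \<noteq> UNIV \<Longrightarrow> g i < N"
    unfolding finite_nat_set_iff_bounded by (metis (mono_tags, lifting) imageI mem_Collect_eq)
  \<comment> \<open>Listing the preimages of all numbers below \<open>N\<close> fixes in particular
    the values at the finitely many arguments constrained by \<open>W\<close>.\<close>
  define s where "s = map (inv_into UNIV g) [0..<N + m]"
  have gi: "g (inv_into UNIV g i) = i" "inv_into UNIV g (g i) = i" for i
    using g(1) by (simp_all add: bij_is_surj surj_f_inv_f bij_is_inj)
  have "g \<in> inv_nbhd s" using g(1) gi by (simp add: inv_nbhd_def s_def)
  moreover have "g' \<in> U" if g': "g' \<in> inv_nbhd s" for g'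
  proof -
    have "g' i \<in> W i" for i
    proof (cases "W i = UNIV")
      case False
      have "g' (s ! g i) = g i" using g' N[OF False] by (auto simp: inv_nbhd_def s_def)
      moreover have "s ! g i = i" using N[OF False] gi by (simp add: s_def)
      ultimately show ?thesis using W(2) by auto
    qed simp
    then have "g' \<in> V" using W(3) by auto
    then show ?thesis using V(2) g' by (auto simp: inv_nbhd_def)
  qed
  moreover have "m \<le> length s" by (simp add: s_def)
  ultimately show ?thesis by blast
qed

lemma inv_nbhd_distinct: "g \<in> inv_nbhd s \<Longrightarrow> distinct s"
proof -
  assume g: "g \<in> inv_nbhd s"
  have "i = j" if "i < length s" "j < length s" "s ! i = s ! j" for i j
    using g that by (auto simp: inv_nbhd_def) metis
  then show "distinct s" unfolding distinct_conv_nth by blast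
qed

abbreviation meager :: "(nat \<Rightarrow> nat) set \<Rightarrow> bool" where
  "meager \<equiv> meager_in S_infty_topology"

lemma not_meager_inv_nbhd: "inv_nbhd s \<noteq> {} \<Longrightarrow> \<not> meager (inv_nbhd s)"
  by (rule not_meager_in_open[OF completely_metrizable_S_infty openin_inv_nbhd])

text \<open>The form in which the Baire property is used: a set that is nonmeager in a basic open set is
  comeager in a smaller one.\<close>

definition localizable :: "(nat \<Rightarrow> nat) set \<Rightarrow> bool" where
  "localizable A \<longleftrightarrow> A \<subseteq> {g. bij g} \<and> (\<forall>s. \<not> meager (A \<inter> inv_nbhd s) \<longrightarrow>
     (\<exists>s'. inv_nbhd s' \<noteq> {} \<and> inv_nbhd s' \<subseteq> inv_nbhd s \<and> meager (inv_nbhd s' - A)))"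

text \<open>If the right side held without the left, \<open>inv_nbhd s'\<close> would be meager,
  against the Baire category theorem. If \<open>A\<close> is nonmeager in every smaller
  neighbourhood, localizability makes the neighbourhoods in which \<open>A\<close> is comeager dense
  in \<open>inv_nbhd s\<close>, so the complement of \<open>A\<close> is meager there. The
  equivalence turns a negated category quantifier into a countable union.\<close>

lemma localizable_complement_iff:
  assumes A: "localizable A"
  shows "\<not> meager (({g. bij g} - A) \<inter> inv_nbhd s) \<longleftrightarrow>
    (\<exists>s'. inv_nbhd s' \<noteq> {} \<and> inv_nbhd s' \<subseteq> inv_nbhd s \<and> meager (A \<inter> inv_nbhd s'))" (is "?L \<longleftrightarrow> ?R")
proof
  assume ?R
  then obtain s' where s': "inv_nbhd s' \<noteq> {}" "inv_nbhd s' \<subseteq> inv_nbhd s" "meager (A \<inter> inv_nbhd s')" by blast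
  show ?L
  proof
    assume "meager (({g. bij g} - A) \<inter> inv_nbhd s)"
    then have "meager ((({g. bij g} - A) \<inter> inv_nbhd s) \<union> (A \<inter> inv_nbhd s'))"
      using s'(3) by (rule meager_in_Un)
    then have "meager (inv_nbhd s')"
      by (rule meager_in_subset) (use s'(2) in \<open>auto simp: inv_nbhd_def\<close>)
    then show False using not_meager_inv_nbhd s'(1) by blast
  qed
next
  assume L: ?L
  show ?R
  proof (rule ccontr)
    assume neg: "\<not> ?R"
    define S where "S = {s'. inv_nbhd s' \<subseteq> inv_nbhd s \<and> meager (inv_nbhd s' - A)}"
    define U where "U = (\<Union>s' \<in> S. inv_nbhd s')"
    have "meager (\<Union>s' \<in> S. inv_nbhd s' - A)"
      by (rule meager_in_UN) (auto simp: S_def)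
    \<comment> \<open>\<open>U\<close> is dense in \<open>inv_nbhd s\<close>: a basic neighbourhood
      missing \<open>U\<close> would contain a nonempty neighbourhood whose word belongs to
      \<open>S\<close>.\<close>
    moreover have "meager (inv_nbhd s - U)"
    proof (rule meager_in_nowhere_dense)
      have "openin S_infty_topology U"
        unfolding U_def using openin_inv_nbhd by auto
      then show cl: "closedin S_infty_topology (inv_nbhd s - U)"
        using closedin_inv_nbhd by (intro closedin_diff)
      show "S_infty_topology interior_of (inv_nbhd s - U) = {}"
      proof (rule ccontr)
        assume "S_infty_topology interior_of (inv_nbhd s - U) \<noteq> {}"
        then obtain g where g: "g \<in> S_infty_topology interior_of (inv_nbhd s - U)" by blast
        obtain s' where s': "g \<in> inv_nbhd s'" "inv_nbhd s' \<subseteq> S_infty_topology interior_of (inv_nbhd s - U)"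
          using inv_nbhd_basis[OF openin_interior_of g, of 0] by blast
        have sub: "inv_nbhd s' \<subseteq> inv_nbhd s - U"
          using s'(2) interior_of_subset by (rule subset_trans)
        then have "\<not> meager (A \<inter> inv_nbhd s')" using neg s'(1) by blast
        then obtain s'' where s'': "inv_nbhd s'' \<noteq> {}" "inv_nbhd s'' \<subseteq> inv_nbhd s'" "meager (inv_nbhd s'' - A)"
          using A unfolding localizable_def by blast
        then have "s'' \<in> S" using sub by (auto simp: S_def)
        then have "inv_nbhd s'' \<subseteq> U" by (auto simp: U_def)
        then show False using s''(1,2) sub by blast
      qed
    qed
    ultimately have "meager ((\<Union>s' \<in> S. inv_nbhd s' - A) \<union> (inv_nbhd s - U))"
      by (rule meager_in_Un)
    then have "meager (({g. bij g} - A) \<inter> inv_nbhd s)"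
      by (rule meager_in_subset) (auto simp: U_def)
    then show False using L by blast
  qed
qed

lemma localizable_complement:
  assumes A: "localizable A"
  shows "localizable ({g. bij g} - A)"
  unfolding localizable_def
proof (intro conjI allI impI)
  fix s assume "\<not> meager (({g. bij g} - A) \<inter> inv_nbhd s)"
  then obtain s' where s': "inv_nbhd s' \<noteq> {}" "inv_nbhd s' \<subseteq> inv_nbhd s" "meager (A \<inter> inv_nbhd s')"
    using localizable_complement_iff[OF A] by blast
  moreover have "inv_nbhd s' - ({g. bij g} - A) = A \<inter> inv_nbhd s'"
    by (auto simp: inv_nbhd_def)
  ultimately show "\<exists>s'. inv_nbhd s' \<noteq> {} \<and> inv_nbhd s' \<subseteq> inv_nbhd s \<and> meager (inv_nbhd s' - ({g. bij g} - A))"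
    by metis
qed auto

lemma not_meager_UN_iff:
  fixes A :: "nat \<Rightarrow> (nat \<Rightarrow> nat) set"
  shows "\<not> meager ((\<Union>n. A n) \<inter> B) \<longleftrightarrow> (\<exists>n. \<not> meager (A n \<inter> B))"
proof
  assume L: "\<not> meager ((\<Union>n. A n) \<inter> B)"
  show "\<exists>n. \<not> meager (A n \<inter> B)"
  proof (rule ccontr)
    assume "\<not> ?thesis"
    then have "meager (\<Union>n. A n \<inter> B)" by (intro meager_in_UN) auto
    then show False using L by simp
  qed
next
  assume "\<exists>n. \<not> meager (A n \<inter> B)"
  then obtain n where n: "\<not> meager (A n \<inter> B)" ..
  show "\<not> meager ((\<Union>n. A n) \<inter> B)"
  proof
    assume "meager ((\<Union>n. A n) \<inter> B)"
    then have "meager (A n \<inter> B)" by (rule meager_in_subset) auto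
    then show False using n by simp
  qed
qed

lemma localizable_UN:
  fixes A :: "nat \<Rightarrow> (nat \<Rightarrow> nat) set"
  assumes A: "\<And>n. localizable (A n)"
  shows "localizable (\<Union>n. A n)"
  unfolding localizable_def
proof (intro conjI allI impI)
  show "(\<Union>n. A n) \<subseteq> {g. bij g}" using A by (auto simp: localizable_def)
  fix s assume "\<not> meager ((\<Union>n. A n) \<inter> inv_nbhd s)"
  then obtain n where "\<not> meager (A n \<inter> inv_nbhd s)" using not_meager_UN_iff by blast
  then obtain s' where s': "inv_nbhd s' \<noteq> {}" "inv_nbhd s' \<subseteq> inv_nbhd s" "meager (inv_nbhd s' - A n)"
    using A[of n] unfolding localizable_def by blast
  have "meager (inv_nbhd s' - (\<Union>n. A n))" by (rule meager_in_subset[OF s'(3)]) auto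
  then show "\<exists>s'. inv_nbhd s' \<noteq> {} \<and> inv_nbhd s' \<subseteq> inv_nbhd s \<and> meager (inv_nbhd s' - (\<Union>n. A n))"
    using s' by blast
qed

lemma localizable_inv_nbhd: "localizable (inv_nbhd t)"
  unfolding localizable_def
proof (intro conjI allI impI)
  fix s assume "\<not> meager (inv_nbhd t \<inter> inv_nbhd s)"
  then have "inv_nbhd t \<inter> inv_nbhd s \<noteq> {}" using meager_in_empty by metis
  then obtain g where g: "g \<in> inv_nbhd t \<inter> inv_nbhd s" by blast
  have "openin S_infty_topology (inv_nbhd t \<inter> inv_nbhd s)" using openin_inv_nbhd by blast
  then obtain s' where s': "g \<in> inv_nbhd s'" "inv_nbhd s' \<subseteq> inv_nbhd t \<inter> inv_nbhd s"
    using inv_nbhd_basis[of _ g 0] g by blast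
  then have e: "inv_nbhd s' - inv_nbhd t = {}" by blast
  have "meager (inv_nbhd s' - inv_nbhd t)" unfolding e by (rule meager_in_empty)
  then show "\<exists>s'. inv_nbhd s' \<noteq> {} \<and> inv_nbhd s' \<subseteq> inv_nbhd s \<and> meager (inv_nbhd s' - inv_nbhd t)"
    using s' by blast
qed (auto simp: inv_nbhd_def)

lemma localizable_empty: "localizable {}"
  unfolding localizable_def by simp

lemma localizable_diff:
  assumes "localizable A" "localizable B"
  shows "localizable (A - B)"
proof -
  have "localizable (\<Union>n :: nat. if n = 0 then {g. bij g} - A else B)"
    using assms localizable_complement by (intro localizable_UN) simp
  moreover have "(\<Union>n :: nat. if n = 0 then {g. bij g} - A else B) = ({g. bij g} - A) \<union> B"
    by (auto split: if_splits)
  ultimately have "localizable ({g. bij g} - (({g. bij g} - A) \<union> B))"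
    using localizable_complement by simp
  moreover have "{g. bij g} - (({g. bij g} - A) \<union> B) = A - B"
    using assms(1) by (auto simp: localizable_def)
  ultimately show ?thesis by simp
qed

section \<open>From Borel actions to sets of words\<close>

lemma Polish_space_countable_base:
  assumes "Polish_space X"
  obtains A :: "nat \<Rightarrow> 'p set" where "\<And>n. openin X (A n)"
    "\<And>U x. openin X U \<Longrightarrow> x \<in> U \<Longrightarrow> \<exists>n. x \<in> A n \<and> A n \<subseteq> U"
proof -
  obtain M d where "Metric_space M d" and X: "X = Metric_space.mtopology M d"
    using assms unfolding Polish_space_def completely_metrizable_space_def by blast
  interpret Metric_space M d by fact
  obtain D where D: "countable D" "D \<subseteq> M" "mtopology closure_of D = M"
    using assms unfolding Polish_space_def separable_space_def X by auto
  \<comment> \<open>The empty set keeps the family nonempty even for an empty space, so that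
    \<open>from_nat_into\<close> enumerates exactly this family.\<close>
  define \<B> where "\<B> = insert {} ((\<lambda>(c, k). mball c (1 / real (Suc k))) ` (D \<times> UNIV))"
  have "countable \<B>" unfolding \<B>_def using D(1) by simp
  then have r: "range (from_nat_into \<B>) = \<B>" by (simp add: range_from_nat_into \<B>_def)
  have op: "openin X B" if "B \<in> \<B>" for B
    using that unfolding \<B>_def X by auto
  have base: "\<exists>B \<in> \<B>. x \<in> B \<and> B \<subseteq> U" if U: "openin X U" "x \<in> U" for U x
  proof -
    obtain e where e: "e > 0" "mball x e \<subseteq> U" and xM: "x \<in> M"
      using U unfolding X openin_mtopology by blast
    obtain k where k: "1 / real (Suc k) < e / 2"
      using nat_approx_posE[of "e / 2"] e(1) by (meson half_gt_zero)
    have "\<forall>r>0. \<exists>y \<in> D. y \<in> mball x r" using D(3) xM unfolding metric_closure_of by blast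
    then obtain c where c: "c \<in> D" "c \<in> mball x (1 / real (Suc k))"
      by (metis of_nat_0_less_iff zero_less_Suc zero_less_divide_1_iff)
    then have cM: "c \<in> M" "d x c < 1 / real (Suc k)" "d c x < 1 / real (Suc k)" by (auto simp: commute)
    have "mball c (1 / real (Suc k)) \<subseteq> mball x e"
    proof
      fix y assume "y \<in> mball c (1 / real (Suc k))"
      then have "y \<in> M" "d c y < 1 / real (Suc k)" by auto
      then show "y \<in> mball x e" using triangle[OF xM cM(1), of y] cM xM k by simp
    qed
    then have "mball c (1 / real (Suc k)) \<subseteq> U" using e(2) by blast
    moreover have "x \<in> mball c (1 / real (Suc k))" using cM xM by simp
    moreover have "mball c (1 / real (Suc k)) \<in> \<B>" using c(1) unfolding \<B>_def by auto
    ultimately show ?thesis by blast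
  qed
  show ?thesis
  proof (rule that[of "from_nat_into \<B>"])
    show "openin X (from_nat_into \<B> n)" for n using op r by blast
    show "\<exists>n. x \<in> from_nat_into \<B> n \<and> from_nat_into \<B> n \<subseteq> U" if "openin X U" "x \<in> U" for U x
      using base[OF that] r by (metis imageE)
  qed
qed

definition fiber :: "(nat \<Rightarrow> nat) set \<Rightarrow> ((nat \<Rightarrow> nat) \<times> 'p) set \<Rightarrow> 'p \<Rightarrow> (nat \<Rightarrow> nat) set" where
  "fiber G B x = {g \<in> G. (g, x) \<in> B}"

text \<open>The theorem of Montgomery and Novikov, proved together with the Baire property of the
  sections, which the complement step needs.\<close>

lemma category_quantifier:
  fixes X :: "'p topology"
  assumes X: "Polish_space X"
    and B: "B \<in> sets (borel_of (prod_topology S_infty_topology X))"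
  shows "(\<forall>x \<in> topspace X. localizable (fiber {g. bij g} B x)) \<and>
    (\<forall>s. {x \<in> topspace X. \<not> meager (fiber {g. bij g} B x \<inter> inv_nbhd s)} \<in> sets (borel_of X))"
proof -
  let ?T = "topspace (prod_topology S_infty_topology X)"
  let ?F = "fiber {g. bij g}"
  let ?Q = "\<lambda>B. (\<forall>x \<in> topspace X. localizable (?F B x)) \<and>
    (\<forall>s. {x \<in> topspace X. \<not> meager (?F B x \<inter> inv_nbhd s)} \<in> sets (borel_of X))"
  have Q_UN: "?Q (\<Union>n. A n)" if A: "\<And>n. ?Q (A n)" for A :: "nat \<Rightarrow> ((nat \<Rightarrow> nat) \<times> 'p) set"
  proof -
    have F: "?F (\<Union>n. A n) x = (\<Union>n. ?F (A n) x)" for x by (auto simp: fiber_def)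
    have "{x \<in> topspace X. \<not> meager ((\<Union>n. ?F (A n) x) \<inter> inv_nbhd s)} =
        (\<Union>n. {x \<in> topspace X. \<not> meager (?F (A n) x \<inter> inv_nbhd s)})" for s
      unfolding not_meager_UN_iff by blast
    moreover have "(\<Union>n. {x \<in> topspace X. \<not> meager (?F (A n) x \<inter> inv_nbhd s)}) \<in> sets (borel_of X)" for s
      using A by (intro sets.countable_UN) blast
    moreover have "localizable (\<Union>n. ?F (A n) x)" if "x \<in> topspace X" for x
      using A that by (intro localizable_UN) blast
    ultimately show ?thesis unfolding F by simp
  qed
  have Q_empty: "?Q {}"
    using localizable_empty by (simp add: fiber_def)
  \<comment> \<open>The fibres of a rectangle are a fixed basic open set or empty, and an open set
    is nonmeager exactly when it is nonempty.\<close>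
  have Q_rect: "?Q (inv_nbhd t \<times> U)" if U: "openin X U" for t U
  proof -
    have F: "?F (inv_nbhd t \<times> U) x = (if x \<in> U then inv_nbhd t else {})" for x
      by (auto simp: fiber_def inv_nbhd_def)
    have ne: "\<not> meager (inv_nbhd t \<inter> inv_nbhd s) \<longleftrightarrow> inv_nbhd t \<inter> inv_nbhd s \<noteq> {}" for s
    proof
      assume "inv_nbhd t \<inter> inv_nbhd s \<noteq> {}"
      moreover have "openin S_infty_topology (inv_nbhd t \<inter> inv_nbhd s)"
        using openin_inv_nbhd by (rule openin_Int) (rule openin_inv_nbhd)
      ultimately show "\<not> meager (inv_nbhd t \<inter> inv_nbhd s)"
        using not_meager_in_open[OF completely_metrizable_S_infty] by blast
    qed (use meager_in_empty in metis)
    have "{x \<in> topspace X. \<not> meager (?F (inv_nbhd t \<times> U) x \<inter> inv_nbhd s)} =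
        (if inv_nbhd t \<inter> inv_nbhd s \<noteq> {} then U else {})" for s
      using openin_subset[OF U] ne[of s] unfolding F by auto
    moreover have "U \<in> sets (borel_of X)"
      using U by (simp add: sets_borel_of sigma_sets.Basic)
    ultimately show ?thesis
      unfolding F using localizable_inv_nbhd localizable_empty by simp
  qed
  obtain A :: "nat \<Rightarrow> 'p set" where A: "\<And>n. openin X (A n)" "\<And>U x. openin X U \<Longrightarrow> x \<in> U \<Longrightarrow> \<exists>n. x \<in> A n \<and> A n \<subseteq> U"
    using Polish_space_countable_base[OF X] by blast
  have "B \<in> sigma_sets (?T) {U. openin (prod_topology S_infty_topology X) U}"
    using B by (simp add: sets_borel_of)
  then show ?thesis
  proof (induction B rule: sigma_sets.induct)
    case (Basic W)
    then have W: "openin (prod_topology S_infty_topology X) W" by simp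
    \<comment> \<open>An open set is a countable union of basic rectangles; indices whose rectangle
      does not fit contribute the empty set.\<close>
    define R where "R k = (case from_nat k of (s :: nat list, n :: nat) \<Rightarrow>
        if inv_nbhd s \<times> A n \<subseteq> W then inv_nbhd s \<times> A n else {})" for k
    have "W = (\<Union>k. R k)"
    proof (intro equalityI subsetI)
      fix p assume p: "p \<in> W"
      obtain g x where gx: "p = (g, x)" by (cases p)
      have "\<exists>U V. openin S_infty_topology U \<and> openin X V \<and> g \<in> U \<and> x \<in> V \<and> U \<times> V \<subseteq> W"
        using W p unfolding gx openin_prod_topology_alt by simp
      then obtain U V where UV: "openin S_infty_topology U" "openin X V" "g \<in> U" "x \<in> V" "U \<times> V \<subseteq> W"
        by (elim exE conjE) (rule that)
      obtain s where s: "g \<in> inv_nbhd s" "inv_nbhd s \<subseteq> U" using inv_nbhd_basis[OF UV(1,3), of 0] by auto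
      obtain n where n: "x \<in> A n" "A n \<subseteq> V" using A(2)[OF UV(2,4)] by auto
      have "inv_nbhd s \<times> A n \<subseteq> W" using s n UV(5) by blast
      then have "R (to_nat (s, n)) = inv_nbhd s \<times> A n" by (simp add: R_def)
      then have "p \<in> R (to_nat (s, n))" using s n gx by simp
      then show "p \<in> (\<Union>k. R k)" by blast
    next
      fix p assume "p \<in> (\<Union>k. R k)"
      then obtain k where "p \<in> R k" by blast
      then show "p \<in> W"
        by (cases "from_nat k :: nat list \<times> nat") (auto simp: R_def split: if_splits)
    qed
    moreover have "?Q (R k)" for k
      using Q_rect[OF A(1)] Q_empty by (cases "from_nat k :: nat list \<times> nat") (simp add: R_def)
    ultimately show ?case using Q_UN[of R] by simp
  next
    case Empty
    then show ?case using Q_empty .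
  next
    case (Compl B)
    have F: "?F (?T - B) x = {g. bij g} - ?F B x" if "x \<in> topspace X" for x
      using that by (auto simp: fiber_def)
    \<comment> \<open>Here the Baire property of the fibres enters, through
      \<open>localizable_complement_iff\<close>.\<close>
    have "{x \<in> topspace X. \<not> meager (?F (?T - B) x \<inter> inv_nbhd s)} =
        (\<Union>s' \<in> {s'. inv_nbhd s' \<noteq> {} \<and> inv_nbhd s' \<subseteq> inv_nbhd s}.
          topspace X - {x \<in> topspace X. \<not> meager (?F B x \<inter> inv_nbhd s')})" for s
    proof -
      have "\<not> meager (?F (?T - B) x \<inter> inv_nbhd s) \<longleftrightarrow>
          (\<exists>s'. inv_nbhd s' \<noteq> {} \<and> inv_nbhd s' \<subseteq> inv_nbhd s \<and> meager (?F B x \<inter> inv_nbhd s'))"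
        if "x \<in> topspace X" for x
        unfolding F[OF that] using localizable_complement_iff Compl.IH that by blast
      then show ?thesis by auto
    qed
    moreover have "(\<Union>s' \<in> {s'. inv_nbhd s' \<noteq> {} \<and> inv_nbhd s' \<subseteq> inv_nbhd s}.
          topspace X - {x \<in> topspace X. \<not> meager (?F B x \<inter> inv_nbhd s')}) \<in> sets (borel_of X)" for s
    proof (rule sets.countable_UN'')
      show "topspace X - {x \<in> topspace X. \<not> meager (?F B x \<inter> inv_nbhd s')} \<in> sets (borel_of X)" for s'
        using Compl.IH sets.compl_sets[of _ "borel_of X"] by simp
    qed auto
    moreover have "localizable ({g. bij g} - ?F B x)" if "x \<in> topspace X" for x
      using localizable_complement Compl.IH that by blast
    ultimately show ?case using F by simp
  next
    case (Union A)
    then show ?case using Q_UN[of A] by simp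
  qed
qed

text \<open>The tree of \<open>x\<close> lists, for every basic open set \<open>A n\<close> and every finite injective \<open>s\<close>, whether
  \<open>g x \<in> A n\<close> for nonmeagerly many \<open>g\<close> whose inverse extends \<open>s\<close>. The length of the initial block
  of the word encodes \<open>n\<close>.\<close>

definition visits :: "('p \<Rightarrow> bool) \<Rightarrow> ((nat \<Rightarrow> nat) \<Rightarrow> 'p) \<Rightarrow> nat list \<Rightarrow> bool" where
  "visits A orb s \<longleftrightarrow> \<not> meager ({g. bij g \<and> A (orb g)} \<inter> inv_nbhd s)"

definition orbit_tree :: "(nat \<Rightarrow> 'p set) \<Rightarrow> ((nat \<Rightarrow> nat) \<Rightarrow> 'p) \<Rightarrow> nat list set" where
  "orbit_tree A orb = {replicate k v | k v. k \<ge> 1} \<union>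
     {replicate (n + 2) v @ s | n v s. s \<noteq> [] \<and> distinct (v # s) \<and> visits (\<lambda>y. y \<in> A n) orb (v # s)}"

text \<open>A longer word prescribes more of the inverse and so has a smaller neighbourhood. This
  makes the tree closed under prefixes.\<close>

lemma visits_prefix: "visits A orb (s @ t) \<Longrightarrow> visits A orb s"
proof -
  have "inv_nbhd (s @ t) \<subseteq> inv_nbhd s"
  proof
    fix g assume g: "g \<in> inv_nbhd (s @ t)"
    have "g (s ! i) = i" if "i < length s" for i
      using g that unfolding inv_nbhd_def by (auto simp: nth_append dest: spec[of _ i])
    then show "g \<in> inv_nbhd s" using g by (auto simp: inv_nbhd_def)
  qed
  then have sub: "{g. bij g \<and> A (orb g)} \<inter> inv_nbhd (s @ t) \<subseteq> {g. bij g \<and> A (orb g)} \<inter> inv_nbhd s" by blast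
  show "visits A orb (s @ t) \<Longrightarrow> visits A orb s"
    unfolding visits_def by (erule contrapos_nn) (erule meager_in_subset[OF _ sub])
qed

lemma orbit_tree_cases:
  assumes "t \<in> orbit_tree A orb"
  obtains k v where "k \<ge> 1" "t = replicate k v"
  | n v s where "t = replicate (n + 2) v @ s" "s \<noteq> []" "distinct (v # s)" "visits (\<lambda>y. y \<in> A n) orb (v # s)"
  using assms unfolding orbit_tree_def by blast

lemma replicate_in_orbit_tree: "k \<ge> 1 \<Longrightarrow> replicate k v \<in> orbit_tree A orb"
  unfolding orbit_tree_def by blast

text \<open>The letters of \<open>s\<close> differ from \<open>v\<close>, so the first of them marks
  the end of the block and \<open>n\<close> can be read off from its length.\<close>

lemma replicate_block_eq_iff:
  assumes "s \<noteq> []" "distinct (v # s)" "s' \<noteq> []" "distinct (v' # s')"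
  shows "replicate (n + 2) v @ s = replicate (n' + 2) v' @ s' \<longleftrightarrow> n = n' \<and> v = v' \<and> s = s'"
proof
  assume eq: "replicate (n + 2) v @ s = replicate (n' + 2) v' @ s'"
  then have v: "v = v'" by simp
  have tk: "takeWhile (\<lambda>x. x = w) (replicate k w @ r) = replicate k w" if "w \<notin> set r" for k r and w :: 'a
    using that by (cases r) (auto simp: takeWhile_append)
  have "replicate (n + 2) v = replicate (n' + 2) v"
    using tk[of v s "n + 2"] tk[of v s' "n' + 2"] assms eq v by simp
  then have "n = n'" by (metis add_right_cancel length_replicate)
  then show "n = n' \<and> v = v' \<and> s = s'" using eq v by simp
qed simp

lemma block_in_orbit_tree_iff:
  assumes s: "s \<noteq> []" "distinct (v # s)"
  shows "replicate (n + 2) v @ s \<in> orbit_tree A orb \<longleftrightarrow> visits (\<lambda>y. y \<in> A n) orb (v # s)"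
proof
  assume "replicate (n + 2) v @ s \<in> orbit_tree A orb"
  then show "visits (\<lambda>y. y \<in> A n) orb (v # s)"
  proof (cases rule: orbit_tree_cases)
    case (1 k w)
    then have "set (replicate (n + 2) v @ s) \<subseteq> {w}" by auto
    moreover obtain u where "u \<in> set s" using s(1) by (cases s) auto
    ultimately show ?thesis using s(2) by auto
  next
    case (2 n' v' s')
    then have "n = n' \<and> v = v' \<and> s = s'"
      unfolding replicate_block_eq_iff[OF s 2(2,3)] by blast
    then show ?thesis using 2(4) by blast
  qed
next
  show "visits (\<lambda>y. y \<in> A n) orb (v # s) \<Longrightarrow> replicate (n + 2) v @ s \<in> orbit_tree A orb"
    using s unfolding orbit_tree_def by blast
qed

text \<open>Cutting off last letters shortens first \<open>s\<close> and then the block; therefore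
  all powers \<open>replicate k v\<close> belong to the tree, whatever the orbit. As the block has
  length at least two and \<open>s\<close> is nonempty, the words of length two are of the form
  \<open>[v, v]\<close>; and except in powers the last letter does not occur earlier.\<close>

lemma code_tree_orbit_tree: "code_tree (orbit_tree A orb)"
  unfolding code_tree_def
proof (intro conjI allI impI)
  show "[] \<notin> orbit_tree A orb" by (auto elim: orbit_tree_cases)
  show "[v] \<in> orbit_tree A orb" for v using replicate_in_orbit_tree[of 1 v] by simp
  show "t = [] \<or> t \<in> orbit_tree A orb" if "t @ [v] \<in> orbit_tree A orb" for t v
    using that
  proof (cases rule: orbit_tree_cases)
    case (1 k w)
    have "y = w" if "y \<in> set (t @ [v])" for y using that unfolding 1(2) by simp
    then have "replicate (length t) w = t" by (intro replicate_length_same) simp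
    then show ?thesis using replicate_in_orbit_tree[of "length t" w A orb] by (cases "t = []") (auto simp: Suc_le_eq)
  next
    case (2 n w s)
    then obtain s' where s': "s = s' @ [v]" by (metis append_butlast_last_id last_appendR last_snoc)
    then have t: "t = replicate (n + 2) w @ s'" using 2(1) by simp
    show ?thesis
    proof (cases "s' = []")
      case True
      then show ?thesis using replicate_in_orbit_tree[of "n + 2" w] t by simp
    next
      case False
      have "visits (\<lambda>y. y \<in> A n) orb (w # s')" using 2(4) visits_prefix[of _ _ "w # s'" "[v]"] s' by simp
      moreover have "distinct (w # s')" using 2(3) s' by simp
      ultimately show ?thesis unfolding t using block_in_orbit_tree_iff[OF False] by blast
    qed
  qed
  show "set t = {v}" if "t @ [v] \<in> orbit_tree A orb \<and> v \<in> set t" for t v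
    using that[THEN conjunct1]
  proof (cases rule: orbit_tree_cases)
    case (1 k w)
    have "y = w" if "y \<in> set (t @ [v])" for y using that unfolding 1(2) by simp
    then show ?thesis using that by auto
  next
    case (2 n w s)
    then obtain s' where s': "s = s' @ [v]" by (metis append_butlast_last_id last_appendR last_snoc)
    then have "t = replicate (n + 2) w @ s'" using 2(1) by simp
    then have "v \<in> insert w (set s')" using that by auto
    then show ?thesis using 2(3) s' by auto
  qed
  show "u = v" if "[u, v] \<in> orbit_tree A orb" for u v
    using that
  proof (cases rule: orbit_tree_cases)
    case (1 k w)
    have "y = w" if "y \<in> set [u, v]" for y using that unfolding 1(2) by simp
    from this[of u] this[of v] show ?thesis by simp
  next
    case (2 n w s)
    then have "length [u, v] = n + 2 + length s" by (metis length_append length_replicate)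
    then show ?thesis using 2(2) by simp
  qed
qed

section \<open>The tree of a point as a complete invariant of its orbit, up to relabelling\<close>

locale borel_S_infty_action =
  fixes X :: "'p topology" and act :: "(nat \<Rightarrow> nat) \<Rightarrow> 'p \<Rightarrow> 'p" and A :: "nat \<Rightarrow> 'p set"
  assumes action: "Borel_S_infty_action X act" and open_A: "\<And>n. openin X (A n)"
    and base_A: "\<And>U x. openin X U \<Longrightarrow> x \<in> U \<Longrightarrow> \<exists>n. x \<in> A n \<and> A n \<subseteq> U"
begin

sublocale group_action S_infty "topspace X" act
  using action by (simp add: Borel_S_infty_action_def)

lemma act_in: "bij g \<Longrightarrow> x \<in> topspace X \<Longrightarrow> act g x \<in> topspace X"
  using element_image by (simp add: carrier_S_infty)

lemma act_comp: "bij g \<Longrightarrow> bij h \<Longrightarrow> x \<in> topspace X \<Longrightarrow> act (g \<circ> h) x = act g (act h x)"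
  using composition_rule[of x g h] by (simp add: carrier_S_infty mult_S_infty)

lemma act_inj: "bij g \<Longrightarrow> x \<in> topspace X \<Longrightarrow> y \<in> topspace X \<Longrightarrow> act g x = act g y \<Longrightarrow> x = y"
  using inj_prop[of g] by (simp add: carrier_S_infty inj_on_def)

lemma act_id: "x \<in> topspace X \<Longrightarrow> act id x = x"
proof -
  assume x: "x \<in> topspace X"
  have "act id (act id x) = act id x" using act_comp[of id id x] x by simp
  then show ?thesis using act_inj[of id "act id x" x] act_in[of id x] x by simp
qed

definition visit_set :: "nat \<Rightarrow> 'p \<Rightarrow> (nat \<Rightarrow> nat) set" where
  "visit_set n x = {g. bij g \<and> act g x \<in> A n}"

definition tree :: "'p \<Rightarrow> nat list set" where
  "tree x = orbit_tree A (\<lambda>g. act g x)"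

lemma visits_iff: "visits (\<lambda>y. y \<in> A n) (\<lambda>g. act g x) s \<longleftrightarrow> \<not> meager (visit_set n x \<inter> inv_nbhd s)"
  by (simp add: visits_def visit_set_def)

lemma visit_set_Borel:
  shows "x \<in> topspace X \<Longrightarrow> localizable (visit_set n x)"
    and "{x \<in> topspace X. \<not> meager (visit_set n x \<inter> inv_nbhd s)} \<in> sets (borel_of X)"
proof -
  define B where "B = (\<lambda>(g, x). act g x) -` A n \<inter> space (borel_of (prod_topology S_infty_topology X))"
  have "A n \<in> sets (borel_of X)"
    using open_A by (simp add: sets_borel_of sigma_sets.Basic)
  then have "B \<in> sets (borel_of (prod_topology S_infty_topology X))"
    unfolding B_def using action by (intro measurable_sets) (auto simp: Borel_S_infty_action_def)
  moreover have "Polish_space X" using action by (simp add: Borel_S_infty_action_def)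
  ultimately have Q: "\<forall>x \<in> topspace X. localizable (fiber {g. bij g} B x)"
    "\<forall>s. {x \<in> topspace X. \<not> meager (fiber {g. bij g} B x \<inter> inv_nbhd s)} \<in> sets (borel_of X)"
    using category_quantifier by blast+
  have F: "fiber {g. bij g} B x = visit_set n x" if "x \<in> topspace X" for x
    using that by (auto simp: fiber_def B_def visit_set_def)
  show "x \<in> topspace X \<Longrightarrow> localizable (visit_set n x)" using Q(1) F by simp
  have "{x \<in> topspace X. \<not> meager (visit_set n x \<inter> inv_nbhd s)} =
      {x \<in> topspace X. \<not> meager (fiber {g. bij g} B x \<inter> inv_nbhd s)}"
    using F by auto
  then show "{x \<in> topspace X. \<not> meager (visit_set n x \<inter> inv_nbhd s)} \<in> sets (borel_of X)"
    using Q(2) by simp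
qed

lemma measurable_tree: "Measurable.pred (borel_of X) (\<lambda>x. t \<in> tree x)"
proof -
  have vis: "Measurable.pred (borel_of X) (\<lambda>x. visits (\<lambda>y. y \<in> A n) (\<lambda>g. act g x) s)" for n s
    unfolding pred_def visits_iff using visit_set_Borel(2) by simp
  have eq: "t \<in> tree x \<longleftrightarrow> (\<exists>k v. k \<ge> 1 \<and> t = replicate k v) \<or>
      (\<exists>n v s. t = replicate (n + 2) v @ s \<and> s \<noteq> [] \<and> distinct (v # s) \<and> visits (\<lambda>y. y \<in> A n) (\<lambda>g. act g x) (v # s))" for x
    unfolding tree_def orbit_tree_def by blast
  show ?thesis
    unfolding eq by (intro pred_intros_countable pred_intros_logic vis) simp_all
qed

lemma homeomorphic_map_right_translation:
  assumes "bij h"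
  shows "homeomorphic_map S_infty_topology S_infty_topology (\<lambda>g. g \<circ> h)"
proof -
  have cont: "continuous_map S_infty_topology S_infty_topology (\<lambda>g. g \<circ> k)" if "bij k" for k
  proof -
    have "continuous_on UNIV (\<lambda>g :: nat \<Rightarrow> nat. \<lambda>i. g (k i))"
      by (intro continuous_on_coordinatewise_then_product continuous_on_product_coordinates)
    then show ?thesis
      unfolding S_infty_topology_def carrier_S_infty
      using that by (auto simp: o_def[abs_def] bij_comp[unfolded o_def] intro: continuous_on_subset)
  qed
  let ?k = "inv_into UNIV h"
  have k: "bij ?k" "h \<circ> ?k = id" "?k \<circ> h = id"
    using assms by (simp_all add: bij_imp_bij_inv bij_is_inj bij_is_surj surj_iff[symmetric] inj_iff[symmetric])
  have "homeomorphic_maps S_infty_topology S_infty_topology (\<lambda>g. g \<circ> h) (\<lambda>g. g \<circ> ?k)"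
    unfolding homeomorphic_maps_def using cont assms k by (simp add: o_assoc[symmetric])
  then show ?thesis by (rule homeomorphic_maps_imp_map)
qed

text \<open>Composing \<open>g\<close> with the inverse of \<open>h\<close> gives a permutation that
  moves \<open>act h x\<close> to \<open>act g x\<close>, and that sends \<open>h (s ! i)\<close> to
  \<open>i\<close> when \<open>g\<close> sends \<open>s ! i\<close> to \<open>i\<close>. Right
  translations are homeomorphisms and preserve meagerness.\<close>

lemma meager_translate_visit_set:
  assumes h: "bij h" and x: "x \<in> topspace X"
  shows "meager (visit_set n (act h x) \<inter> inv_nbhd (map h s)) \<Longrightarrow> meager (visit_set n x \<inter> inv_nbhd s)"
proof -
  assume m: "meager (visit_set n (act h x) \<inter> inv_nbhd (map h s))"
  have "meager ((\<lambda>g. g \<circ> h) ` (visit_set n (act h x) \<inter> inv_nbhd (map h s)))"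
    using homeomorphic_map_right_translation[OF h] m by (rule meager_in_homeomorphic_image)
  moreover have "visit_set n x \<inter> inv_nbhd s \<subseteq> (\<lambda>g. g \<circ> h) ` (visit_set n (act h x) \<inter> inv_nbhd (map h s))"
  proof
    fix g assume g: "g \<in> visit_set n x \<inter> inv_nbhd s"
    let ?k = "inv_into UNIV h"
    have k: "bij ?k" and kh: "?k \<circ> h = id" "\<And>i. ?k (h i) = i"
      using h by (simp_all add: bij_imp_bij_inv bij_is_inj inj_iff[symmetric])
    have bg: "bij g" "act g x \<in> A n" "\<And>i. i < length s \<Longrightarrow> g (s ! i) = i"
      using g by (auto simp: visit_set_def inv_nbhd_def)
    have bgk: "bij (g \<circ> ?k)" using k bg(1) by (rule bij_comp)
    have gg: "(g \<circ> ?k) \<circ> h = g" using kh(1) by (simp add: o_assoc[symmetric])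
    have "act (g \<circ> ?k) (act h x) = act g x"
      using act_comp[OF bgk h x] gg by simp
    then have "g \<circ> ?k \<in> visit_set n (act h x) \<inter> inv_nbhd (map h s)"
      using bgk bg kh(2) by (simp add: visit_set_def inv_nbhd_def)
    then show "g \<in> (\<lambda>g. g \<circ> h) ` (visit_set n (act h x) \<inter> inv_nbhd (map h s))"
      using gg by (metis (no_types, lifting) image_eqI)
  qed
  ultimately show ?thesis by (rule meager_in_subset)
qed

lemma map_tree_subset:
  assumes h: "bij h" and x: "x \<in> topspace X"
  shows "map h ` tree x \<subseteq> tree (act h x)"
proof (rule image_subsetI)
  fix t assume "t \<in> tree x"
  then show "map h t \<in> tree (act h x)"
    unfolding tree_def
  proof (cases rule: orbit_tree_cases)
    case (1 k v)
    then show "map h t \<in> orbit_tree A (\<lambda>g. act g (act h x))"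
      using replicate_in_orbit_tree[of k "h v"] by simp
  next
    case (2 n v s)
    have "visits (\<lambda>y. y \<in> A n) (\<lambda>g. act g (act h x)) (map h (v # s))"
      using 2(4) meager_translate_visit_set[OF h x] unfolding visits_iff by blast
    moreover have "distinct (map h (v # s))"
      unfolding distinct_map using 2(3) inj_on_subset[OF bij_is_inj[OF h] subset_UNIV] by blast
    ultimately have "replicate (n + 2) (h v) @ map h s \<in> orbit_tree A (\<lambda>g. act g (act h x))"
      using 2(2) by (subst block_in_orbit_tree_iff) simp_all
    then show "map h t \<in> orbit_tree A (\<lambda>g. act g (act h x))"
      unfolding 2(1) by (simp only: map_append map_replicate)
  qed
qed

text \<open>The inclusion not covered by \<open>map_tree_subset\<close> is the same fact for the
  inverse permutation, applied to \<open>act h x\<close>.\<close>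

lemma tree_act:
  assumes h: "bij h" and x: "x \<in> topspace X"
  shows "tree (act h x) = map h ` tree x"
proof
  let ?k = "inv_into UNIV h"
  have k: "bij ?k" and kh: "?k \<circ> h = id" and hk: "\<And>i. h (?k i) = i"
    using h by (simp_all add: bij_imp_bij_inv bij_is_inj inj_iff[symmetric] bij_is_surj surj_f_inv_f)
  have "act ?k (act h x) = x"
    using act_comp[OF k h x] kh act_id[OF x] by simp
  then have "map ?k ` tree (act h x) \<subseteq> tree x"
    using map_tree_subset[OF k act_in[OF h x]] by simp
  then have "map h ` map ?k ` tree (act h x) \<subseteq> map h ` tree x" by (rule image_mono)
  moreover have "map h ` map ?k ` tree (act h x) = tree (act h x)"
    by (simp add: image_image o_def hk)
  ultimately show "tree (act h x) \<subseteq> map h ` tree x" by simp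
qed (rule map_tree_subset[OF h x])

text \<open>A nonmeager difference would be comeager in some basic open set. The word of that set is
  then visited from \<open>x\<close> but not from \<open>y\<close>, which makes the trees
  differ.\<close>

lemma visit_set_diff_meager:
  assumes x: "x \<in> topspace X" and y: "y \<in> topspace X" and eq: "tree x = tree y"
  shows "meager (visit_set n x - visit_set n y)"
proof (rule ccontr)
  let ?E = "visit_set n x - visit_set n y"
  assume ne: "\<not> meager ?E"
  have "?E \<inter> inv_nbhd [] = ?E" by (auto simp: inv_nbhd_def visit_set_def)
  with ne have ne': "\<not> meager (?E \<inter> inv_nbhd [])" by simp
  have "localizable ?E" using visit_set_Borel(1) x y by (intro localizable_diff)
  from this[unfolded localizable_def, THEN conjunct2, rule_format, OF ne']
  obtain s' where s': "inv_nbhd s' \<noteq> {}" "meager (inv_nbhd s' - ?E)"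
    by (elim exE conjE) (rule that)
  from s'(1) obtain g where g: "g \<in> inv_nbhd s'" by blast
  \<comment> \<open>Length two leaves a nonempty rest after the first letter, as words that encode a
    visit require.\<close>
  obtain s where s: "2 \<le> length s" "g \<in> inv_nbhd s" "inv_nbhd s \<subseteq> inv_nbhd s'"
    using inv_nbhd_basis[OF openin_inv_nbhd g, of 2] by blast
  have m: "meager (inv_nbhd s - ?E)"
    by (rule meager_in_subset[OF s'(2)]) (use s(3) in auto)
  have "meager (visit_set n y \<inter> inv_nbhd s)"
    by (rule meager_in_subset[OF m]) auto
  moreover have "\<not> meager (visit_set n x \<inter> inv_nbhd s)"
  proof
    assume "meager (visit_set n x \<inter> inv_nbhd s)"
    with m have "meager ((inv_nbhd s - ?E) \<union> (visit_set n x \<inter> inv_nbhd s))" by (rule meager_in_Un)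
    then have "meager (inv_nbhd s)" by (rule meager_in_subset) auto
    then show False using not_meager_inv_nbhd s(2) by blast
  qed
  moreover obtain v r where vr: "s = v # r" "r \<noteq> []"
    using s(1) by (cases s; cases "tl s") auto
  ultimately have "visits (\<lambda>y. y \<in> A n) (\<lambda>g. act g x) (v # r)" "\<not> visits (\<lambda>y. y \<in> A n) (\<lambda>g. act g y) (v # r)"
    unfolding visits_iff by simp_all
  moreover have "distinct (v # r)" using inv_nbhd_distinct[OF s(2)] vr by simp
  note block_in_orbit_tree_iff[OF vr(2) this]
  ultimately have "replicate (n + 2) v @ r \<in> tree x" "replicate (n + 2) v @ r \<notin> tree y"
    unfolding tree_def by blast+
  then show False using eq by simp
qed

text \<open>By the Baire category theorem some \<open>g\<close> avoids all the meager differences.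
  Then \<open>act g x\<close> and \<open>act g y\<close> lie in the same basic open sets and
  coincide, hence so do \<open>x\<close> and \<open>y\<close>.\<close>

lemma tree_inj:
  assumes x: "x \<in> topspace X" and y: "y \<in> topspace X" and eq: "tree x = tree y"
  shows "x = y"
proof -
  let ?D = "(\<Union>n. visit_set n x - visit_set n y) \<union> (\<Union>n. visit_set n y - visit_set n x)"
  have "meager (\<Union>n. visit_set n x - visit_set n y)" "meager (\<Union>n. visit_set n y - visit_set n x)"
    using visit_set_diff_meager x y eq by (auto intro!: meager_in_UN)
  then have m: "meager ?D"
    by (rule meager_in_Un)
  have "id \<in> inv_nbhd []" by (simp add: inv_nbhd_def)
  then have "\<not> meager (inv_nbhd [])" using not_meager_inv_nbhd by blast
  have "\<not> inv_nbhd [] \<subseteq> ?D"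
  proof
    assume "inv_nbhd [] \<subseteq> ?D"
    then have "meager (inv_nbhd [])" by (rule meager_in_subset[OF m])
    then show False using \<open>\<not> meager (inv_nbhd [])\<close> by contradiction
  qed
  then obtain g where g0: "g \<in> inv_nbhd []"
    "g \<notin> ?D"
    by (meson subsetI)
  have g: "bij g" "\<And>n. g \<in> visit_set n x \<longleftrightarrow> g \<in> visit_set n y"
    using g0 by (auto simp: inv_nbhd_def)
  have "act g x = act g y"
  proof (rule ccontr)
    assume ne: "act g x \<noteq> act g y"
    have "Hausdorff_space X"
      using action completely_metrizable_imp_metrizable_space metrizable_imp_Hausdorff_space
      by (auto simp: Borel_S_infty_action_def Polish_space_def)
    then obtain U V where UV: "openin X U" "act g x \<in> U" "act g y \<in> V" "disjnt U V"
      using ne act_in[OF g(1)] x y unfolding Hausdorff_space_def by metis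
    then obtain n where n: "act g x \<in> A n" "A n \<subseteq> U" using base_A by blast
    then have "act g y \<in> A n" using g by (auto simp: visit_set_def)
    then show False using n UV by (auto simp: disjnt_def)
  qed
  then show ?thesis using act_inj g(1) x y by blast
qed

lemma orbit_eqrel_iff_tree:
  assumes x: "x \<in> topspace X" and y: "y \<in> topspace X"
  shows "(x, y) \<in> orbit_eqrel X act \<longleftrightarrow> (\<exists>h. bij h \<and> tree y = map h ` tree x)"
proof
  assume "(x, y) \<in> orbit_eqrel X act"
  then obtain h where "bij h" "y = act h x"
    by (auto simp: orbit_eqrel_def orbit_def carrier_S_infty)
  then show "\<exists>h. bij h \<and> tree y = map h ` tree x" using tree_act x by blast
next
  assume "\<exists>h. bij h \<and> tree y = map h ` tree x"
  then obtain h where h: "bij h" "tree y = map h ` tree x" by blast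
  then have "tree y = tree (act h x)" using tree_act[OF h(1) x] by simp
  then have "y = act h x" using tree_inj[OF y act_in[OF h(1) x]] by simp
  then show "(x, y) \<in> orbit_eqrel X act"
    using x h(1) by (auto simp: orbit_eqrel_def orbit_def carrier_S_infty)
qed

end

theorem orbit_eqrel_reducible_chaotic:
  fixes C :: "'a topology" and d :: "'a metric" and X :: "'b topology"
  assumes C: "Cantor_space C" and d: "mtopology_of d = C" and act: "Borel_S_infty_action X act"
  shows "borel_reducible (borel_of X) (orbit_eqrel X act) (chaotic_homeos_borel C d) (chaotic_conjugacy C d)"
proof -
  obtain b where b: "cantor_coding C b" using Cantor_space_coding[OF C] .
  have "Polish_space X" using act by (simp add: Borel_S_infty_action_def)
  then obtain A :: "nat \<Rightarrow> 'b set" where "\<And>n. openin X (A n)" "\<And>U x. openin X U \<Longrightarrow> x \<in> U \<Longrightarrow> \<exists>n. x \<in> A n \<and> A n \<subseteq> U"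
    using Polish_space_countable_base by blast
  then interpret borel_S_infty_action X act A
    using act by unfold_locales
  have tree: "code_tree (tree x)" for x unfolding tree_def by (rule code_tree_orbit_tree)
  have "(\<lambda>x. cantor_shift C b (tree x)) \<in> measurable (borel_of X) (chaotic_homeos_borel C d)"
    by (rule measurable_cantor_shift[OF b d tree measurable_tree])
  then show ?thesis
    unfolding borel_reducible_def
    by (intro bexI[of _ "\<lambda>x. cantor_shift C b (tree x)"])
      (simp_all add: cantor_shift_conjugate_iff[OF b d tree tree] orbit_eqrel_iff_tree)
qed

section \<open>Coding homeomorphisms by the algebra of clopen sets\<close>

locale clopen_enumeration = cantor_coding C b for C :: "'p topology" and b +
  fixes cl :: "nat \<Rightarrow> 'p set"
  assumes Hausdorff: "Hausdorff_space C" and bij_cl: "bij_betw cl UNIV {U. openin C U \<and> closedin C U}"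
begin

abbreviation pre :: "('p \<Rightarrow> 'p) \<Rightarrow> 'p set \<Rightarrow> 'p set" where
  "pre T K \<equiv> {x \<in> topspace C. T x \<in> K}"

lemma openin_cl: "openin C (cl m)" and closedin_cl: "closedin C (cl m)"
  using bij_cl by (auto simp: bij_betw_def)

lemma ex_cl: "openin C U \<Longrightarrow> closedin C U \<Longrightarrow> \<exists>m. cl m = U"
proof -
  assume "openin C U" "closedin C U"
  then have "U \<in> range cl" using bij_cl by (simp add: bij_betw_def)
  then show ?thesis by auto
qed

lemma cl_inj: "cl m = cl n \<longleftrightarrow> m = n"
  using bij_cl by (auto simp: bij_betw_def inj_def)

lemma cl_separates:
  assumes "x \<in> topspace C" "y \<in> topspace C" "\<And>m. x \<in> cl m \<longleftrightarrow> y \<in> cl m"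
  shows "x = y"
proof (rule ccontr)
  assume "x \<noteq> y"
  then obtain k where k: "(x \<in> b k) \<noteq> (y \<in> b k)" using separating assms by blast
  obtain m where "cl m = topspace C \<inter> b k" using ex_cl open_test closed_test by blast
  then show False using assms(3)[of m] k assms(1,2) by blast
qed

section \<open>Stone duality for the clopen algebra\<close>

definition preserves :: "(nat \<Rightarrow> nat) \<Rightarrow> bool" where
  "preserves h \<longleftrightarrow> bij h \<and> (\<forall>m n. cl (h m) \<subseteq> cl (h n) \<longleftrightarrow> cl m \<subseteq> cl n)"

text \<open>The sets \<open>cl (h m)\<close> with \<open>x \<in> cl m\<close> form an ultrafilter of
  clopen sets, and \<open>y\<close> is its limit, found as a common point of the images of the
  cylinders around \<open>x\<close>. Only inclusion is preserved by assumption, but it determines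
  the bottom element and disjointness; the converse membership then follows by passing to
  complements.\<close>

lemma stone_point:
  assumes "preserves h" and x: "x \<in> topspace C"
  shows "\<exists>y \<in> topspace C. \<forall>m. y \<in> cl (h m) \<longleftrightarrow> x \<in> cl m"
proof -
  have h: "bij h" and mono: "\<And>m n. cl (h m) \<subseteq> cl (h n) \<longleftrightarrow> cl m \<subseteq> cl n"
    using assms(1) by (auto simp: preserves_def)
  have ex: "\<exists>m. cl (h m) = U" if "openin C U" "closedin C U" for U
    using ex_cl[OF that] h by (metis bij_pointE)
  obtain e where e: "cl e = {}" using ex_cl[of "{}"] by auto
  obtain e' where e': "cl (h e') = {}" using ex[of "{}"] by auto
  \<comment> \<open>The empty set is the image of some \<open>e'\<close>, as \<open>h\<close> is
    onto, and \<open>cl e\<close> is contained in \<open>cl e'\<close>.\<close>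
  have he: "cl (h e) = {}" using mono[of e e'] e e' by auto
  have disj: "cl (h m) \<inter> cl (h n) = {}" if "cl m \<inter> cl n = {}" for m n
  proof -
    obtain q where q: "cl (h q) = cl (h m) \<inter> cl (h n)"
      using ex[of "cl (h m) \<inter> cl (h n)"] openin_cl closedin_cl by (metis closedin_Int openin_Int)
    then have "cl q \<subseteq> cl m" "cl q \<subseteq> cl n" using mono by blast+
    then have "cl q \<subseteq> cl e" using that by blast
    then have "cl (h q) \<subseteq> cl (h e)" using mono by blast
    then show ?thesis using q he by blast
  qed
  have "\<forall>n. \<exists>m. cl m = cyl (rev_prefix (code x) n)"
    using ex_cl openin_cyl closedin_cyl by blast
  then obtain k where k: "\<And>n. cl (k n) = cyl (rev_prefix (code x) n)" by metis
  have "\<exists>y \<in> topspace C. \<forall>n. y \<in> cl (h (k n))"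
  proof (rule cyl_nest)
    show "closedin C (cl (h (k n)))" for n by (rule closedin_cl)
    show "cl (h (k n)) \<noteq> {}" for n
    proof
      assume "cl (h (k n)) = {}"
      then have "cl (k n) \<subseteq> cl e" using mono[of "k n" e] by simp
      moreover have "x \<in> cl (k n)" unfolding k using x by (simp add: in_cyl_iff)
      ultimately show False using e by blast
    qed
    show "decseq (\<lambda>n. cl (h (k n)))"
    proof (rule decseq_SucI)
      fix n
      have "cl (k (Suc n)) \<subseteq> cl (k n)" unfolding k by (auto simp: in_cyl_iff)
      then show "cl (h (k (Suc n))) \<subseteq> cl (h (k n))" using mono by simp
    qed
  qed
  then obtain y where y: "y \<in> topspace C" "\<And>n. y \<in> cl (h (k n))" by blast
  have imp: "y \<in> cl (h m)" if "x \<in> cl m" for m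
  proof -
    obtain n where "cyl (rev_prefix (code x) n) \<subseteq> cl m" using cyl_basis[OF openin_cl \<open>x \<in> cl m\<close>] by blast
    then have "cl (h (k n)) \<subseteq> cl (h m)" using mono[of "k n" m] k by simp
    then show ?thesis using y(2)[of n] by blast
  qed
  have "x \<in> cl m" if "y \<in> cl (h m)" for m
  proof (rule ccontr)
    assume nx: "x \<notin> cl m"
    obtain m' where m': "cl m' = topspace C - cl m"
      using ex_cl[of "topspace C - cl m"] openin_cl closedin_cl by (metis closedin_def closedin_diff closedin_topspace openin_diff openin_topspace)
    then have "y \<in> cl (h m')" using imp[of m'] nx x by simp
    moreover have "cl (h m) \<inter> cl (h m') = {}" by (rule disj) (use m' in blast)
    ultimately show False using that by blast
  qed
  then show ?thesis using y(1) imp by blast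
qed

lemma preserves_inv: "preserves h \<Longrightarrow> preserves (inv_into UNIV h)"
proof -
  assume h: "preserves h"
  then have b: "bij h" by (simp add: preserves_def)
  then have "h (inv_into UNIV h m) = m" for m by (simp add: bij_is_surj surj_f_inv_f)
  then show ?thesis
    using h bij_imp_bij_inv[OF b] unfolding preserves_def by metis
qed

text \<open>Every clopen set is some \<open>cl (h m)\<close>, with preimage \<open>cl m\<close>,
  which gives continuity. Surjectivity is \<open>stone_point\<close> for the inverse of
  \<open>h\<close>, and continuous bijections of a compact Hausdorff space are
  homeomorphisms.\<close>

lemma stone_homeomorphism:
  assumes h: "preserves h"
  shows "\<exists>\<phi>. homeomorphic_map C C \<phi> \<and> (\<forall>x \<in> topspace C. \<forall>m. \<phi> x \<in> cl (h m) \<longleftrightarrow> x \<in> cl m)"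
proof -
  have bh: "bij h" using h by (simp add: preserves_def)
  have hk: "h (inv_into UNIV h m) = m" for m using bh by (simp add: bij_is_surj surj_f_inv_f)
  have "\<forall>x. \<exists>y. x \<in> topspace C \<longrightarrow> y \<in> topspace C \<and> (\<forall>m. y \<in> cl (h m) \<longleftrightarrow> x \<in> cl m)"
    using stone_point[OF h] by blast
  then obtain \<phi> where \<phi>: "\<And>x. x \<in> topspace C \<Longrightarrow> \<phi> x \<in> topspace C"
    "\<And>x m. x \<in> topspace C \<Longrightarrow> \<phi> x \<in> cl (h m) \<longleftrightarrow> x \<in> cl m" by metis
  have "continuous_map C C \<phi>"
    unfolding continuous_map_def
  proof (intro conjI allI impI)
    fix U assume U: "openin C U"
    show "openin C (pre \<phi> U)"
    proof (subst openin_subopen, intro ballI)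
      fix x assume x: "x \<in> pre \<phi> U"
      obtain n where n: "cyl (rev_prefix (code (\<phi> x)) n) \<subseteq> U" using cyl_basis[OF U, of "\<phi> x"] x by blast
      obtain k where k: "cl k = cyl (rev_prefix (code (\<phi> x)) n)" using ex_cl openin_cyl closedin_cyl by blast
      define m where "m = inv_into UNIV h k"
      have m: "cl (h m) \<subseteq> U" using n k hk by (simp add: m_def)
      have "\<phi> x \<in> cl (h m)" using x \<phi>(1) unfolding m_def hk k by (simp add: in_cyl_iff)
      then have "x \<in> cl m" using \<phi>(2) x by blast
      moreover have "cl m \<subseteq> pre \<phi> U"
        using openin_subset[OF openin_cl[of m]] \<phi>(2) m by blast
      ultimately show "\<exists>T. openin C T \<and> x \<in> T \<and> T \<subseteq> pre \<phi> U"
        using openin_cl by blast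
    qed
  qed (use \<phi>(1) in auto)
  moreover have "inj_on \<phi> (topspace C)"
  proof (rule inj_onI)
    fix x y assume "x \<in> topspace C" "y \<in> topspace C" "\<phi> x = \<phi> y"
    then show "x = y" using cl_separates \<phi>(2) by metis
  qed
  moreover have "\<exists>x \<in> topspace C. \<phi> x = y" if y: "y \<in> topspace C" for y
  proof -
    obtain x where x: "x \<in> topspace C" "\<And>m. x \<in> cl (inv_into UNIV h m) \<longleftrightarrow> y \<in> cl m"
      using stone_point[OF preserves_inv[OF h] y] by blast
    have "\<phi> x \<in> cl m \<longleftrightarrow> y \<in> cl m" for m
      using \<phi>(2)[OF x(1), of "inv_into UNIV h m"] x(2)[of m] hk by simp
    then have "\<phi> x = y" using cl_separates[OF \<phi>(1)[OF x(1)] y] by blast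
    then show ?thesis using x(1) by blast
  qed
  then have "\<phi> ` topspace C = topspace C" using \<phi>(1) by blast
  ultimately have "homeomorphic_map C C \<phi>"
    using continuous_imp_homeomorphic_map compact Hausdorff by blast
  then show ?thesis using \<phi>(2) by blast
qed

text \<open>A structure on the indices with two binary relations: inclusion of clopen sets, and the
  graph of the map taking a clopen set to its preimage. Truth values are written as reals, so that
  the codes lie in a countable product of real lines, a Polish space.\<close>

definition sys_code :: "('p \<Rightarrow> 'p) \<Rightarrow> bool \<times> nat \<times> nat \<Rightarrow> real" where
  "sys_code T = (\<lambda>(c, m, n). of_bool (if c then cl m \<subseteq> cl n else pre T (cl m) = cl n))"

lemma sys_code_eq_iff:
  assumes h: "bij h"
  shows "(\<forall>c m n. sys_code S (c, h m, h n) = sys_code T (c, m, n)) \<longleftrightarrow> preserves h \<and>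
    (\<forall>m n. pre S (cl (h m)) = cl (h n) \<longleftrightarrow> pre T (cl m) = cl n)"
proof -
  have ob: "(of_bool p = (of_bool q :: real)) \<longleftrightarrow> p = q" for p q by (cases p; cases q) auto
  show ?thesis unfolding sys_code_def preserves_def all_bool_eq prod.case ob if_True if_False using h by blast
qed

text \<open>A conjugacy permutes the clopen sets and carries both relations along. Conversely, an
  isomorphism of the structures induces a homeomorphism by Stone duality. It intertwines
  \<open>T\<close> and \<open>S\<close>, because clopen sets separate points and the preimage
  relation decides to which of them the two images belong.\<close>

lemma conjugate_iff_sys_code:
  assumes T: "homeomorphic_map C C T" and S: "homeomorphic_map C C S"
  shows "conjugate_systems C T C S \<longleftrightarrow> (\<exists>h. bij h \<and> (\<forall>c m n. sys_code S (c, h m, h n) = sys_code T (c, m, n)))"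
proof -
  have TC: "T x \<in> topspace C" and SC: "S x \<in> topspace C" if "x \<in> topspace C" for x
    using homeomorphic_imp_surjective_map[OF T] homeomorphic_imp_surjective_map[OF S] that by blast+
  have clC: "cl m \<subseteq> topspace C" for m using openin_subset[OF openin_cl] .
  show ?thesis
  proof
    assume "conjugate_systems C T C S"
    then obtain \<phi> where \<phi>: "homeomorphic_map C C \<phi>" "\<And>x. x \<in> topspace C \<Longrightarrow> \<phi> (T x) = S (\<phi> x)"
      by (auto simp: conjugate_systems_def)
    have inj: "inj_on \<phi> (topspace C)" and sur: "\<phi> ` topspace C = topspace C"
      using \<phi>(1) homeomorphic_imp_injective_map homeomorphic_imp_surjective_map by blast+
    have "\<exists>k. cl k = \<phi> ` cl m" for m
      using ex_cl homeomorphic_map_openness[OF \<phi>(1) clC, of m] homeomorphic_map_closedness[OF \<phi>(1) clC, of m]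
        openin_cl closedin_cl by simp
    then obtain h where h: "\<And>m. cl (h m) = \<phi> ` cl m" by metis
    have img: "\<phi> ` A \<subseteq> \<phi> ` B \<longleftrightarrow> A \<subseteq> B" if "A \<subseteq> topspace C" "B \<subseteq> topspace C" for A B
      using inj_on_image_subset_iff[OF inj that] .
    have in_img: "\<phi> x \<in> cl (h m) \<longleftrightarrow> x \<in> cl m" if "x \<in> topspace C" for x m
      unfolding h using inj_on_image_mem_iff[OF inj that clC] .
    have mono: "cl (h m) \<subseteq> cl (h n) \<longleftrightarrow> cl m \<subseteq> cl n" for m n
      unfolding h using img clC by blast
    have "inj h"
      by (rule injI) (metis cl_inj mono subset_antisym order_refl)
    moreover have "\<exists>m. h m = k" for k
    proof -
      define A where "A = pre \<phi> (cl k)"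
      have cont: "continuous_map C C \<phi>" using \<phi>(1) homeomorphic_imp_continuous_map by blast
      have "openin C A" "closedin C A"
        unfolding A_def using openin_continuous_map_preimage[OF cont openin_cl] closedin_continuous_map_preimage[OF cont closedin_cl] .
      then obtain m where m: "cl m = A" using ex_cl by blast
      have "\<phi> ` A = cl k"
      proof (intro equalityI subsetI)
        show "y \<in> cl k" if "y \<in> \<phi> ` A" for y using that by (auto simp: A_def)
        fix y assume y: "y \<in> cl k"
        then have "y \<in> \<phi> ` topspace C" using clC[of k] sur by auto
        then obtain x where "x \<in> topspace C" "y = \<phi> x" by auto
        then show "y \<in> \<phi> ` A" using y by (auto simp: A_def)
      qed
      then show ?thesis using h[of m] m cl_inj by metis
    qed
    then have "surj h" by (metis surj_def)
    ultimately have bh: "bij h" by (simp add: bij_def)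
    have "pre S (cl (h m)) = \<phi> ` pre T (cl m)" for m
    proof (intro equalityI subsetI)
      fix y assume y: "y \<in> pre S (cl (h m))"
      then obtain x where x: "x \<in> topspace C" "y = \<phi> x" using sur by blast
      then have "\<phi> (T x) \<in> cl (h m)" using y \<phi>(2) by simp
      then show "y \<in> \<phi> ` pre T (cl m)" using in_img[OF TC[OF x(1)]] x by blast
    next
      fix y assume "y \<in> \<phi> ` pre T (cl m)"
      then obtain x where x: "x \<in> topspace C" "T x \<in> cl m" "y = \<phi> x" by blast
      then have "S y \<in> cl (h m)" using \<phi>(2)[OF x(1)] in_img[OF TC[OF x(1)]] by metis
      moreover have "y \<in> topspace C" using x sur by blast
      ultimately show "y \<in> pre S (cl (h m))" by simp
    qed
    moreover have "\<phi> ` A = \<phi> ` B \<longleftrightarrow> A = B" if "A \<subseteq> topspace C" "B \<subseteq> topspace C" for A B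
      using inj_on_image_eq_iff[OF inj that] .
    ultimately have pre_iff: "pre S (cl (h m)) = cl (h n) \<longleftrightarrow> pre T (cl m) = cl n" for m n
      using clC[of n] by (simp add: h)
    have "preserves h" unfolding preserves_def using bh mono by simp
    then have "\<forall>c m n. sys_code S (c, h m, h n) = sys_code T (c, m, n)"
      unfolding sys_code_eq_iff[OF bh] using pre_iff by simp
    then show "\<exists>h. bij h \<and> (\<forall>c m n. sys_code S (c, h m, h n) = sys_code T (c, m, n))"
      using bh by (intro exI[of _ h] conjI)
  next
    assume "\<exists>h. bij h \<and> (\<forall>c m n. sys_code S (c, h m, h n) = sys_code T (c, m, n))"
    then obtain h where bh: "bij h" and h: "preserves h"
      and eq: "\<And>m n. pre S (cl (h m)) = cl (h n) \<longleftrightarrow> pre T (cl m) = cl n"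
      using sys_code_eq_iff by blast
    obtain \<phi> where \<phi>: "homeomorphic_map C C \<phi>" "\<And>x m. x \<in> topspace C \<Longrightarrow> \<phi> x \<in> cl (h m) \<longleftrightarrow> x \<in> cl m"
      using stone_homeomorphism[OF h] by blast
    have \<phi>C: "\<phi> x \<in> topspace C" if "x \<in> topspace C" for x
      using homeomorphic_imp_surjective_map[OF \<phi>(1)] that by blast
    have contT: "continuous_map C C T" using T homeomorphic_imp_continuous_map by blast
    have "\<phi> (T x) = S (\<phi> x)" if x: "x \<in> topspace C" for x
    proof (rule cl_separates)
      show "\<phi> (T x) \<in> topspace C" "S (\<phi> x) \<in> topspace C" using x \<phi>C TC SC by blast+
      fix k
      obtain m where m: "k = h m" using bh by (metis bij_pointE)
      obtain n where n: "cl n = pre T (cl m)"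
        using ex_cl openin_continuous_map_preimage[OF contT openin_cl] closedin_continuous_map_preimage[OF contT closedin_cl] by blast
      have "\<phi> (T x) \<in> cl k \<longleftrightarrow> x \<in> cl n" unfolding m n using \<phi>(2)[OF TC[OF x]] x by simp
      also have "\<dots> \<longleftrightarrow> \<phi> x \<in> pre S (cl (h m))"
        using eq[of m n] n \<phi>(2)[OF x, of n] by simp
      finally show "\<phi> (T x) \<in> cl k \<longleftrightarrow> S (\<phi> x) \<in> cl k" using \<phi>C[OF x] m by simp
    qed
    then show "conjugate_systems C T C S" using \<phi>(1) unfolding conjugate_systems_def by blast
  qed
qed

text \<open>The preimage of a clopen set is locally constant in \<open>T\<close>: the partition into
  \<open>cl m\<close> and its complement has a Lebesgue number, and maps closer than that send each
  point to the same side.\<close>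

lemma continuous_map_sys_code:
  assumes d: "mtopology_of d = C"
  shows "continuous_map (subtopology (mtopology_of (cfunspace C d)) (chaotic_homeos C d)) euclidean sys_code"
proof -
  let ?H = "subtopology (mtopology_of (cfunspace C d)) (chaotic_homeos C d)"
  interpret F: Metric_space "mspace (cfunspace C d)" "mdist (cfunspace C d)" by (rule Metric_space_mspace_mdist)
  interpret D: Metric_space "mspace d" "mdist d" by simp
  have topD: "D.mtopology = C" using d by (simp add: mtopology_of_def)
  have topC: "topspace C = mspace d" using topD by auto
  have local: "\<exists>e>0. \<forall>S \<in> chaotic_homeos C d. mdist (cfunspace C d) T S < e \<longrightarrow>
      pre S (cl m) = pre T (cl m)" if T: "T \<in> chaotic_homeos C d" for T m
  proof -
    have "compactin D.mtopology (topspace C)" unfolding topD using compact by (simp add: compact_space_def)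
    moreover have "topspace C \<subseteq> \<Union>{cl m, topspace C - cl m}" by auto
    moreover have "openin D.mtopology U" if "U \<in> {cl m, topspace C - cl m}" for U
      unfolding topD using that openin_cl[of m] openin_diff[OF openin_topspace closedin_cl[of m]] by auto
    ultimately obtain e where e: "e > 0" "\<And>y. y \<in> topspace C \<Longrightarrow> \<exists>U \<in> {cl m, topspace C - cl m}. D.mball y e \<subseteq> U"
      using D.lebesgue_number[of "topspace C" "{cl m, topspace C - cl m}"] by blast
    show ?thesis
    proof (intro exI[of _ e] conjI ballI impI)
      fix S assume S: "S \<in> chaotic_homeos C d" and close: "mdist (cfunspace C d) T S < e"
      have TS: "T \<in> mspace (cfunspace C d)" "S \<in> mspace (cfunspace C d)"
        using T S unfolding chaotic_homeos_def by blast+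
      have "S x \<in> cl m \<longleftrightarrow> T x \<in> cl m" if x: "x \<in> topspace C" for x
      proof -
        have in_C: "T x \<in> topspace C" "S x \<in> topspace C" using TS x topC by auto
        have "mdist d (T x) (S x) < e"
          using cfunspace_mdist_lt[OF _ TS close x] compact by (simp add: compact_space_def)
        then have "S x \<in> D.mball (T x) e" "T x \<in> D.mball (T x) e" using in_C e(1) topC by auto
        moreover obtain U where "U \<in> {cl m, topspace C - cl m}" "D.mball (T x) e \<subseteq> U" using e(2)[OF in_C(1)] by blast
        ultimately show ?thesis by blast
      qed
      then show "pre S (cl m) = pre T (cl m)" by blast
    qed (use e(1) in simp)
  qed
  have coord: "continuous_map ?H euclidean (\<lambda>T. sys_code T p)" for p
  proof -
    obtain c m n where p: "p = (c, m, n)" by (cases p)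
    have "openin ?H {T \<in> topspace ?H. sys_code T p \<in> U}" for U
    proof (subst openin_subopen, intro ballI)
      fix T assume T: "T \<in> {T \<in> topspace ?H. sys_code T p \<in> U}"
      then have TH: "T \<in> chaotic_homeos C d" "T \<in> mspace (cfunspace C d)" by auto
      obtain e where e: "e > 0" "\<And>S. S \<in> chaotic_homeos C d \<Longrightarrow> mdist (cfunspace C d) T S < e \<Longrightarrow>
          pre S (cl m) = pre T (cl m)"
        using local[OF TH(1), of m] by blast
      let ?B = "F.mball T e \<inter> chaotic_homeos C d"
      have "openin ?H ?B"
        using F.openin_mball[of T e] unfolding mtopology_of_def openin_subtopology by blast
      moreover have "T \<in> ?B" using TH e(1) F.centre_in_mball_iff by blast
      moreover have "?B \<subseteq> {T \<in> topspace ?H. sys_code T p \<in> U}"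
      proof
        fix S assume S: "S \<in> ?B"
        then have S': "S \<in> mspace (cfunspace C d)" "mdist (cfunspace C d) T S < e" "S \<in> chaotic_homeos C d"
          unfolding F.in_mball Int_iff by blast+
        then have "pre S (cl m) = pre T (cl m)" using e(2)[OF S'(3,2)] by simp
        then have "sys_code S p = sys_code T p" by (simp add: sys_code_def p)
        then show "S \<in> {T \<in> topspace ?H. sys_code T p \<in> U}" using S' T by (simp del: mspace_cfunspace)
      qed
      ultimately show "\<exists>V. openin ?H V \<and> T \<in> V \<and> V \<subseteq> {T \<in> topspace ?H. sys_code T p \<in> U}" by blast
    qed
    then show ?thesis unfolding continuous_map_def by simp
  qed
  have "continuous_map ?H (product_topology (\<lambda>i. euclidean) UNIV) sys_code"
    unfolding continuous_map_componentwise_UNIV using coord by blast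
  then show ?thesis unfolding euclidean_product_topology .
qed

end

section \<open>The logic action on structures with the natural numbers as universe\<close>

definition index_action :: "(nat \<Rightarrow> nat) \<Rightarrow> (bool \<times> nat \<times> nat \<Rightarrow> real) \<Rightarrow> bool \<times> nat \<times> nat \<Rightarrow> real" where
  "index_action h y = (\<lambda>(c, m, n). y (c, inv_into UNIV h m, inv_into UNIV h n))"

lemma index_action_eq_iff:
  assumes h: "bij h"
  shows "z = index_action h y \<longleftrightarrow> (\<forall>c m n. z (c, h m, h n) = y (c, m, n))"
proof
  have hk: "h (inv_into UNIV h m) = m" "inv_into UNIV h (h m) = m" for m
    using h by (simp_all add: bij_is_surj surj_f_inv_f bij_is_inj)
  show "z = index_action h y \<Longrightarrow> \<forall>c m n. z (c, h m, h n) = y (c, m, n)"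
    by (simp add: index_action_def hk)
  assume z: "\<forall>c m n. z (c, h m, h n) = y (c, m, n)"
  show "z = index_action h y"
  proof (rule ext)
    fix p :: "bool \<times> nat \<times> nat"
    obtain c m n where p: "p = (c, m, n)" by (cases p)
    have "z (c, h (inv_into UNIV h m), h (inv_into UNIV h n)) = y (c, inv_into UNIV h m, inv_into UNIV h n)"
      using z by blast
    then show "z p = index_action h y p" by (simp add: p hk index_action_def)
  qed
qed

lemma index_action_comp:
  assumes g: "bij g" and h: "bij h"
  shows "index_action (g \<circ> h) y = index_action g (index_action h y)"
proof -
  have "inv_into UNIV (g \<circ> h) = inv_into UNIV h \<circ> inv_into UNIV g"
    using g h by (rule o_inv_distrib)
  then show ?thesis by (simp add: index_action_def fun_eq_iff)
qed

lemma group_action_index_action: "group_action S_infty UNIV index_action"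
proof -
  have id: "index_action id y = y" for y by (auto simp: index_action_def)
  have bij: "bij (index_action g)" if g: "bij g" for g
  proof (rule bijI')
    let ?k = "inv_into UNIV g"
    have k: "bij ?k" "g \<circ> ?k = id" "?k \<circ> g = id"
      using g by (simp_all add: bij_imp_bij_inv bij_is_inj bij_is_surj surj_iff[symmetric] inj_iff[symmetric])
    have kg: "index_action ?k (index_action g y) = y" "index_action g (index_action ?k y) = y" for y
      using index_action_comp[OF k(1) g, of y] index_action_comp[OF g k(1), of y] k id by simp_all
    show "(index_action g x = index_action g y) = (x = y)" for x y using kg(1) by metis
    show "\<exists>x. y = index_action g x" for y using kg(2) by metis
  qed
  have "index_action (g \<otimes>\<^bsub>S_infty\<^esub> h) = index_action g \<otimes>\<^bsub>BijGroup UNIV\<^esub> index_action h"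
    if "bij g" "bij h" for g h
    using that bij index_action_comp[OF that]
    by (auto simp: mult_S_infty BijGroup_def Bij_def extensional_def compose_def)
  then have "index_action \<in> hom S_infty (BijGroup UNIV)"
    using bij by (intro homI) (auto simp: carrier_S_infty BijGroup_def Bij_def extensional_def)
  moreover have "group S_infty" unfolding S_infty_def by (rule group_BijGroup)
  ultimately show ?thesis
    unfolding group_action_def group_hom_def group_hom_axioms_def using group_BijGroup by blast
qed

text \<open>A coordinate of the image is the coordinate of \<open>y\<close> at the preimages of
  \<open>m\<close> and \<open>n\<close> under \<open>g\<close>. That these preimages are
  \<open>i\<close> and \<open>k\<close> is an open condition on \<open>g\<close>, so preimages of
  open sets are unions of open rectangles.\<close>

lemma continuous_index_action:
  "continuous_map (prod_topology S_infty_topology euclidean) euclidean (\<lambda>(g, y). index_action g y)"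
proof -
  let ?P = "prod_topology S_infty_topology (euclidean :: (bool \<times> nat \<times> nat \<Rightarrow> real) topology)"
  have "continuous_map ?P euclidean (\<lambda>p. index_action (fst p) (snd p) q)" for q
  proof -
    obtain c m n where q: "q = (c, m, n)" by (cases q)
    have "openin ?P
        {p \<in> topspace ?P. index_action (fst p) (snd p) q \<in> U}" if U: "open U" for U
    proof -
      define G where "G i k = {g. bij g} \<inter> ({g :: nat \<Rightarrow> nat. g i = m} \<inter> {g. g k = n})" for i k
      define V where "V i k = {y :: bool \<times> nat \<times> nat \<Rightarrow> real. y (c, i, k) \<in> U}" for i k
      have G: "openin S_infty_topology (G i k)" for i k
        unfolding G_def using open_nat_coordinate by (intro openin_S_inftyI open_Int)
      have "open ((\<lambda>y :: bool \<times> nat \<times> nat \<Rightarrow> real. y (c, i, k)) -` U)" for i k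
        by (rule open_vimage[OF U]) simp
      then have V: "open (V i k)" for i k by (simp add: V_def vimage_def)
      have eq: "{p \<in> topspace ?P. index_action (fst p) (snd p) q \<in> U} =
          \<Union>((\<lambda>(i, k). G i k \<times> V i k) ` UNIV)"
      proof (intro equalityI subsetI)
        fix p assume p: "p \<in> {p \<in> topspace ?P. index_action (fst p) (snd p) q \<in> U}"
        obtain g y where gy: "p = (g, y)" by (cases p)
        have g: "bij g" using p gy by simp
        then have "g (inv_into UNIV g m) = m" "g (inv_into UNIV g n) = n" by (simp_all add: bij_is_surj surj_f_inv_f)
        then have "p \<in> G (inv_into UNIV g m) (inv_into UNIV g n) \<times> V (inv_into UNIV g m) (inv_into UNIV g n)"
          using p g by (simp add: gy G_def V_def index_action_def q)
        then show "p \<in> \<Union>((\<lambda>(i, k). G i k \<times> V i k) ` UNIV)"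
          by (intro UnionI[OF imageI[of "(inv_into UNIV g m, inv_into UNIV g n)"]]) simp_all
      next
        fix p assume "p \<in> \<Union>((\<lambda>(i, k). G i k \<times> V i k) ` UNIV)"
        then obtain i k where ik: "p \<in> G i k \<times> V i k" by auto
        obtain g y where gy: "p = (g, y)" by (cases p)
        have g: "bij g" "g i = m" "g k = n" "y (c, i, k) \<in> U" using ik by (auto simp: gy G_def V_def)
        then have "inv_into UNIV g m = i" "inv_into UNIV g n = k" by (auto simp: bij_is_inj)
        then show "p \<in> {p \<in> topspace ?P. index_action (fst p) (snd p) q \<in> U}"
          using g by (simp add: gy index_action_def q)
      qed
      have op: "openin ?P (G i k \<times> V i k)" for i k
        using G[of i k] V[of i k] by (simp add: openin_prod_Times_iff)
      show ?thesis unfolding eq by (intro openin_Union) (use op in auto)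
    qed
    then show ?thesis unfolding continuous_map_def by simp
  qed
  then have "continuous_map ?P (product_topology (\<lambda>i. euclidean) UNIV)
      (\<lambda>p. index_action (fst p) (snd p))"
    unfolding continuous_map_componentwise_UNIV by blast
  then show ?thesis unfolding euclidean_product_topology by (simp add: case_prod_beta')
qed

lemma Borel_index_action: "Borel_S_infty_action euclidean index_action"
proof -
  have "second_countable (euclidean :: (bool \<times> nat \<times> nat \<Rightarrow> real) topology)"
  proof -
    obtain B :: "(bool \<times> nat \<times> nat \<Rightarrow> real) set set" where B: "countable B" "topological_basis B"
      using ex_countable_basis by blast
    have "\<exists>V \<in> B. x \<in> V \<and> V \<subseteq> U" if "open U" "x \<in> U" for U x
      by (rule topological_basisE[OF B(2) that]) (intro bexI conjI)
    then show ?thesis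
      unfolding second_countable_def using B topological_basis_open by (intro exI[of _ B]) auto
  qed
  then have "Polish_space (euclidean :: (bool \<times> nat \<times> nat \<Rightarrow> real) topology)"
    unfolding Polish_space_def using completely_metrizable_space_euclidean second_countable_imp_separable_space by blast
  then show ?thesis
    unfolding Borel_S_infty_action_def
    using group_action_index_action continuous_map_measurable_borel_of[OF continuous_index_action] by simp
qed

theorem chaotic_conjugacy_reducible_index_action:
  fixes C :: "'a topology" and d :: "'a metric"
  assumes C: "Cantor_space C" and d: "mtopology_of d = C"
  shows "borel_reducible (chaotic_homeos_borel C d) (chaotic_conjugacy C d)
    (borel_of euclidean) (orbit_eqrel euclidean index_action)"
proof -
  obtain b where b: "cantor_coding C b" using Cantor_space_coding[OF C] .
  interpret cantor_coding C b by fact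
  define cl where "cl = from_nat_into {U. openin C U \<and> closedin C U}"
  interpret clopen_enumeration C b cl
  proof
    show "Hausdorff_space C" using C metrizable_imp_Hausdorff_space by (auto simp: Cantor_space_def)
    show "bij_betw cl UNIV {U. openin C U \<and> closedin C U}"
      unfolding cl_def using countable_clopen infinite_clopen by (rule bij_betw_from_nat_into)
  qed
  have sp: "space (chaotic_homeos_borel C d) = chaotic_homeos C d"
    by (auto simp: chaotic_homeos_borel_def chaotic_homeos_def)
  have "(T, S) \<in> chaotic_conjugacy C d \<longleftrightarrow> (sys_code T, sys_code S) \<in> orbit_eqrel euclidean index_action"
    if "T \<in> chaotic_homeos C d" "S \<in> chaotic_homeos C d" for T S
  proof -
    have TS: "homeomorphic_map C C T" "homeomorphic_map C C S" using that by (auto simp: chaotic_homeos_def)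
    have "(sys_code T, sys_code S) \<in> orbit_eqrel euclidean index_action \<longleftrightarrow>
        (\<exists>h. bij h \<and> sys_code S = index_action h (sys_code T))"
      by (auto simp: orbit_eqrel_def orbit_def carrier_S_infty)
    also have "\<dots> \<longleftrightarrow> conjugate_systems C T C S"
      using conjugate_iff_sys_code[OF TS] index_action_eq_iff by blast
    finally show ?thesis using that by (simp add: chaotic_conjugacy_def)
  qed
  then show ?thesis
    unfolding borel_reducible_def sp
    using continuous_map_measurable_borel_of[OF continuous_map_sys_code[OF d]]
    by (intro bexI[of _ sys_code]) (auto simp: chaotic_homeos_borel_def)
qed

theorem mainTheorem1:
  fixes C :: "'a topology" and d :: "'a metric"
    and X :: "'b topology" and a :: "(nat \<Rightarrow> nat) \<Rightarrow> 'b \<Rightarrow> 'b"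
  assumes "Cantor_space C" and "mtopology_of d = C"
    and "universal_S_infty_action X a"
  shows "borel_bireducible
           (chaotic_homeos_borel C d) (chaotic_conjugacy C d)
           (borel_of X) (orbit_eqrel X a)"
proof -
  have action: "Borel_S_infty_action X a"
    using assms(3) by (simp add: universal_S_infty_action_def)
  \<comment> \<open>The index action lives on a space of real-valued functions, so universality is
    used in its form for arbitrary types.\<close>
  have "borel_reducible (chaotic_homeos_borel C d) (chaotic_conjugacy C d) (borel_of X) (orbit_eqrel X a)"
    by (rule borel_reducible_trans[OF chaotic_conjugacy_reducible_index_action[OF assms(1,2)]
          universal_S_infty_actionD[OF assms(3) Borel_index_action]])
  then show ?thesis
    unfolding borel_bireducible_def using orbit_eqrel_reducible_chaotic[OF assms(1,2) action] by blast
qed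

end
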